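(* Let $\mathcal{F}$ be a simply generated family with weight sequence $(\phi_m)_{m\ge0}$, $\Phi(x)=\sum_m\phi_mx^m$ with radius of convergence $R$; suppose there is $\tau\in(0,R]$ with $\tau\Phi'(\tau)=\Phi(\tau)$ and that the corresponding offspring distribution $\xi$ ($\mathbb{P}(\xi=m)=\phi_m\tau^m/\Phi(\tau)$) satisfies $\mathbb{V}(\xi)=\sigma^2<\infty$. Let $K_n$ be the number of distinct unordered rooted trees represented by the fringe subtrees of a random tree $T_n$ of size $n$ from $\mathcal{F}$. Set $\kappa=2\tau^{-1}\Phi(\tau)^{1/2}(2\pi\Phi''(\tau))^{-1/2}$. Let $M=\{m:\phi_m>0\}$, let $C_1=\log b_M$, where $b_M$ is the constant such that the number $u_k^M$ of unordered rooted trees of size $k$ all of whose outdegrees lie in $M$ satisfies $u_k^M\sim a_Mb_M^kk^{-3/2}$, and let $C_2=-\lambda$ with $\lambda=\mathbb{E}(f(T))$, where $T$ is the unconditioned Galton--Watson tree with offspring distribution $\xi$ and $f$ is the toll function defined in the context. Then (i) $\kappa\sqrt{C_2}\frac{n}{\sqrt{\log n}}(1+o(1))\le\mathbb{E}(K_n)\le\kappa\sqrt{C_1}\frac{n}{\sqrt{\log n}}(1+o(1))$; (ii) with probability tending to $1$, $\kappa\sqrt{C_2}\frac{n}{\sqrt{\log n}}(1+o(1))\le K_n\le\kappa\sqrt{C_1}\frac{n}{\sqrt{\log n}}(1+o(1))$.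
   Context: A simply generated family: a plane tree $t$ has weight $\prod_v\phi_{\deg(v)}$, and a random tree of size $n$ has underlying plane tree chosen with probability proportional to weight; it is distributed as the Galton--Watson tree with offspring $\xi$ conditioned on $n$ vertices. Fringe subtrees (vertex plus all descendants) are identified if isomorphic as rooted unordered trees. For a plane tree $t$ with root degree $\rho(t)$ whose root branches fall into $k_t$ isomorphism classes (as unordered rooted trees) with multiplicities $m_1,\dots,m_{k_t}$, define $f(t)=\log(\mathbb{P}(\xi=\rho(t))\rho(t)!)-\log(m_1!\cdots m_{k_t}!)$ if $\mathbb{P}(\xi=\rho(t))>0$ and $f(t)=0$ otherwise. *)

theory Defs
  imports "HOL-Probability.Probability" "HOL-Library.Multiset" "HOL-Library.Landau_Symbols"
begin

datatype ptree = PNode "ptree list"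

(* Unordered rooted trees.  A node carries the multiset of its branches, so equality in this type
   is isomorphism of rooted unordered trees. *)
datatype utree = UNode "utree multiset"

primrec shape :: "ptree \<Rightarrow> utree" where
  "shape (PNode ts) = UNode (mset (map shape ts))"

(* One entry for each vertex, namely its outdegree. *)
primrec outdegs :: "ptree \<Rightarrow> nat list" where
  "outdegs (PNode ts) = length ts # concat (map outdegs ts)"

primrec uoutdegs :: "utree \<Rightarrow> nat multiset" where
  "uoutdegs (UNode N) = add_mset (size N) (sum_mset (image_mset uoutdegs N))"

definition tsize :: "ptree \<Rightarrow> nat" where
  "tsize t = length (outdegs t)"

definition weight :: "(nat \<Rightarrow> real) \<Rightarrow> ptree \<Rightarrow> real" where
  "weight \<phi> t = (\<Prod>m\<leftarrow>outdegs t. \<phi> m)"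

definition unordered_count :: "nat set \<Rightarrow> nat \<Rightarrow> nat" where
  "unordered_count M k = card {u. size (uoutdegs u) = k \<and> set_mset (uoutdegs u) \<subseteq> M}"

primrec fringe_subtrees :: "ptree \<Rightarrow> ptree set" where
  "fringe_subtrees (PNode ts) = insert (PNode ts) (\<Union>(set (map fringe_subtrees ts)))"

definition distinct_fringe :: "ptree \<Rightarrow> nat" where
  "distinct_fringe t = card (shape ` fringe_subtrees t)"

(* The derivatives of Phi c are Phi (diffs c), Phi (diffs (diffs c)), ...; written as series they
   also make sense (as one-sided derivatives) at the radius of convergence. *)
definition Phi :: "(nat \<Rightarrow> real) \<Rightarrow> real \<Rightarrow> real" where
  "Phi c x = (\<Sum>m. c m * x ^ m)"

definition offspring :: "(nat \<Rightarrow> real) \<Rightarrow> real \<Rightarrow> nat pmf" where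
  "offspring \<phi> \<tau> = embed_pmf (\<lambda>m. \<phi> m * \<tau> ^ m / Phi \<phi> \<tau>)"

(* Meaningful when the total weight of the trees of size n is positive. *)
definition random_tree :: "(nat \<Rightarrow> real) \<Rightarrow> nat \<Rightarrow> ptree pmf" where
  "random_tree \<phi> n =
     embed_pmf (\<lambda>t. if tsize t = n then weight \<phi> t / (\<Sum>s | tsize s = n. weight \<phi> s) else 0)"

(* The sizes for which the random tree exists.  If the outdegrees have gcd d, these are, up to
   finitely many exceptions, the numbers congruent to 1 modulo d. *)
definition admissible_sizes :: "(nat \<Rightarrow> real) \<Rightarrow> nat set" where
  "admissible_sizes \<phi> = {n. \<exists>t. tsize t = n \<and> weight \<phi> t > 0}"

definition size_filter :: "(nat \<Rightarrow> real) \<Rightarrow> nat filter" where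
  "size_filter \<phi> = inf sequentially (principal (admissible_sizes \<phi>))"

(* Unconditioned Galton-Watson tree: a finite plane tree t has probability the product over its
   vertices v of P(xi = deg v).  These sum to 1 exactly when the tree is almost surely finite,
   in particular for critical xi with P(xi = 0) > 0. *)
definition gw_tree :: "nat pmf \<Rightarrow> ptree pmf" where
  "gw_tree \<xi> = embed_pmf (weight (pmf \<xi>))"

primrec toll :: "nat pmf \<Rightarrow> ptree \<Rightarrow> real" where
  "toll \<xi> (PNode ts) =
     (if pmf \<xi> (length ts) > 0
      then ln (pmf \<xi> (length ts) * fact (length ts))
           - ln (\<Prod>u\<in>set (map shape ts). fact (count (mset (map shape ts)) u))
      else 0)"

definition kappa :: "(nat \<Rightarrow> real) \<Rightarrow> real \<Rightarrow> real" where
  "kappa \<phi> \<tau> = 2 * inverse \<tau> * Phi \<phi> \<tau> powr (1/2) * (2 * pi * Phi (diffs (diffs \<phi>)) \<tau>) powr (-1/2)"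

end

(* The plane tree with outdegrees d_1, ..., d_n in preorder is identified with the word d_1 ... d_n;
   its fringe subtrees are the subwords that are themselves tree words. The random tree of size n is
   a word of n i.i.d. letters conditioned on being a tree word. That event has probability at least
   c exp(-sqrt n) (grafting, plus the tail asymptotics below), whereas the quantities of interest change by
   at most O(log n) when one letter changes, so that McDiarmid's inequality for the unconditioned word
   gives errors exp(-n / polylog n) and survives the conditioning. It remains to compute expectations
   over i.i.d. words.

   The tail P(|T| > m) ~ kappa / sqrt m of the unconditioned tree T follows from its generating function by
   Karamata's Tauberian theorem. For the upper bound, the fringe subtrees of size at most m represent
   at most C m b^m shapes, and about n P(|T| > m) fringe subtrees are larger; take m slightly below
   log n / log b. For the lower bound, a tree t has shape probability exp(sum of its tolls), and a law of
   large numbers for the tolls makes this about exp(- C2 |t|) for most T with |T| > m. If m is slightly above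
   log n / C2, these probabilities are at most n^(-1-delta), and then coincidences among the
   about n P(|T| > m) larger fringe subtrees are negligible. *)

theory Submission
  imports Defs "HOL-Real_Asymp.Real_Asymp" "HOL-Combinatorics.Multiset_Permutations" "HOL-Library.Sublist"
begin

text \<open>As \<tau> may lie on the boundary of the disc of convergence and only a second moment is
  available, the generating function of |T| is controlled just on the real axis below 1. That suits
  a Tauberian theorem, because the tail is monotone, but it says nothing about single sizes, which
  may moreover lie in one residue class. For P(|T| = n) any lower bound that decays more slowly than
  exp(-n / polylog n) suffices, and exp(-sqrt n) is what a crude induction yields. The delicate
  point is the law of large numbers. The trees with |T| > m have probability of order m^(-1/2), so
  the exceptional ones must have probability o(m^(-1/2)), although a toll can be as large as
  log(deg!) and depends on the whole fringe subtree. Only upper deviations of the sum of tolls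
  matter. Therefore each toll is bounded by a bounded function of B consecutive letters, suited to
  McDiarmid, plus a function of the degree alone, for which a truncated Chebyshev inequality gives
  O(log^2 m / m). Sizes are confined to (m, L m] with a large constant L. This costs the fraction 1
  / sqrt L of the tail and keeps the influence of a letter logarithmic.\<close>

abbreviation (input) "expect \<equiv> measure_pmf.expectation"
abbreviation (input) "prob \<equiv> measure_pmf.prob"

section \<open>A Tauberian theorem\<close>

lemma filterlim_power_at_left_1:
  "filterlim (\<lambda>z::real. z ^ Suc i) (at_left 1) (at_left 1)"
proof -
  have "((\<lambda>z::real. z ^ Suc i) \<longlongrightarrow> 1) (at_left 1)"
    by (rule tendsto_eq_intros | simp)+
  moreover have "\<forall>\<^sub>F z::real in at_left 1. z ^ Suc i \<in> {..<1} \<and> z ^ Suc i \<noteq> 1"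
  proof -
    have "\<forall>\<^sub>F z::real in at_left 1. z \<in> {0<..<1}"
      by (rule eventually_at_left_real) simp
    thus ?thesis
    proof eventually_elim
      case (elim z)
      hence "z ^ Suc i < 1" using power_Suc_less_one[of z i] by simp
      thus ?case by simp
    qed
  qed
  ultimately show ?thesis
    by (simp add: filterlim_at)
qed

lemma summable_bounded_power:
  fixes Q :: "nat \<Rightarrow> real"
  assumes "\<And>m. \<bar>Q m\<bar> \<le> H" "\<bar>z\<bar> < 1"
  shows "summable (\<lambda>m. Q m * z ^ m)"
proof (rule summable_comparison_test')
  show "summable (\<lambda>m. H * \<bar>z\<bar> ^ m)"
    using assms(2) by (intro summable_mult summable_geometric) simp
  show "norm (Q m * z ^ m) \<le> H * \<bar>z\<bar> ^ m" if "m \<ge> 0" for m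
    using assms(1)[of m] by (simp add: abs_mult power_abs mult_right_mono)
qed

text \<open>Karamata's argument: agreement of the leading Abel asymptotics along all powers of \<open>z\<close>
  passes to polynomial and then, by Weierstrass approximation, to continuous test functions.\<close>

lemma Karamata_polynomial:
  fixes D :: "nat \<Rightarrow> real"
  assumes bdd: "\<And>m. \<bar>D m\<bar> \<le> H"
    and lim: "((\<lambda>z. sqrt (1 - z) * (\<Sum>m. D m * z ^ m)) \<longlongrightarrow> 0) (at_left 1)"
  shows "((\<lambda>z. sqrt (1 - z) * (\<Sum>m. D m * z ^ m * (\<Sum>i\<le>n. a i * (z ^ m) ^ i))) \<longlongrightarrow> 0) (at_left 1)"
proof -
  have ev: "\<forall>\<^sub>F z::real in at_left 1. z \<in> {0<..<1}"
    by (rule eventually_at_left_real) simp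
  \<comment> \<open>Since D has Abel limit 0, the point \<open>z ^ Suc i\<close> can stand in for z:
    \<open>sqrt (1 - z)\<close> is at most \<open>sqrt (1 - z ^ Suc i)\<close>, and their exact
    ratio does not matter.\<close>
  have mono: "((\<lambda>z. sqrt (1 - z) * (\<Sum>m. D m * (z ^ Suc i) ^ m)) \<longlongrightarrow> 0) (at_left 1)" for i
  proof -
    have l: "((\<lambda>z. sqrt (1 - z ^ Suc i) * (\<Sum>m. D m * (z ^ Suc i) ^ m)) \<longlongrightarrow> 0) (at_left 1)"
      using filterlim_compose[OF lim filterlim_power_at_left_1] .
    show ?thesis
    proof (rule Lim_null_comparison[OF _ tendsto_norm_zero[OF l]])
      show "\<forall>\<^sub>F z in at_left 1. norm (sqrt (1 - z) * (\<Sum>m. D m * (z ^ Suc i) ^ m))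
              \<le> norm (sqrt (1 - z ^ Suc i) * (\<Sum>m. D m * (z ^ Suc i) ^ m))"
        using ev
      proof eventually_elim
        case (elim z)
        have "z ^ Suc i \<le> z" using elim power_decreasing[of 1 "Suc i" z] by simp
        hence "sqrt (1 - z) \<le> sqrt (1 - z ^ Suc i)" by simp
        moreover have "\<bar>sqrt (1 - z)\<bar> = sqrt (1 - z)" using elim by simp
        ultimately have "norm (sqrt (1 - z)) \<le> norm (sqrt (1 - z ^ Suc i))"
          unfolding real_norm_def by linarith
        thus ?case unfolding norm_mult
          by (rule mult_right_mono) simp
      qed
    qed
  qed
  have "((\<lambda>z. \<Sum>i\<le>n. a i * (sqrt (1 - z) * (\<Sum>m. D m * (z ^ Suc i) ^ m))) \<longlongrightarrow> (\<Sum>i\<le>n. a i * 0)) (at_left 1)"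
    by (intro tendsto_sum tendsto_mult_left mono)
  moreover have "\<forall>\<^sub>F z in at_left 1. (\<Sum>i\<le>n. a i * (sqrt (1 - z) * (\<Sum>m. D m * (z ^ Suc i) ^ m)))
       = sqrt (1 - z) * (\<Sum>m. D m * z ^ m * (\<Sum>i\<le>n. a i * (z ^ m) ^ i))"
    using ev
  proof eventually_elim
    case (elim z)
    have sm: "summable (\<lambda>m. D m * (z ^ Suc i) ^ m)" for i
      using elim power_Suc_less_one[of z i]
      by (intro summable_bounded_power[OF bdd]) (simp del: power_Suc)
    have "(\<Sum>m. D m * z ^ m * (\<Sum>i\<le>n. a i * (z ^ m) ^ i))
        = (\<Sum>m. \<Sum>i\<le>n. a i * (D m * (z ^ Suc i) ^ m))"
      by (intro suminf_cong) (simp add: sum_distrib_left power_mult_distrib power_mult[symmetric] mult_ac)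
    also have "\<dots> = (\<Sum>i\<le>n. \<Sum>m. a i * (D m * (z ^ Suc i) ^ m))"
      by (rule suminf_sum) (intro summable_mult sm)
    also have "\<dots> = (\<Sum>i\<le>n. a i * (\<Sum>m. D m * (z ^ Suc i) ^ m))"
      by (intro sum.cong refl suminf_mult sm)
    finally show ?case by (simp add: sum_distrib_left mult_ac)
  qed
  ultimately show ?thesis
    by (subst (asm) tendsto_cong) simp_all
qed

text \<open>Comparison with a model sequence R of the same Abel limit replaces the evaluation of a
  limit integral. Nonnegativity of Q and R controls the polynomial approximation: its error d is
  multiplied by the Abel sum of Q + R, which after scaling stays below K.\<close>

lemma Karamata_continuous:
  fixes Q R :: "nat \<Rightarrow> real"
  assumes Q: "\<And>m. 0 \<le> Q m" "\<And>m. Q m \<le> H" and R: "\<And>m. 0 \<le> R m" "\<And>m. R m \<le> H"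
    and limQ: "((\<lambda>z. sqrt (1 - z) * (\<Sum>m. Q m * z ^ m)) \<longlongrightarrow> c) (at_left 1)"
    and limR: "((\<lambda>z. sqrt (1 - z) * (\<Sum>m. R m * z ^ m)) \<longlongrightarrow> c) (at_left 1)"
    and g: "continuous_on {0..1} g"
  shows "((\<lambda>z. sqrt (1 - z) * (\<Sum>m. (Q m - R m) * z ^ m * g (z ^ m))) \<longlongrightarrow> 0) (at_left 1)"
proof -
  have ev: "\<forall>\<^sub>F z::real in at_left 1. z \<in> {0<..<1}"
    by (rule eventually_at_left_real) simp
  have bdd: "\<bar>Q m\<bar> \<le> H" "\<bar>R m\<bar> \<le> H" "\<bar>Q m - R m\<bar> \<le> H" "\<bar>Q m + R m\<bar> \<le> 2 * H" for m
    using Q[of m] R[of m] by auto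
  have sQ: "summable (\<lambda>m. Q m * z ^ m)" and sR: "summable (\<lambda>m. R m * z ^ m)" if "z \<in> {0<..<1}" for z
    using that by (auto intro!: summable_bounded_power[of _ H] bdd)
  have sub: "((\<lambda>z. sqrt (1 - z) * (\<Sum>m. (Q m - R m) * z ^ m)) \<longlongrightarrow> c - c) (at_left 1)"
  proof (rule Lim_transform_eventually[OF tendsto_diff[OF limQ limR]])
    show "\<forall>\<^sub>F z in at_left 1. sqrt (1 - z) * (\<Sum>m. Q m * z ^ m) - sqrt (1 - z) * (\<Sum>m. R m * z ^ m)
       = sqrt (1 - z) * (\<Sum>m. (Q m - R m) * z ^ m)"
      using ev by eventually_elim
        (simp add: suminf_diff[OF sQ sR] algebra_simps flip: right_diff_distrib)
  qed
  have add: "((\<lambda>z. sqrt (1 - z) * (\<Sum>m. (Q m + R m) * z ^ m)) \<longlongrightarrow> c + c) (at_left 1)"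
  proof (rule Lim_transform_eventually[OF tendsto_add[OF limQ limR]])
    show "\<forall>\<^sub>F z in at_left 1. sqrt (1 - z) * (\<Sum>m. Q m * z ^ m) + sqrt (1 - z) * (\<Sum>m. R m * z ^ m)
       = sqrt (1 - z) * (\<Sum>m. (Q m + R m) * z ^ m)"
      using ev by eventually_elim
        (simp add: suminf_add[OF sQ sR] algebra_simps flip: distrib_left)
  qed
  define K where "K = \<bar>c + c\<bar> + 1"
  have K: "K > 0" by (simp add: K_def)
  have evK: "\<forall>\<^sub>F z in at_left 1. sqrt (1 - z) * (\<Sum>m. (Q m + R m) * z ^ m) < K"
    using add by (rule order_tendstoD) (simp add: K_def)
  show ?thesis
  proof (rule tendstoI)
    fix e :: real assume e: "e > 0"
    define d where "d = e / (2 * K)"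
    have d: "d > 0" using e K by (simp add: d_def)
    obtain N where N: "\<And>x. x \<in> {0..1} \<Longrightarrow> \<bar>g x - (\<Sum>k\<le>N. g (k/N) * Bernstein N k x)\<bar> < d"
      using Bernstein_Weierstrass[OF g d] by blast
    have "real_polynomial_function (\<lambda>x. \<Sum>k\<le>N. g (k/N) * Bernstein N k x)"
      unfolding Bernstein_def by (intro real_polynomial_function_sum)
        (auto intro!: real_polynomial_function.intros(2,4)
          real_polynomial_function_power real_polynomial_function_diff
          real_polynomial_function.intros(1)[OF bounded_linear_ident])
    then obtain a n where an: "(\<lambda>x. \<Sum>k\<le>N. g (k/N) * Bernstein N k x) = (\<lambda>x. \<Sum>i\<le>n. a i * x ^ i)"
      using real_polynomial_function_imp_sum by blast
    define P where "P x = (\<Sum>i\<le>n. a i * x ^ i)" for x :: real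
    have P: "\<bar>g x - P x\<bar> \<le> d" if "x \<in> {0..1}" for x
      using N[OF that] fun_cong[OF an, of x] by (simp add: P_def)
    have "((\<lambda>z. sqrt (1 - z) * (\<Sum>m. (Q m - R m) * z ^ m * P (z ^ m))) \<longlongrightarrow> 0) (at_left 1)"
      unfolding P_def using sub by (intro Karamata_polynomial[OF bdd(3)]) simp
    from tendstoD[OF this, of "e/2"] have
      "\<forall>\<^sub>F z in at_left 1. \<bar>sqrt (1 - z) * (\<Sum>m. (Q m - R m) * z ^ m * P (z ^ m))\<bar> < e / 2"
      using e by simp
    with ev evK show "\<forall>\<^sub>F z in at_left 1. dist (sqrt (1 - z) * (\<Sum>m. (Q m - R m) * z ^ m * g (z ^ m))) 0 < e"
    proof eventually_elim
      case (elim z)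
      have zm: "z ^ m \<in> {0..1}" for m using elim by (auto intro: power_le_one)
      have bounded_g: "\<exists>B. \<forall>x\<in>{0..1}. \<bar>h x\<bar> \<le> B" if "continuous_on {0..1} h" for h :: "real \<Rightarrow> real"
        using compact_imp_bounded[OF compact_continuous_image[OF that compact_Icc]]
        by (auto simp: bounded_iff)
      have s: "summable (\<lambda>m. (Q m - R m) * z ^ m * h (z ^ m))" if ch: "continuous_on {0..1} h" for h
      proof -
        obtain B where B: "\<And>x. x \<in> {0..1} \<Longrightarrow> \<bar>h x\<bar> \<le> B" using bounded_g[OF ch] by blast
        have "\<bar>(Q m - R m) * h (z ^ m)\<bar> \<le> H * B" for m
          unfolding abs_mult using bdd(3)[of m] B[OF zm[of m]] by (intro mult_mono) auto
        from summable_bounded_power[OF this, of z] elim show ?thesis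
          by (simp add: mult_ac)
      qed
      have cP: "continuous_on {0..1} P" unfolding P_def by (intro continuous_intros)
      have sa: "summable (\<lambda>m. (Q m + R m) * z ^ m)"
        using elim by (auto intro!: summable_bounded_power[of _ "2*H"] bdd)
      have "\<bar>(\<Sum>m. (Q m - R m) * z ^ m * g (z ^ m)) - (\<Sum>m. (Q m - R m) * z ^ m * P (z ^ m))\<bar>
          = \<bar>\<Sum>m. (Q m - R m) * z ^ m * (g (z ^ m) - P (z ^ m))\<bar>"
        by (subst suminf_diff[OF s[OF g] s[OF cP]]) (simp add: algebra_simps)
      also have "\<dots> \<le> (\<Sum>m. (Q m + R m) * z ^ m * d)"
      proof -
        have le: "norm ((Q m - R m) * z ^ m * (g (z ^ m) - P (z ^ m))) \<le> (Q m + R m) * z ^ m * d" for m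
          unfolding norm_mult using P[OF zm[of m]] Q[of m] R[of m] elim
          by (intro mult_mono) auto
        have "summable (\<lambda>m. (Q m + R m) * z ^ m * d)" using sa by (rule summable_mult2)
        from norm_suminf_le[OF le this] show ?thesis by simp
      qed
      also have "\<dots> = (\<Sum>m. (Q m + R m) * z ^ m) * d"
        by (rule suminf_mult2[symmetric, OF sa])
      finally have "sqrt (1 - z) * \<bar>(\<Sum>m. (Q m - R m) * z ^ m * g (z ^ m)) - (\<Sum>m. (Q m - R m) * z ^ m * P (z ^ m))\<bar>
          \<le> sqrt (1 - z) * (\<Sum>m. (Q m + R m) * z ^ m) * d"
        using elim by (simp add: mult_left_mono mult.assoc)
      also have "\<dots> \<le> K * d" using elim d by (intro mult_right_mono) auto
      also have "\<dots> = e / 2" using K by (simp add: d_def)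
      finally have "\<bar>sqrt (1 - z) * (\<Sum>m. (Q m - R m) * z ^ m * g (z ^ m)) - sqrt (1 - z) * (\<Sum>m. (Q m - R m) * z ^ m * P (z ^ m))\<bar> \<le> e / 2"
        using elim by (simp add: abs_mult flip: right_diff_distrib)
      moreover have "\<bar>x\<bar> < e" if "\<bar>x - y\<bar> \<le> e / 2" "\<bar>y\<bar> < e / 2" for x y
        using that by linarith
      ultimately show ?case unfolding dist_real_def diff_0_right using elim(3) by blast
    qed
  qed
qed

text \<open>In absolute value these are the central binomial coefficients divided by 4^m, the
  coefficients of (1 - z)^(-1/2). They are the model sequence for Karamata's theorem: their scaled
  Abel sum is exactly 1, and their decay supplies the factor 1 / sqrt pi of the tail.\<close>

lemma central_gbinomial_asymptotic:
  "(\<lambda>m. sqrt (real m) * \<bar>(-1/2 :: real) gchoose m\<bar>) \<longlonglongrightarrow> 1 / sqrt pi"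
proof -
  have "(\<lambda>n. \<bar>((-1/2::real) gchoose n) / ((-1)^n / exp ((-1/2+1) * of_real (ln (real n))))\<bar>) \<longlonglongrightarrow> \<bar>inverse (Gamma (1/2))\<bar>"
    using tendsto_rabs[OF gbinomial_asymptotic[of "-1/2::real"]] by simp
  moreover have "\<forall>\<^sub>F n in sequentially. \<bar>((-1/2::real) gchoose n) / ((-1)^n / exp ((-1/2+1) * of_real (ln (real n))))\<bar> =
      sqrt (real n) * \<bar>(-1/2 :: real) gchoose n\<bar>"
    using eventually_gt_at_top[of 0]
  proof eventually_elim
    case (elim n)
    have "exp (1/2 * ln (real n)) = sqrt (real n)"
      using elim powr_half_sqrt[of "real n"] by (simp add: powr_def)
    thus ?case by (simp add: abs_mult abs_divide power_abs)
  qed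
  ultimately have "(\<lambda>n. sqrt (real n) * \<bar>(-1/2 :: real) gchoose n\<bar>) \<longlonglongrightarrow> \<bar>inverse (Gamma (1/2))\<bar>"
    by (rule Lim_transform_eventually)
  thus ?thesis by (simp add: Gamma_one_half_real inverse_eq_divide)
qed

lemma gbinomial_minus_half_Suc:
  obtains r :: real where "r < 0" "\<bar>r\<bar> \<le> 1" "(-1/2 :: real) gchoose Suc m = ((-1/2) gchoose m) * r"
proof (rule that)
  show "(-1/2 :: real) gchoose Suc m = ((-1/2) gchoose m) * ((-1/2 - real m) / real (Suc m))"
    using gbinomial_mult_1[of "-1/2::real" m] by (simp add: field_simps)
  show "(-1/2 - real m) / real (Suc m) < 0"
    by (intro divide_neg_pos) auto
  show "\<bar>(-1/2 - real m) / real (Suc m)\<bar> \<le> 1" by (simp add: abs_divide)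
qed

lemma abs_gbinomial_minus_half:
  "\<bar>(-1/2 :: real) gchoose m\<bar> = (-1) ^ m * ((-1/2) gchoose m)"
proof (induction m)
  case (Suc m)
  obtain r :: real where r: "r < 0" "(-1/2 :: real) gchoose Suc m = ((-1/2) gchoose m) * r"
    using gbinomial_minus_half_Suc[of m] by metis
  have "\<bar>(-1/2 :: real) gchoose Suc m\<bar> = - (\<bar>(-1/2) gchoose m\<bar> * r)"
    unfolding r(2) using r(1) by (simp add: abs_mult)
  also have "\<dots> = (-1) ^ Suc m * (((-1/2) gchoose m) * r)"
    unfolding Suc.IH by simp
  finally show ?case unfolding r(2) .
qed auto

lemma abs_gbinomial_minus_half_le_1: "\<bar>(-1/2 :: real) gchoose m\<bar> \<le> 1"
proof (induction m)
  case (Suc m)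
  obtain r :: real where r: "\<bar>r\<bar> \<le> 1" "(-1/2 :: real) gchoose Suc m = ((-1/2) gchoose m) * r"
    using gbinomial_minus_half_Suc[of m] by metis
  show ?case unfolding r(2) abs_mult using Suc.IH r(1) by (intro mult_le_one) auto
qed auto

lemma sqrt_mult_suminf_central_gbinomial:
  assumes "0 < z" "z < (1::real)"
  shows "sqrt (1 - z) * (\<Sum>m. \<bar>(-1/2 :: real) gchoose m\<bar> * z ^ m) = 1"
proof -
  have "(\<lambda>n. ((-1/2::real) gchoose n) * (- z)^n) sums (1 + (- z)) powr (-1/2)"
    using assms by (intro gen_binomial_real) auto
  moreover have "((-1/2::real) gchoose n) * (- z)^n = \<bar>(-1/2) gchoose n\<bar> * z ^ n" for n
    by (subst abs_gbinomial_minus_half) (simp add: power_minus[of z])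
  ultimately have "(\<Sum>m. \<bar>(-1/2 :: real) gchoose m\<bar> * z ^ m) = (1 - z) powr (-1/2)"
    by (simp add: sums_iff)
  also have "\<dots> = inverse (sqrt (1 - z))"
    using assms powr_half_sqrt[of "1 - z"] powr_minus[of "1 - z" "1/2"] by simp
  finally show ?thesis using assms by simp
qed

text \<open>For z = exp(-1/N) the powers z^m equal exp(-m/N), so a function supported on
  [exp(-\<beta>), exp(-\<alpha>)] selects the m with \<alpha> N < m < \<beta> N. A tent is
  continuous, unlike the indicator of that interval.\<close>

lemma tent_weights:
  fixes \<alpha> \<beta> :: real
  assumes "0 < \<alpha>" "\<alpha> < \<beta>"
  obtains g and c :: real where "continuous_on {0..1} g" "\<And>x. g x \<ge> (0::real)"
    "\<And>x. x \<le> exp (-\<beta>) \<Longrightarrow> g x = 0" "\<And>x. x \<ge> exp (-\<alpha>) \<Longrightarrow> g x = 0"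
    "c > 0" "\<And>N. real N \<ge> 6 / (\<beta> - \<alpha>) \<Longrightarrow> 
       (\<Sum>m | \<alpha> * N < real m \<and> real m < \<beta> * N. exp (-1/N) ^ m * g (exp (-1/N) ^ m)) \<ge> c * real N"
proof -
  define g where "g x = max 0 (min (x - exp (-\<beta>)) (exp (-\<alpha>) - x))" for x
  \<comment> \<open>The middle third of the window, on which the tent is at least \<open>c1\<close>.
    The condition N >= 6 / (\<beta> - \<alpha>) says d N >= 2, so that rounding leaves at least d N
    / 2 integers in it.\<close>
  define d where "d = (\<beta> - \<alpha>) / 3"
  have d: "d > 0" using assms by (simp add: d_def)
  define \<alpha>' where "\<alpha>' = \<alpha> + d"
  define \<beta>' where "\<beta>' = \<beta> - d"
  have ab: "\<alpha> < \<alpha>'" "\<alpha>' < \<beta>'" "\<beta>' < \<beta>" "\<beta>' - \<alpha>' = d"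
    using d by (auto simp: \<alpha>'_def \<beta>'_def d_def field_simps)
  define c1 where "c1 = min (exp (-\<beta>') - exp (-\<beta>)) (exp (-\<alpha>) - exp (-\<alpha>'))"
  have c1: "c1 > 0" using ab by (simp add: c1_def)
  define c where "c = exp (-\<beta>') * c1 * (d / 2)"
  have c: "c > 0" using c1 d by (simp add: c_def)
  show ?thesis
  proof (rule that[of g c])
    show "continuous_on {0..1} g" unfolding g_def by (intro continuous_intros)
    show "(\<Sum>m | \<alpha> * N < real m \<and> real m < \<beta> * N. exp (-1/N) ^ m * g (exp (-1/N) ^ m)) \<ge> c * real N"
      if N: "real N \<ge> 6 / (\<beta> - \<alpha>)" for N
    proof -
      have "real N > 0" using N assms by (smt (verit) divide_pos_pos)
      have Nd: "d * N \<ge> 2" using N assms by (simp add: d_def field_simps)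
      have fin: "finite {m. \<alpha> * N < real m \<and> real m < \<beta> * N}"
        by (rule finite_subset[of _ "{..nat \<lceil>\<beta> * N\<rceil>}"]) (auto, linarith)
      define A where "A = {nat \<lceil>\<alpha>' * N\<rceil>..nat \<lfloor>\<beta>' * N\<rfloor>}"
      have A: "\<alpha>' * N \<le> real m" "real m \<le> \<beta>' * N" if "m \<in> A" for m
      proof -
        have "\<lceil>\<alpha>' * N\<rceil> \<le> int m" "m \<le> nat \<lfloor>\<beta>' * N\<rfloor>" using that by (auto simp: A_def nat_le_iff)
        moreover have "\<beta>' * N \<ge> 0" using ab assms by simp
        ultimately show "\<alpha>' * N \<le> real m" "real m \<le> \<beta>' * N"
          by (simp_all add: ceiling_le_iff le_nat_iff le_floor_iff)
      qed
      have "c * N \<le> real (card A) * (exp (-\<beta>') * c1)"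
      proof -
        have "\<alpha>' * N > 0" using ab assms \<open>real N > 0\<close> by simp
        moreover have "\<beta>' * N - \<alpha>' * N \<ge> 2" using ab Nd by (simp flip: left_diff_distrib)
        ultimately have "real (card A) \<ge> \<beta>' * N - \<alpha>' * N - 1"
          unfolding A_def by (simp, linarith)
        also have "\<beta>' * N - \<alpha>' * N - 1 = d * N - 1" using ab by (simp flip: left_diff_distrib)
        finally have "real (card A) \<ge> d / 2 * N" using Nd by simp
        thus ?thesis using c1 unfolding c_def
          by (smt (verit) exp_gt_zero mult.commute mult.left_commute mult_pos_pos mult_right_mono mult.assoc)
      qed
      also have "\<dots> = (\<Sum>m\<in>A. exp (-\<beta>') * c1)" by simp
      also have "\<dots> \<le> (\<Sum>m\<in>A. exp (-1/N) ^ m * g (exp (-1/N) ^ m))"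
      proof (rule sum_mono)
        fix m assume m: "m \<in> A"
        have e: "exp (-1/N) ^ m = exp (- (m / N))" by (simp flip: exp_of_nat_mult)
        have "m / N \<le> \<beta>'" "\<alpha>' \<le> m / N" using A[OF m] \<open>real N > 0\<close> by (auto simp: field_simps)
        hence "exp (-\<beta>') \<le> exp (- (m / N))" "exp (-\<alpha>') \<ge> exp (- (m / N))" by auto
        moreover from this have "c1 \<le> g (exp (-(m/N)))" unfolding c1_def g_def by linarith
        ultimately show "exp (-\<beta>') * c1 \<le> exp (-1/N) ^ m * g (exp (-1/N) ^ m)"
          unfolding e using c1 by (intro mult_mono) auto
      qed
      also have "\<dots> \<le> (\<Sum>m | \<alpha> * N < real m \<and> real m < \<beta> * N. exp (-1/N) ^ m * g (exp (-1/N) ^ m))"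
      proof (rule sum_mono2[OF fin])
        show "A \<subseteq> {m. \<alpha> * N < real m \<and> real m < \<beta> * N}"
        proof safe
          fix m assume m: "m \<in> A"
          have "\<alpha> * N < \<alpha>' * N" "\<beta>' * N < \<beta> * N" using ab \<open>real N > 0\<close> by auto
          thus "\<alpha> * N < real m" "real m < \<beta> * N" using A[OF m] by linarith+
        qed
      qed (auto simp: g_def)
      finally show ?thesis .
    qed
  qed (use c assms in \<open>auto simp: g_def\<close>)
qed

text \<open>The tent function selects the window \<open>\<alpha> N < m < \<beta> N\<close>, on which a bound for \<open>Q\<close> and a
  bound for \<open>R\<close> can be compared.\<close>

lemma Karamata_window:
  fixes Q R :: "nat \<Rightarrow> real" and \<alpha> \<beta> e c :: real
  assumes Q: "\<And>m. 0 \<le> Q m" "\<And>m. Q m \<le> H" and R: "\<And>m. 0 \<le> R m" "\<And>m. R m \<le> H"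
    and limQ: "((\<lambda>z. sqrt (1 - z) * (\<Sum>m. Q m * z ^ m)) \<longlongrightarrow> c) (at_left 1)"
    and limR: "((\<lambda>z. sqrt (1 - z) * (\<Sum>m. R m * z ^ m)) \<longlongrightarrow> c) (at_left 1)"
    and ab: "0 < \<alpha>" "\<alpha> < \<beta>"
    and e: "e > 0"
  shows "\<forall>\<^sub>F N in sequentially. \<forall>u v. (\<forall>m. \<alpha> * N < real m \<and> real m < \<beta> * N \<longrightarrow> u \<le> Q m \<and> R m \<le> v) \<longrightarrow> sqrt N * u \<le> sqrt N * v + e"
    and "\<forall>\<^sub>F N in sequentially. \<forall>u v. (\<forall>m. \<alpha> * N < real m \<and> real m < \<beta> * N \<longrightarrow> Q m \<le> u \<and> v \<le> R m) \<longrightarrow> sqrt N * v \<le> sqrt N * u + e"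
proof -
  obtain g and K :: real where g: "continuous_on {0..1} g" "\<And>x. g x \<ge> (0::real)"
    "\<And>x. x \<le> exp (-\<beta>) \<Longrightarrow> g x = 0" "\<And>x. x \<ge> exp (-\<alpha>) \<Longrightarrow> g x = 0" and K: "K > 0"
    and KN: "\<And>N. real N \<ge> 6 / (\<beta> - \<alpha>) \<Longrightarrow> 
       (\<Sum>m | \<alpha> * N < real m \<and> real m < \<beta> * N. exp (-1/N) ^ m * g (exp (-1/N) ^ m)) \<ge> K * real N"
    by (rule tent_weights[OF ab]) blast
  have "filterlim (\<lambda>N. exp (-1/real N)) (at_left 1) sequentially"
    by real_asymp
  from filterlim_compose[OF Karamata_continuous[OF Q R limQ limR g(1)] this]
  have lim: "(\<lambda>N. sqrt (1 - exp (-1/real N)) * (\<Sum>m. (Q m - R m) * exp (-1/real N) ^ m * g (exp (-1/real N) ^ m))) \<longlonglongrightarrow> 0" .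
  have "(\<lambda>N. 1 / (sqrt (real N) * sqrt (1 - exp (-1/real N)))) \<longlonglongrightarrow> 1" by real_asymp
  from tendsto_mult[OF lim this] have
   "(\<lambda>N. sqrt (1 - exp (-1/real N)) * (\<Sum>m. (Q m - R m) * exp (-1/real N) ^ m * g (exp (-1/real N) ^ m)) * (1 / (sqrt (real N) * sqrt (1 - exp (-1/real N))))) \<longlonglongrightarrow> 0"
    by simp
  moreover have "\<forall>\<^sub>F N in sequentially. sqrt (1 - exp (-1/real N)) * (\<Sum>m. (Q m - R m) * exp (-1/real N) ^ m * g (exp (-1/real N) ^ m)) * (1 / (sqrt (real N) * sqrt (1 - exp (-1/real N))))
     = (\<Sum>m. (Q m - R m) * exp (-1/real N) ^ m * g (exp (-1/real N) ^ m)) / sqrt N"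
    using eventually_gt_at_top[of 0] by eventually_elim simp
  ultimately have "(\<lambda>N. (\<Sum>m. (Q m - R m) * exp (-1/real N) ^ m * g (exp (-1/real N) ^ m)) / sqrt (real N)) \<longlonglongrightarrow> 0"
    by (rule Lim_transform_eventually)
  \<comment> \<open>The weights sum to at least K N, so an error e K sqrt N in the weighted sums
    becomes e after division by K N and multiplication by sqrt N.\<close>
  from tendstoD[OF this, of "e * K"] have
   "\<forall>\<^sub>F N in sequentially. \<bar>(\<Sum>m. (Q m - R m) * exp (-1/real N) ^ m * g (exp (-1/real N) ^ m)) / sqrt N\<bar> < e * K"
    using e K by simp
  moreover have "\<forall>\<^sub>F N in sequentially. real N \<ge> 6 / (\<beta> - \<alpha>)"
    using filterlim_real_sequentially unfolding filterlim_at_top by blast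
  ultimately have main: "\<forall>\<^sub>F N in sequentially. N > 0 \<and> (\<exists>w :: nat \<Rightarrow> real. \<exists>W. finite W \<and> W = {m. \<alpha> * N < real m \<and> real m < \<beta> * N} \<and>
      (\<forall>m. w m \<ge> 0) \<and> K * N \<le> sum w W \<and> \<bar>(\<Sum>m\<in>W. Q m * w m) - (\<Sum>m\<in>W. R m * w m)\<bar> \<le> e * K * sqrt N)"
    using eventually_gt_at_top[of 0]
  proof eventually_elim
    case (elim N)
    define W where "W = {m. \<alpha> * N < real m \<and> real m < \<beta> * N}"
    define w where "w m = exp (-1/real N) ^ m * g (exp (-1/real N) ^ m)" for m
    have fin: "finite W" unfolding W_def
      by (rule finite_subset[of _ "{..nat \<lceil>\<beta> * N\<rceil>}"]) (auto, linarith)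
    have w0: "w m = 0" if "m \<notin> W" for m
    proof -
      have e: "exp (-1/N) ^ m = exp (- (m / N))" by (simp flip: exp_of_nat_mult)
      have "m / N \<le> \<alpha> \<or> m / N \<ge> \<beta>" using that elim by (auto simp: W_def field_simps)
      thus ?thesis unfolding w_def e using g(3,4) by auto
    qed
    have "(\<Sum>m. (Q m - R m) * exp (-1/real N) ^ m * g (exp (-1/real N) ^ m)) = (\<Sum>m. (Q m - R m) * w m)"
      by (simp add: w_def mult_ac)
    also have "\<dots> = (\<Sum>m\<in>W. (Q m - R m) * w m)"
      by (rule suminf_finite[OF fin]) (simp add: w0)
    also have "\<dots> = (\<Sum>m\<in>W. Q m * w m) - (\<Sum>m\<in>W. R m * w m)"
      by (simp add: left_diff_distrib sum_subtractf)
    finally have "\<bar>(\<Sum>m\<in>W. Q m * w m) - (\<Sum>m\<in>W. R m * w m)\<bar> < e * K * sqrt N"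
      using elim(1) elim(3) by (simp add: abs_divide field_simps)
    moreover have "K * N \<le> sum w W" using KN[OF elim(2)] by (simp add: w_def W_def)
    moreover have "w m \<ge> 0" for m using g(2) by (simp add: w_def)
    ultimately show ?case using fin elim(3) unfolding W_def[symmetric]
      by (intro conjI exI[of _ w] exI[of _ W]) auto
  qed
  have fin: "sqrt N * u \<le> sqrt N * v + e" if "K * N \<le> S" "u * S \<le> v * S + e * K * sqrt N" "N > 0" for N :: nat and S u v
  proof (rule ccontr)
    assume "\<not> ?thesis"
    hence *: "sqrt N * (u - v) > e" by (simp add: algebra_simps)
    hence "u - v > 0" using e that(3) by (smt (verit) mult_less_0_iff of_nat_0_less_iff real_sqrt_gt_0_iff mult_nonneg_nonpos)
    hence "(u - v) * (K * N) \<le> (u - v) * S" using that by (intro mult_left_mono) auto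
    also have "\<dots> \<le> e * K * sqrt N" using that by (simp add: algebra_simps)
    finally have "(u - v) * (sqrt N * sqrt N) * K \<le> e * sqrt N * K" by (simp add: mult_ac)
    hence "(sqrt N * (u - v)) * (sqrt N * K) \<le> e * (sqrt N * K)" by (simp only: mult_ac)
    with * that(3) K show False by (simp add: mult.commute)
  qed
  show "\<forall>\<^sub>F N in sequentially. \<forall>u v. (\<forall>m. \<alpha> * N < real m \<and> real m < \<beta> * N \<longrightarrow> u \<le> Q m \<and> R m \<le> v) \<longrightarrow> sqrt N * u \<le> sqrt N * v + e"
    using main
  proof (eventually_elim, safe)
    fix N u v and w :: "nat \<Rightarrow> real"
    let ?W = "{m. \<alpha> * real N < real m \<and> real m < \<beta> * real N}"
    assume *: "\<forall>m. w m \<ge> 0" "K * N \<le> sum w ?W" "\<bar>(\<Sum>m\<in>?W. Q m * w m) - (\<Sum>m\<in>?W. R m * w m)\<bar> \<le> e * K * sqrt N" "N > 0"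
      and uv: "\<forall>m. \<alpha> * real N < real m \<and> real m < \<beta> * real N \<longrightarrow> u \<le> Q m \<and> R m \<le> v"
    have "u * sum w ?W \<le> (\<Sum>m\<in>?W. Q m * w m)"
      using *(1) uv unfolding sum_distrib_left by (intro sum_mono mult_right_mono) auto
    moreover have "(\<Sum>m\<in>?W. R m * w m) \<le> v * sum w ?W"
      using *(1) uv unfolding sum_distrib_left by (intro sum_mono mult_right_mono) auto
    ultimately have "u * sum w ?W \<le> v * sum w ?W + e * K * sqrt N" using *(3) by linarith
    from fin[OF *(2) this *(4)] show "sqrt N * u \<le> sqrt N * v + e" .
  qed
  show "\<forall>\<^sub>F N in sequentially. \<forall>u v. (\<forall>m. \<alpha> * N < real m \<and> real m < \<beta> * N \<longrightarrow> Q m \<le> u \<and> v \<le> R m) \<longrightarrow> sqrt N * v \<le> sqrt N * u + e"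
    using main
  proof (eventually_elim, safe)
    fix N u v and w :: "nat \<Rightarrow> real"
    let ?W = "{m. \<alpha> * real N < real m \<and> real m < \<beta> * real N}"
    assume *: "\<forall>m. w m \<ge> 0" "K * N \<le> sum w ?W" "\<bar>(\<Sum>m\<in>?W. Q m * w m) - (\<Sum>m\<in>?W. R m * w m)\<bar> \<le> e * K * sqrt N" "N > 0"
      and uv: "\<forall>m. \<alpha> * real N < real m \<and> real m < \<beta> * real N \<longrightarrow> Q m \<le> u \<and> v \<le> R m"
    have "v * sum w ?W \<le> (\<Sum>m\<in>?W. R m * w m)"
      using *(1) uv unfolding sum_distrib_left by (intro sum_mono mult_right_mono) auto
    moreover have "(\<Sum>m\<in>?W. Q m * w m) \<le> u * sum w ?W"
      using *(1) uv unfolding sum_distrib_left by (intro sum_mono mult_right_mono) auto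
    ultimately have "v * sum w ?W \<le> u * sum w ?W + e * K * sqrt N" using *(3) by linarith
    from fin[OF *(2) this *(4)] show "sqrt N * v \<le> sqrt N * u + e" .
  qed
qed

text \<open>Monotonicity turns the windowed comparison into a pointwise one: to the left of N the
  values of Q are at least Q N, to the right at most Q N, and on a window whose end points have
  ratio close to 1 the model sequence is nearly constant.\<close>

theorem Karamata_half:
  fixes Q :: "nat \<Rightarrow> real"
  assumes dec: "decseq Q" and pos: "\<And>m. 0 \<le> Q m" and c: "c > 0"
    and limQ: "((\<lambda>z. sqrt (1 - z) * (\<Sum>m. Q m * z ^ m)) \<longlongrightarrow> c) (at_left 1)"
  shows "(\<lambda>m. sqrt (real m) * Q m) \<longlonglongrightarrow> c / sqrt pi"
proof -
  define R where "R m = c * \<bar>(-1/2 :: real) gchoose m\<bar>" for m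
  define H where "H = max (Q 0) c"
  have Q: "0 \<le> Q m" "Q m \<le> H" for m
    using pos decseqD[OF dec, of 0 m] by (auto simp: H_def)
  have R: "0 \<le> R m" "R m \<le> H" for m
    using c abs_gbinomial_minus_half_le_1[of m] mult_left_mono[of _ 1 c]
    by (auto simp: R_def H_def le_max_iff_disj)
  have limR: "((\<lambda>z. sqrt (1 - z) * (\<Sum>m. R m * z ^ m)) \<longlongrightarrow> c) (at_left 1)"
  proof (rule tendsto_eventually)
    have "\<forall>\<^sub>F z::real in at_left 1. z \<in> {0<..<1}"
      by (rule eventually_at_left_real) simp
    thus "\<forall>\<^sub>F z in at_left 1. sqrt (1 - z) * (\<Sum>m. R m * z ^ m) = c"
    proof eventually_elim
      case (elim z)
      have "summable (\<lambda>m. \<bar>(-1/2 :: real) gchoose m\<bar> * z ^ m)"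
        by (intro summable_bounded_power[of _ 1] abs_gbinomial_minus_half_le_1, unfold abs_abs)
          (rule abs_gbinomial_minus_half_le_1, use elim in simp)
      hence "(\<Sum>m. R m * z ^ m) = c * (\<Sum>m. \<bar>(-1/2 :: real) gchoose m\<bar> * z ^ m)"
        unfolding R_def mult.assoc by (rule suminf_mult)
      thus ?case using sqrt_mult_suminf_central_gbinomial[of z] elim by simp
    qed
  qed
  define \<rho> where "\<rho> = c / sqrt pi"
  have \<rho>: "\<rho> > 0" using c by (simp add: \<rho>_def)
  have R_lim: "(\<lambda>m. sqrt (real m) * R m) \<longlonglongrightarrow> \<rho>"
    using tendsto_mult_left[OF central_gbinomial_asymptotic, of c] by (simp add: R_def \<rho>_def mult_ac)
  have "\<forall>\<^sub>F N in sequentially. sqrt (real N) * Q N < a" if a: "a > \<rho>" for a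
  proof -
    obtain b where b: "\<rho> < b" "b < a" using dense[OF a] by blast
    obtain b' where b': "b < b'" "b' < a" using dense[OF b(2)] by blast
    have "b > 0" "b' > 0" using b b' \<rho> by auto
    \<comment> \<open>Chosen so that the bound b / sqrt(\<alpha> N) for R on the window becomes b'
      after multiplication by sqrt N, which is still below a.\<close>
    define \<alpha> where "\<alpha> = (b / b')\<^sup>2"
    have \<alpha>: "0 < \<alpha>" "\<alpha> < 1" using \<open>b > 0\<close> b' by (auto simp: \<alpha>_def power_less_one_iff)
    have sa: "sqrt \<alpha> = b / b'" using \<open>b > 0\<close> b' by (simp add: \<alpha>_def)
    obtain M where M: "\<And>m. m \<ge> M \<Longrightarrow> sqrt (real m) * R m < b"
      using order_tendstoD(2)[OF R_lim b(1)] unfolding eventually_sequentially by blast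
    have "\<forall>\<^sub>F N in sequentially. real N \<ge> real M / \<alpha>"
      using filterlim_real_sequentially unfolding filterlim_at_top by blast
    moreover have "(a - b') / 2 > 0" using b' by simp
    note Karamata_window(1)[OF Q R limQ limR \<alpha> this]
    ultimately show ?thesis
      using eventually_gt_at_top[of 0]
    proof eventually_elim
      case (elim N)
      define v where "v = b / sqrt (\<alpha> * N)"
      have "\<forall>m. \<alpha> * N < real m \<and> real m < 1 * real N \<longrightarrow> Q N \<le> Q m \<and> R m \<le> v"
      proof (safe)
        fix m assume m: "\<alpha> * N < real m" "real m < 1 * real N"
        show "Q N \<le> Q m" using m decseqD[OF dec, of m N] by simp
        have "real M \<le> \<alpha> * N" using elim(1) \<alpha> by (simp add: field_simps)
        hence "m \<ge> M" using m by linarith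
        have "\<alpha> * N > 0" using \<alpha> elim by simp
        hence "m > 0" using m by linarith
        have "R m \<le> b / sqrt (real m)" using M[OF \<open>m \<ge> M\<close>] \<open>m > 0\<close> by (simp add: field_simps)
        also have "\<dots> \<le> v" unfolding v_def using m \<open>b > 0\<close> \<open>\<alpha> * N > 0\<close> \<open>m > 0\<close>
          by (intro divide_left_mono mult_pos_pos) auto
        finally show "R m \<le> v" .
      qed
      hence "sqrt N * Q N \<le> sqrt N * v + (a - b') / 2" using elim(2) by blast
      also have "sqrt N * v = b'" using elim(3) \<open>b > 0\<close> \<open>b' > 0\<close>
        by (simp add: v_def real_sqrt_mult sa)
      also have "b' + (a - b') / 2 < a" using b' by (simp add: field_simps)
      finally show ?case .
    qed
  qed
  moreover have "\<forall>\<^sub>F N in sequentially. a < sqrt (real N) * Q N" if a0: "a < \<rho>" for a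
  proof -
    obtain a' where a': "a \<le> a'" "0 < a'" "a' < \<rho>"
      using a0 \<rho> by (metis dense less_eq_real_def linorder_not_le order.trans)
    obtain b where b: "a' < b" "b < \<rho>" using dense[OF a'(3)] by blast
    obtain b' where b': "a' < b'" "b' < b" using dense[OF b(1)] by blast
    have "b > 0" "b' > 0" using b b' a' by auto
    define \<beta> where "\<beta> = (b / b')\<^sup>2"
    have \<beta>: "0 < (1::real)" "1 < \<beta>" using \<open>b' > 0\<close> b' by (auto simp: \<beta>_def one_less_power)
    have sb: "sqrt \<beta> = b / b'" using \<open>b > 0\<close> \<open>b' > 0\<close> by (simp add: \<beta>_def)
    obtain M where M: "\<And>m. m \<ge> M \<Longrightarrow> b < sqrt (real m) * R m"
      using order_tendstoD(1)[OF R_lim b(2)] unfolding eventually_sequentially by blast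
    have "(b' - a') / 2 > 0" using b' by simp
    from eventually_ge_at_top[of M] eventually_gt_at_top[of 0] 
      Karamata_window(2)[OF Q R limQ limR \<beta> this] show ?thesis
    proof eventually_elim
      case (elim N)
      define v where "v = b / sqrt (\<beta> * N)"
      have "\<forall>m. 1 * real N < real m \<and> real m < \<beta> * N \<longrightarrow> Q m \<le> Q N \<and> v \<le> R m"
      proof (safe)
        fix m assume m: "1 * real N < real m" "real m < \<beta> * real N"
        show "Q m \<le> Q N" using m decseqD[OF dec, of N m] by simp
        have "m \<ge> M" "m > 0" using m elim by auto
        have "v \<le> b / sqrt (real m)" unfolding v_def using m \<open>b > 0\<close> \<open>m > 0\<close> elim(2) \<beta>
          by (intro divide_left_mono mult_pos_pos) auto
        also have "\<dots> \<le> R m" using M[OF \<open>m \<ge> M\<close>] \<open>m > 0\<close> by (simp add: field_simps)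
        finally show "v \<le> R m" .
      qed
      hence "sqrt N * v \<le> sqrt N * Q N + (b' - a') / 2" using elim(3) by blast
      moreover have "sqrt N * v = b'" using elim(2) \<open>b > 0\<close> \<open>b' > 0\<close>
        by (simp add: v_def real_sqrt_mult sb)
      ultimately have "b' - (b' - a') / 2 \<le> sqrt N * Q N" by simp
      moreover have "a < b' - (b' - a') / 2" using a' b' by (simp add: field_simps)
      ultimately show ?case by linarith
    qed
  qed
  ultimately show ?thesis unfolding \<rho>_def[symmetric]
    by (intro order_tendstoI) auto
qed

section \<open>Bounded differences\<close>

lemma integrable_pmf_bounded:
  fixes f :: "'a \<Rightarrow> real"
  assumes "\<And>x. \<bar>f x\<bar> \<le> H"
  shows "integrable (measure_pmf p) f"
  by (rule measure_pmf.integrable_const_bound[where B = H]) (use assms in auto)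

lemma expectation_pmf_bounded:
  fixes f :: "'a \<Rightarrow> real"
  assumes "\<And>x. \<bar>f x\<bar> \<le> H"
  shows "\<bar>expect p f\<bar> \<le> H"
proof -
  have "expect p f \<le> H" "- H \<le> expect p f"
    using assms[THEN abs_le_D2] assms[THEN abs_le_D1]
    by (auto intro!: measure_pmf.integral_le_const measure_pmf.integral_ge_const
          integrable_pmf_bounded[OF assms] AE_I2 simp: minus_le_iff)
  thus ?thesis by linarith
qed

lemma expectation_bind_pmf_bounded:
  fixes f :: "'b \<Rightarrow> real"
  assumes H: "\<And>x. \<bar>f x\<bar> \<le> H"
  shows "expect (bind_pmf p g) f
       = expect p (\<lambda>x. expect (g x) f)"
proof -
  have i: "integrable (measure_pmf q) f" for q by (rule integrable_pmf_bounded[OF H])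
  have nn: "0 \<le> f x + H" for x using H[of x] by linarith
  have *: "(\<integral>\<^sup>+x. ennreal (f x + H) \<partial>measure_pmf q) = ennreal (expect q f + H)" for q
    using nn by (subst nn_integral_eq_integral) (auto simp: i)
  have bE: "\<bar>expect q f\<bar> \<le> H" for q by (rule expectation_pmf_bounded[OF H])
  have nE: "0 \<le> expect q f + H" for q
    using bE[of q] by linarith
  have i2: "integrable (measure_pmf p) (\<lambda>x. expect (g x) f)"
    by (rule integrable_pmf_bounded[OF bE])
  have "ennreal (expect (bind_pmf p g) f + H)
      = (\<integral>\<^sup>+x. ennreal (expect (g x) f + H) \<partial>measure_pmf p)"
    by (simp flip: *)
  also have "\<dots> = ennreal (expect p (\<lambda>x. expect (g x) f) + H)"
    using nE by (subst nn_integral_eq_integral) (auto simp: i2)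
  finally show ?thesis
    using nE integral_nonneg_AE[of "\<lambda>x. expect (g x) f + H" p]
    by (subst (asm) ennreal_inj) (auto simp: i2)
qed

lemma expectation_replicate_pmf_Suc:
  fixes f :: "'a list \<Rightarrow> real"
  assumes "\<And>xs. \<bar>f xs\<bar> \<le> H"
  shows "expect (replicate_pmf (Suc n) p) f
       = expect p (\<lambda>x. expect (replicate_pmf n p) (\<lambda>xs. f (x # xs)))"
proof -
  have "replicate_pmf (Suc n) p = bind_pmf p (\<lambda>x. map_pmf ((#) x) (replicate_pmf n p))"
    by (simp add: map_pmf_def)
  thus ?thesis by (simp add: expectation_bind_pmf_bounded[OF assms] del: replicate_pmf.simps)
qed

lemma expectation_exp_interval:
  fixes G :: "'a \<Rightarrow> real"
  assumes "\<And>x. G x \<in> {a..a + c}" "s > 0"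
  shows "expect p (\<lambda>x. exp (s * G x))
       \<le> exp (s * expect p G + s\<^sup>2 * c\<^sup>2 / 8)"
proof -
  interpret interval_bounded_random_variable "measure_pmf p" G a "a + c"
    by unfold_locales (use assms in auto)
  define E where "E = expect p G"
  have b: "\<bar>exp (s * (G x - E))\<bar> \<le> exp (s * (a + c - E))" for x
    using assms by (simp add: mult_left_mono)
  have "ennreal (expect p (\<lambda>x. exp (s * (G x - E)))) =
     (\<integral>\<^sup>+x. ennreal (exp (s * (G x - E))) \<partial>measure_pmf p)"
    by (subst nn_integral_eq_integral) (auto intro!: integrable_pmf_bounded[OF b])
  also have "\<dots> \<le> ennreal (exp (s\<^sup>2 * (a + c - a)\<^sup>2 / 8))"
    unfolding E_def by (rule Hoeffdings_lemma_nn_integral) fact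
  finally have "expect p (\<lambda>x. exp (s * (G x - E))) \<le> exp (s\<^sup>2 * c\<^sup>2 / 8)"
    by simp
  moreover have "expect p (\<lambda>x. exp (s * G x)) 
      = exp (s * E) * expect p (\<lambda>x. exp (s * (G x - E)))"
    by (subst integral_mult_right_zero[symmetric]) (simp add: right_diff_distrib exp_diff)
  ultimately show ?thesis unfolding E_def[symmetric] by (simp add: exp_add mult_left_mono)
qed

text \<open>Induction on the first letter. Averaging over the other letters leaves a function G of
  one letter whose values lie in an interval of length c, so Hoeffding's lemma contributes a factor
  exp(s^2 c^2 / 8) per letter.\<close>

lemma McDiarmid_mgf:
  fixes f :: "'a list \<Rightarrow> real"
  assumes "\<And>xs. \<bar>f xs\<bar> \<le> H"
    and "\<And>xs i y. length xs = n \<Longrightarrow> i < n \<Longrightarrow> \<bar>f (xs[i := y]) - f xs\<bar> \<le> c"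
    and s: "s > 0"
  shows "expect (replicate_pmf n p) (\<lambda>xs. exp (s * f xs))
       \<le> exp (s * expect (replicate_pmf n p) f + n * (s\<^sup>2 * c\<^sup>2 / 8))"
  using assms(1,2)
proof (induction n arbitrary: f)
  case 0
  show ?case by simp
next
  case (Suc n)
  let ?P = "replicate_pmf n p"
  define G where "G x = expect ?P (\<lambda>xs. f (x # xs))" for x
  have i: "integrable (measure_pmf ?P) (\<lambda>xs. f (x # xs))" for x
    by (rule integrable_pmf_bounded[OF Suc.prems(1)])
  have G: "\<bar>G x\<bar> \<le> H" for x unfolding G_def by (rule expectation_pmf_bounded[OF Suc.prems(1)])
  have G_diff: "G x \<le> G y + c" for x y
  proof -
    have "G x \<le> expect ?P (\<lambda>xs. f (y # xs) + c)"
      unfolding G_def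
    proof (rule integral_mono_AE)
      show "AE xs in measure_pmf ?P. f (x # xs) \<le> f (y # xs) + c"
      proof (rule AE_pmfI)
        fix xs assume "xs \<in> set_pmf ?P"
        hence "length (y # xs) = Suc n" by (simp add: set_replicate_pmf)
        from Suc.prems(2)[OF this, of 0 x] show "f (x # xs) \<le> f (y # xs) + c" by simp
      qed
    qed (use i in auto)
    thus ?thesis using i by (simp add: G_def)
  qed
  define a where "a = Inf (range G)"
  have bdd: "bdd_below (range G)" using G[THEN abs_le_D2] by (intro bdd_belowI2[of _ "-H"]) (simp add: minus_le_iff)
  have Ga: "G x \<in> {a..a + c}" for x
  proof -
    have "a \<le> G x" unfolding a_def by (rule cInf_lower) (use bdd in auto)
    moreover have "G x - c \<le> a" unfolding a_def
      by (rule cInf_greatest) (use G_diff[of x] in \<open>auto simp: diff_le_eq\<close>)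
    ultimately show ?thesis by simp
  qed
  have exp_bdd: "\<bar>exp (s * f xs)\<bar> \<le> exp (s * H)" for xs
    using s abs_le_D1[OF Suc.prems(1)[of xs]] by simp
  have exp_bdd2: "\<bar>exp (s * G x + t)\<bar> \<le> exp (s * H + t)" for x t
    using s abs_le_D1[OF G[of x]] by simp
  have IH: "expect ?P (\<lambda>xs. exp (s * f (x # xs))) \<le> exp (s * G x + n * (s\<^sup>2 * c\<^sup>2 / 8))" for x
    unfolding G_def
  proof (rule Suc.IH)
    show "\<bar>f (x # xs[i := y]) - f (x # xs)\<bar> \<le> c" if "length xs = n" "i < n" for xs i y
      using Suc.prems(2)[of "x # xs" "Suc i" y] that by simp
  qed (rule Suc.prems(1))
  have "expect (replicate_pmf (Suc n) p) (\<lambda>xs. exp (s * f xs))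
      = expect p (\<lambda>x. expect ?P (\<lambda>xs. exp (s * f (x # xs))))"
    by (rule expectation_replicate_pmf_Suc[OF exp_bdd])
  also have "\<dots> \<le> expect p (\<lambda>x. exp (s * G x + n * (s\<^sup>2 * c\<^sup>2 / 8)))"
    by (intro integral_mono IH integrable_pmf_bounded[OF expectation_pmf_bounded[OF exp_bdd]]
          integrable_pmf_bounded[OF exp_bdd2])
  also have "\<dots> = exp (n * (s\<^sup>2 * c\<^sup>2 / 8)) * expect p (\<lambda>x. exp (s * G x))"
    by (simp add: exp_add mult.commute)
  also have "\<dots> \<le> exp (n * (s\<^sup>2 * c\<^sup>2 / 8)) * exp (s * expect p G + s\<^sup>2 * c\<^sup>2 / 8)"
    by (intro mult_left_mono expectation_exp_interval[OF Ga s]) auto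
  also have "expect p G = expect (replicate_pmf (Suc n) p) f"
    unfolding G_def by (rule expectation_replicate_pmf_Suc[OF Suc.prems(1), symmetric])
  finally show ?case by (simp add: algebra_simps add_divide_distrib flip: exp_add)
qed

theorem McDiarmid_upper:
  fixes f :: "'a list \<Rightarrow> real"
  assumes H: "\<And>xs. \<bar>f xs\<bar> \<le> H"
    and diff: "\<And>xs i y. length xs = n \<Longrightarrow> i < n \<Longrightarrow> \<bar>f (xs[i := y]) - f xs\<bar> \<le> c"
    and "n > 0" "c > 0" "d \<ge> 0"
  shows "prob (replicate_pmf n p) {xs. f xs \<ge> expect (replicate_pmf n p) f + d}
       \<le> exp (- 2 * d\<^sup>2 / (n * c\<^sup>2))"
proof (cases "d = 0")
  case False
  hence d: "d > 0" using assms by simp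
  let ?P = "replicate_pmf n p"
  define E where "E = expect ?P f"
  \<comment> \<open>The minimiser of n s^2 c^2 / 8 - s d. It is positive only for d > 0; for d = 0
    the claimed bound is 1.\<close>
  define s where "s = 4 * d / (n * c\<^sup>2)"
  have s: "s > 0" using d assms by (simp add: s_def)
  have b: "\<bar>exp (s * f xs)\<bar> \<le> exp (s * H)" for xs
    using s abs_le_D1[OF H[of xs]] by simp
  have "prob ?P {xs. f xs \<ge> E + d} = prob ?P {xs \<in> space ?P. exp (s * (E + d)) \<le> exp (s * f xs)}"
    using s by simp
  also have "\<dots> \<le> expect ?P (\<lambda>xs. exp (s * f xs)) / exp (s * (E + d))"
    by (rule integral_Markov_inequality_measure[of _ _ UNIV])
       (auto intro!: integrable_pmf_bounded[OF b])
  also have "\<dots> \<le> exp (s * E + n * (s\<^sup>2 * c\<^sup>2 / 8)) / exp (s * (E + d))"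
    unfolding E_def by (intro divide_right_mono McDiarmid_mgf[OF H diff s]) auto
  also have "\<dots> = exp (n * (s\<^sup>2 * c\<^sup>2 / 8) - s * d)"
    by (simp add: algebra_simps flip: exp_diff)
  also have "n * (s\<^sup>2 * c\<^sup>2 / 8) - s * d = - 2 * d\<^sup>2 / (n * c\<^sup>2)"
    using assms by (simp add: s_def field_simps power2_eq_square)
  finally show ?thesis unfolding E_def .
qed simp

corollary McDiarmid_lower:
  fixes f :: "'a list \<Rightarrow> real"
  assumes H: "\<And>xs. \<bar>f xs\<bar> \<le> H"
    and diff: "\<And>xs i y. length xs = n \<Longrightarrow> i < n \<Longrightarrow> \<bar>f (xs[i := y]) - f xs\<bar> \<le> c"
    and "n > 0" "c > 0" "d \<ge> 0"
  shows "prob (replicate_pmf n p) {xs. f xs \<le> expect (replicate_pmf n p) f - d}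
       \<le> exp (- 2 * d\<^sup>2 / (n * c\<^sup>2))"
proof -
  have "\<bar>- f xs\<bar> \<le> H" for xs using H by simp
  moreover have "\<bar>- f (xs[i := y]) - - f xs\<bar> \<le> c" if "length xs = n" "i < n" for xs i y
    using diff[OF that, of y] by linarith
  ultimately have "prob (replicate_pmf n p) {xs. - f xs \<ge> expect (replicate_pmf n p) (\<lambda>xs. - f xs) + d}
       \<le> exp (- 2 * d\<^sup>2 / (n * c\<^sup>2))"
    by (rule McDiarmid_upper) (use assms in auto)
  moreover have "{xs. - f xs \<ge> expect (replicate_pmf n p) (\<lambda>xs. - f xs) + d}
      = {xs. f xs \<le> expect (replicate_pmf n p) f - d}" by auto
  ultimately show ?thesis by simp
qed

section \<open>Plane trees as words\<close>

text \<open>Lukasiewicz words of plane forests: r counts the trees still to be read, and a letter x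
  replaces one of them by its x branches. A general r is what makes recursion on the first letter
  and concatenation possible.\<close>

fun fword :: "nat \<Rightarrow> nat list \<Rightarrow> bool" where
  "fword 0 xs = (xs = [])"
| "fword (Suc r) [] = False"
| "fword (Suc r) (x # xs) = fword (r + x) xs"

lemma fword_append: "fword r xs \<Longrightarrow> fword s ys \<Longrightarrow> fword (r + s) (xs @ ys)"
  by (induction r xs rule: fword.induct) (auto simp: add_ac)

lemma fword_sum_list: "fword r xs \<Longrightarrow> sum_list xs + r = length xs"
  by (induction r xs rule: fword.induct) auto

lemma fword_forest: "(\<And>t. t \<in> set ts \<Longrightarrow> fword 1 (outdegs t)) \<Longrightarrow> fword (length ts) (concat (map outdegs ts))"
proof (induction ts)
  case (Cons t ts)
  thus ?case using fword_append[of 1 "outdegs t" "length ts"] by simp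
qed simp

lemma fword_outdegs: "fword 1 (outdegs t)"
  by (induction t) (simp add: fword_forest)

lemma fword_imp_forest: "fword r xs \<Longrightarrow> \<exists>ts. length ts = r \<and> xs = concat (map outdegs ts)"
proof (induction r xs rule: fword.induct)
  case (3 r x xs)
  then obtain ts where ts: "length ts = r + x" "xs = concat (map outdegs ts)" by auto
  have "xs = concat (map outdegs (take x ts @ drop x ts))" using ts by simp
  hence "x # xs = concat (map outdegs (PNode (take x ts) # drop x ts))"
    using ts(1) by (simp del: append_take_drop_id)
  moreover have "length (PNode (take x ts) # drop x ts) = Suc r" using ts(1) by simp
  ultimately show ?case by blast
qed auto

lemma fword_1_iff: "fword 1 xs \<longleftrightarrow> (\<exists>t. xs = outdegs t)"
proof
  assume "fword 1 xs"
  from fword_imp_forest[OF this] obtain ts where "length ts = 1" "xs = concat (map outdegs ts)" by blast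
  thus "\<exists>t. xs = outdegs t" by (cases ts) auto
qed (auto simp: fword_outdegs simp del: One_nat_def)

text \<open>Tree words form a prefix code. Hence at most one tree starts at each position of an
  arbitrary word, which lets functionals of fringe subtrees be extended to words that encode no
  tree.\<close>

lemma outdegs_append_eq:
  "outdegs t @ ys = outdegs t' @ zs \<Longrightarrow> t = t' \<and> ys = zs"
proof (induction t arbitrary: t' ys zs)
  case (PNode ts)
  obtain ts' where t': "t' = PNode ts'" by (cases t')
  have "ts = ts' \<and> ys = zs"
    if "length ts = length ts'" "concat (map outdegs ts) @ ys = concat (map outdegs ts') @ zs"
    using that PNode.IH
  proof (induction ts ts' rule: list_induct2)
    case (Cons x xs y ys')
    have "x = y \<and> concat (map outdegs xs) @ ys = concat (map outdegs ys') @ zs"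
      using Cons.prems(1) by (intro Cons.prems(2)) auto
    moreover have "xs = ys' \<and> ys = zs"
      by (rule Cons.IH) (use calculation Cons.prems(2) in auto)
    ultimately show ?case by simp
  qed auto
  with PNode.prems t' show ?case by auto
qed

lemma inj_outdegs: "inj outdegs"
  using outdegs_append_eq[of _ "[]" _ "[]"] by (auto intro: injI)

lemma prefix_outdegs_unique:
  "prefix (outdegs t) xs \<Longrightarrow> prefix (outdegs t') xs \<Longrightarrow> t = t'"
  using outdegs_append_eq by (auto simp: prefix_def)

lemma tsize_pos: "tsize t > 0"
  by (cases t) (simp add: tsize_def)

lemma outdegs_nonempty: "outdegs t \<noteq> []"
  by (cases t) simp

lemma outdegs_less_tsize: "x \<in> set (outdegs t) \<Longrightarrow> x < tsize t"
  using fword_sum_list[OF fword_outdegs[of t]] member_le_sum_list[of x "outdegs t"]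
  by (simp add: tsize_def)

lemma finite_tsize_le: "finite {t. tsize t \<le> m}"
proof (rule finite_imageD)
  show "finite (outdegs ` {t. tsize t \<le> m})"
  proof (rule finite_subset)
    show "outdegs ` {t. tsize t \<le> m} \<subseteq> {xs. set xs \<subseteq> {..m} \<and> length xs \<le> m}"
      using outdegs_less_tsize by (force simp: tsize_def)
  qed (rule finite_lists_length_le, simp)
qed (rule inj_on_subset[OF inj_outdegs], simp)

lemma finite_tsize_eq: "finite {t. tsize t = m}"
  by (rule finite_subset[OF _ finite_tsize_le[of m]]) auto

lemma zero_in_outdegs: "0 \<in> set (outdegs t)"
proof -
  have "\<exists>x\<in>set xs. x = 0" if "fword r xs" "r > 0" for r xs
    using that
  proof (induction r xs rule: fword.induct)
    case (3 r x xs)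
    thus ?case by (cases "r + x = 0") auto
  qed auto
  from this[OF fword_outdegs[of t]] show ?thesis by auto
qed

text \<open>The fringe subtrees in preorder and with repetitions, so that \<open>subs t ! i\<close>
  hangs at the vertex whose letter is at position i of \<open>outdegs t\<close>.\<close>

primrec subs :: "ptree \<Rightarrow> ptree list" where
  "subs (PNode ts) = PNode ts # concat (map subs ts)"

lemma length_subs: "length (subs t) = tsize t"
proof (induction t)
  case (PNode ts)
  hence "(\<Sum>x\<leftarrow>ts. length (subs x)) = (\<Sum>x\<leftarrow>ts. length (outdegs x))"
    by (intro arg_cong[of _ _ sum_list] map_cong) (auto simp: tsize_def)
  thus ?case by (simp add: tsize_def length_concat comp_def)
qed

lemma set_subs: "set (subs t) = fringe_subtrees t"
  by (induction t) auto

lemma prefix_subs: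
  "i < tsize t \<Longrightarrow> prefix (outdegs (subs t ! i)) (drop i (outdegs t))"
proof (induction t arbitrary: i)
  case (PNode ts)
  have *: "prefix (outdegs (concat (map subs ts) ! i)) (drop i (concat (map outdegs ts)))"
    if "i < length (concat (map outdegs ts))" for i
    using that PNode.IH
  proof (induction ts arbitrary: i)
    case (Cons t ts)
    show ?case
    proof (cases "i < tsize t")
      case True
      hence "prefix (outdegs (subs t ! i)) (drop i (outdegs t))" by (intro Cons.prems) auto
      thus ?thesis using True
        by (auto simp: nth_append length_subs tsize_def intro: prefix_order.trans)
    next
      case False
      hence "prefix (outdegs (concat (map subs ts) ! (i - tsize t))) (drop (i - tsize t) (concat (map outdegs ts)))"
        using Cons.prems by (intro Cons.IH) (auto simp: tsize_def)
      thus ?thesis using False by (simp add: nth_append length_subs tsize_def)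
    qed
  qed simp
  show ?case
  proof (cases i)
    case (Suc k)
    thus ?thesis using PNode.prems *[of k] by (simp add: tsize_def)
  qed simp
qed

lemma tsize_subs_le: "i < tsize t \<Longrightarrow> tsize (subs t ! i) \<le> tsize t - i"
  using prefix_length_le[OF prefix_subs] by (fastforce simp: tsize_def)

section \<open>Unordered shapes and their probabilities\<close>

lemma uoutdegs_shape: "uoutdegs (shape t) = mset (outdegs t)"
proof (induction t)
  case (PNode ts)
  hence "image_mset (\<lambda>x. uoutdegs (shape x)) (mset ts) = image_mset (\<lambda>x. mset (outdegs x)) (mset ts)"
    by (intro image_mset_cong) auto
  thus ?case
    by (simp add: mset_concat image_mset.compositionality comp_def flip: sum_mset_sum_list)
qed

lemma tsize_shape: "size (uoutdegs (shape t)) = tsize t"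
  by (simp add: uoutdegs_shape tsize_def)

lemma tsize_eq_if_shape_eq: "shape t = shape t' \<Longrightarrow> tsize t = tsize t'"
  by (metis tsize_shape)

lemma surj_shape: "\<exists>t. shape t = u"
proof (induction u)
  case (UNode N)
  have "\<exists>ts. mset (map shape ts) = N" if "\<And>u. u \<in> set_mset N \<Longrightarrow> \<exists>t. shape t = u" for N
    using that
  proof (induction N)
    case (add x N)
    then obtain t ts where "shape t = x" "mset (map shape ts) = N" by force
    hence "mset (map shape (t # ts)) = add_mset x N" by simp
    thus ?case by blast
  qed simp
  from this[OF UNode] obtain ts where "mset (map shape ts) = N" by blast
  hence "shape (PNode ts) = UNode N" by simp
  thus ?case by blast
qed

lemma finite_shape_eq: "finite {t. shape t = u}"
proof -
  obtain t where "shape t = u" using surj_shape by blast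
  hence "{t. shape t = u} \<subseteq> {s. tsize s \<le> tsize t}"
    by (auto dest: tsize_eq_if_shape_eq)
  thus ?thesis by (rule finite_subset) (rule finite_tsize_le)
qed

lemma weight_PNode: "weight p (PNode ts) = p (length ts) * (\<Prod>t\<leftarrow>ts. weight p t)"
proof -
  have "prod_list (map p (concat (map outdegs ts))) = (\<Prod>t\<leftarrow>ts. prod_list (map p (outdegs t)))"
    by (induction ts) auto
  thus ?thesis by (simp add: weight_def)
qed

lemma weight_nonneg: "(\<And>m. p m \<ge> 0) \<Longrightarrow> weight p t \<ge> 0"
  unfolding weight_def by (rule prod_list_nonneg) auto

lemma weight_pos_iff:
  fixes p :: "nat \<Rightarrow> real"
  assumes "\<And>m. p m \<ge> 0"
  shows "weight p t > 0 \<longleftrightarrow> (\<forall>m\<in>set (outdegs t). p m > 0)"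
proof -
  have "prod_list (map p xs) > 0 \<longleftrightarrow> (\<forall>m\<in>set xs. p m > 0)" for xs
    using assms by (induction xs) (auto simp: zero_less_mult_iff less_le prod_list_zero_iff)
  thus ?thesis by (simp add: weight_def)
qed

text \<open>For p = \<open>pmf \<xi>\<close> this is the probability that the Galton-Watson tree has
  shape u.\<close>

definition shape_weight :: "(nat \<Rightarrow> real) \<Rightarrow> utree \<Rightarrow> real" where
  "shape_weight p u = (\<Sum>t | shape t = u. weight p t)"

lemma shape_weight_nonneg: "(\<And>m. p m \<ge> 0) \<Longrightarrow> shape_weight p u \<ge> 0"
  unfolding shape_weight_def by (intro sum_nonneg weight_nonneg) auto

lemma finite_map_shape_eq: "finite {ts. map shape ts = us}"
proof (induction us)
  case (Cons u us)
  have "{ts. map shape ts = u # us} = (\<lambda>(t, ts). t # ts) ` ({t. shape t = u} \<times> {ts. map shape ts = us})"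
    by (auto simp: image_iff map_eq_Cons_conv)
  thus ?case using Cons finite_shape_eq by simp
qed simp

lemma sum_forests_weight:
  "(\<Sum>ts | map shape ts = us. \<Prod>t\<leftarrow>ts. weight p t) = (\<Prod>u\<leftarrow>us. shape_weight p u)"
proof (induction us)
  case (Cons u us)
  have eq: "{ts. map shape ts = u # us} = (\<lambda>(t, ts). t # ts) ` ({t. shape t = u} \<times> {ts. map shape ts = us})"
    by (auto simp: image_iff map_eq_Cons_conv)
  have "(\<Sum>ts | map shape ts = u # us. \<Prod>t\<leftarrow>ts. weight p t)
      = (\<Sum>(t, ts)\<in>{t. shape t = u} \<times> {ts. map shape ts = us}. weight p t * (\<Prod>t\<leftarrow>ts. weight p t))"
    unfolding eq by (subst sum.reindex) (auto intro!: inj_onI sum.cong)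
  also have "\<dots> = shape_weight p u * (\<Prod>u\<leftarrow>us. shape_weight p u)"
    unfolding sum.cartesian_product[symmetric] sum_product[symmetric] Cons.IH shape_weight_def
    by (simp add: sum_distrib_left sum_distrib_right Cons.IH[symmetric] flip: sum_product)
  finally show ?case by simp
qed simp

text \<open>A plane tree of the given shape amounts to an ordering of the multiset of branch shapes
  and an independent choice of a plane tree for each branch.\<close>

lemma shape_weight_UNode:
  "shape_weight p (UNode N) =
     p (size N) * real (card (permutations_of_multiset N)) * (\<Prod>u\<in>#N. shape_weight p u)"
proof -
  have eq: "{t. shape t = UNode N} = PNode ` (\<Union>us\<in>permutations_of_multiset N. {ts. map shape ts = us})"
    (is "?L = ?R")
  proof (intro equalityI subsetI)
    fix t assume t: "t \<in> ?L"
    obtain ts where "t = PNode ts" by (cases t)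
    with t show "t \<in> ?R" by (auto simp: permutations_of_multiset_def)
  qed (auto simp: permutations_of_multiset_def)
  have "shape_weight p (UNode N) = (\<Sum>ts\<in>(\<Union>us\<in>permutations_of_multiset N. {ts. map shape ts = us}).
      weight p (PNode ts))"
    unfolding shape_weight_def eq by (subst sum.reindex) (auto intro: inj_onI)
  also have "\<dots> = (\<Sum>us\<in>permutations_of_multiset N. \<Sum>ts | map shape ts = us. weight p (PNode ts))"
    by (intro sum.UNION_disjoint) (auto simp: finite_map_shape_eq)
  also have "\<dots> = (\<Sum>us\<in>permutations_of_multiset N. p (size N) * (\<Prod>u\<in>#N. shape_weight p u))"
  proof (rule sum.cong[OF refl])
    fix us assume "us \<in> permutations_of_multiset N"
    hence us: "mset us = N" by (rule permutations_of_multisetD)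
    have "(\<Sum>ts | map shape ts = us. weight p (PNode ts))
        = (\<Sum>ts | map shape ts = us. p (size N) * (\<Prod>t\<leftarrow>ts. weight p t))"
      by (intro sum.cong) (auto simp: weight_PNode simp flip: us)
    also have "\<dots> = p (size N) * (\<Prod>u\<leftarrow>us. shape_weight p u)"
      by (simp add: sum_forests_weight flip: sum_distrib_left)
    also have "(\<Prod>u\<leftarrow>us. shape_weight p u) = (\<Prod>u\<in>#N. shape_weight p u)"
      unfolding us[symmetric] by (simp flip: prod_mset_prod_list)
    finally show "(\<Sum>ts | map shape ts = us. weight p (PNode ts)) = p (size N) * (\<Prod>u\<in>#N. shape_weight p u)" .
  qed
  finally show ?thesis by simp
qed

text \<open>The number of orderings of the branches is the multinomial coefficient inside the toll,
  so unfolding the recursion over all vertices makes the log-probability of the shape additive.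
  Positive weight keeps every vertex away from the default value 0 of the toll.\<close>

lemma shape_weight_eq_exp_toll:
  assumes "weight (pmf \<xi>) t > 0"
  shows "shape_weight (pmf \<xi>) (shape t) = exp (\<Sum>s\<leftarrow>subs t. toll \<xi> s)"
  using assms
proof (induction t)
  case (PNode ts)
  define N where "N = mset (map shape ts)"
  have pos: "pmf \<xi> (length ts) > 0" "\<And>t. t \<in> set ts \<Longrightarrow> weight (pmf \<xi>) t > 0"
    using PNode.prems by (auto simp: weight_pos_iff)
  define D where "D = (\<Prod>u\<in>set_mset N. fact (count N u) :: nat)"
  have D: "D > 0" by (simp add: D_def prod_pos)
  have "real (card (permutations_of_multiset N)) = fact (size N) / real D"
    using card_permutations_of_multiset[of N] by (simp add: D_def real_of_nat_div)
  moreover have "exp (toll \<xi> (PNode ts)) = pmf \<xi> (size N) * fact (size N) / real D"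
  proof -
    have "(\<Prod>u\<in>set (map shape ts). fact (count (mset (map shape ts)) u)) = real D"
      by (simp add: D_def N_def)
    thus ?thesis using pos(1) D by (simp add: exp_diff N_def del: mset_map)
  qed
  ultimately have "shape_weight (pmf \<xi>) (shape (PNode ts)) = exp (toll \<xi> (PNode ts)) * (\<Prod>t\<leftarrow>ts. shape_weight (pmf \<xi>) (shape t))"
    by (simp add: shape_weight_UNode N_def[symmetric] del: mset_map toll.simps)
       (simp add: N_def prod_mset_prod_list comp_def flip: mset_map)
  also have "(\<Prod>t\<leftarrow>ts. shape_weight (pmf \<xi>) (shape t)) = (\<Prod>t\<leftarrow>ts. exp (\<Sum>s\<leftarrow>subs t. toll \<xi> s))"
    using PNode.IH pos(2) by (intro arg_cong[of _ _ prod_list] map_cong) auto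
  also have "\<dots> = exp (\<Sum>s\<leftarrow>concat (map subs ts). toll \<xi> s)"
    by (induction ts) (auto simp: exp_add)
  finally show ?case by (simp add: exp_add del: toll.simps)
qed

section \<open>Random words\<close>

lemma pmf_replicate_pmf:
  "length xs = n \<Longrightarrow> pmf (replicate_pmf n p) xs = (\<Prod>x\<leftarrow>xs. pmf p x)"
proof (induction xs arbitrary: n)
  case (Cons y ys)
  then obtain m where n: "n = Suc m" "length ys = m" by (cases n) auto
  have "replicate_pmf n p = map_pmf (\<lambda>(x, xs). x # xs) (pair_pmf p (replicate_pmf m p))"
    unfolding n by (simp add: pair_pmf_def map_bind_pmf bind_return_pmf map_pmf_def bind_assoc_pmf)
  also have "pmf \<dots> ((\<lambda>(x, xs). x # xs) (y, ys)) = pmf (pair_pmf p (replicate_pmf m p)) (y, ys)"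
    by (rule pmf_map_inj') (auto intro!: injI)
  finally show ?case using Cons.IH[OF n(2)] by (simp add: pmf_pair)
qed simp

lemma expectation_of_bool_eq_mult:
  "expect p (\<lambda>x. of_bool (x = a) * f x) = pmf p a * (f a :: real)"
proof -
  have "(\<lambda>x. of_bool (x = a) * f x) = (\<lambda>x. indicator {a} x * f a)"
    by (auto simp: fun_eq_iff)
  thus ?thesis by (simp add: measure_pmf_single)
qed

text \<open>Independence of the letters behind a fixed prefix; it later decouples an occurrence of a
  tree from what follows it.\<close>

lemma expectation_prefix:
  fixes h :: "'a list \<Rightarrow> real"
  assumes H: "\<And>xs. \<bar>h xs\<bar> \<le> H"
  shows "length w \<le> n \<Longrightarrow>
    expect (replicate_pmf n p) (\<lambda>xs. of_bool (prefix w xs) * h (drop (length w) xs))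
     = (\<Prod>x\<leftarrow>w. pmf p x) * expect (replicate_pmf (n - length w) p) h"
proof (induction w arbitrary: n)
  case (Cons x w)
  then obtain m where n: "n = Suc m" "length w \<le> m" by (cases n) auto
  have b: "\<bar>of_bool (prefix v ys) * h (drop k ys)\<bar> \<le> H" for v ys k
    using H[of "drop k ys"] abs_ge_zero[of "h []"] H[of "[]"] by (cases "prefix v ys") auto
  have "expect (replicate_pmf n p) (\<lambda>xs. of_bool (prefix (x # w) xs) * h (drop (length (x # w)) xs))
      = expect p (\<lambda>y. expect (replicate_pmf m p)
           (\<lambda>xs. of_bool (prefix (x # w) (y # xs)) * h (drop (length (x # w)) (y # xs))))"
    unfolding n by (rule expectation_replicate_pmf_Suc[OF b])
  also have "\<dots> = expect p (\<lambda>y. of_bool (y = x) * expect (replicate_pmf m p)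
           (\<lambda>xs. of_bool (prefix w xs) * h (drop (length w) xs)))"
    by (intro Bochner_Integration.integral_cong refl) auto
  also have "\<dots> = pmf p x * expect (replicate_pmf m p)
           (\<lambda>xs. of_bool (prefix w xs) * h (drop (length w) xs))"
    by (rule expectation_of_bool_eq_mult)
  finally show ?case using Cons.IH[OF n(2)] by (simp add: n)
qed simp

lemma expectation_drop:
  fixes h :: "'a list \<Rightarrow> real"
  assumes H: "\<And>xs. \<bar>h xs\<bar> \<le> H"
  shows "expect (replicate_pmf n p) (\<lambda>xs. h (drop i xs))
       = expect (replicate_pmf (n - i) p) h"
proof (induction i arbitrary: n)
  case (Suc i)
  show ?case
  proof (cases n)
    case (Suc m)
    have "expect (replicate_pmf n p) (\<lambda>xs. h (drop (Suc i) xs))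
       = expect p (\<lambda>x. expect (replicate_pmf m p) (\<lambda>xs. h (drop (Suc i) (x # xs))))"
      unfolding Suc by (rule expectation_replicate_pmf_Suc[OF H])
    thus ?thesis using Suc.IH[of m] Suc by simp
  qed simp
qed simp

text \<open>The value of G at the tree that starts the word, and 0 if no tree of size at most m
  does; at most one summand is nonzero. It reads only m letters, and as a finite sum it has an
  explicit expectation.\<close>

definition tree_functional :: "nat \<Rightarrow> (ptree \<Rightarrow> real) \<Rightarrow> nat list \<Rightarrow> real" where
  "tree_functional m G xs = (\<Sum>t | tsize t \<le> m. G t * of_bool (prefix (outdegs t) xs))"

lemma tree_functional_eq:
  assumes "prefix (outdegs t) xs" "tsize t \<le> m"
  shows "tree_functional m G xs = G t"
proof -
  have "tree_functional m G xs = (\<Sum>s | tsize s \<le> m. if s = t then G t else 0)"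
    unfolding tree_functional_def
  proof (rule sum.cong[OF refl])
    show "G s * of_bool (prefix (outdegs s) xs) = (if s = t then G t else 0)" for s
      using prefix_outdegs_unique[of s xs t] assms(1) by (cases "s = t") auto
  qed
  also have "\<dots> = G t" using assms(2) finite_tsize_le by simp
  finally show ?thesis .
qed

lemma tree_functional_eq_0:
  assumes "\<And>t. tsize t \<le> m \<Longrightarrow> \<not> prefix (outdegs t) xs"
  shows "tree_functional m G xs = 0"
  unfolding tree_functional_def using assms by (intro sum.neutral) auto

lemma tree_functional_cases:
  obtains t where "prefix (outdegs t) xs" "tsize t \<le> m" "\<And>G. tree_functional m G xs = G t"
  | "\<And>t. tsize t \<le> m \<Longrightarrow> \<not> prefix (outdegs t) xs" "\<And>G. tree_functional m G xs = 0"
proof (cases "\<exists>t. prefix (outdegs t) xs \<and> tsize t \<le> m")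
  case True
  thus ?thesis using tree_functional_eq that(1) by blast
next
  case False
  thus ?thesis using tree_functional_eq_0 that(2) by blast
qed

lemma tree_functional_abs_le:
  assumes "\<And>t. tsize t \<le> m \<Longrightarrow> \<bar>G t\<bar> \<le> H"
  shows "\<bar>tree_functional m G xs\<bar> \<le> \<bar>H\<bar>"
  by (rule tree_functional_cases[of xs m]) (use assms in force)+

lemma prefix_take_iff: "length w \<le> m \<Longrightarrow> prefix w (take m xs) \<longleftrightarrow> prefix w xs"
  by (auto simp: prefix_def) (metis append.assoc append_take_drop_id)

lemma tree_functional_take: "tree_functional m G (take m xs) = tree_functional m G xs"
  unfolding tree_functional_def by (intro sum.cong refl) (auto simp: prefix_take_iff tsize_def)

lemma expectation_prefix_outdegs:
  assumes "tsize t \<le> n"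
  shows "expect (replicate_pmf n \<xi>) (\<lambda>xs. of_bool (prefix (outdegs t) xs)) = weight (pmf \<xi>) t"
  using expectation_prefix[of "\<lambda>_. 1" 1 "outdegs t" n \<xi>] assms
  by (simp add: weight_def tsize_def)

lemma expectation_tree_functional:
  assumes "m \<le> n"
  shows "expect (replicate_pmf n \<xi>) (tree_functional m G)
       = (\<Sum>t | tsize t \<le> m. G t * weight (pmf \<xi>) t)"
proof -
  have i: "integrable (measure_pmf (replicate_pmf n \<xi>)) (\<lambda>xs. of_bool (prefix (outdegs t) xs) :: real)" for t
    by (rule integrable_pmf_bounded[of _ 1]) auto
  have "expect (replicate_pmf n \<xi>) (tree_functional m G)
     = (\<Sum>t | tsize t \<le> m. expect (replicate_pmf n \<xi>) (\<lambda>xs. G t * of_bool (prefix (outdegs t) xs)))"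
    unfolding tree_functional_def by (rule Bochner_Integration.integral_sum) (use i in simp)
  also have "\<dots> = (\<Sum>t | tsize t \<le> m. G t * weight (pmf \<xi>) t)"
    using assms by (intro sum.cong refl) (simp add: expectation_prefix_outdegs)
  finally show ?thesis .
qed

text \<open>A letter influences only the windows of length \<open>m\<close> that contain it.\<close>

lemma window_sum_update:
  fixes \<psi> :: "'a list \<Rightarrow> real"
  assumes take: "\<And>ys. \<psi> (take m ys) = \<psi> ys" and D: "\<And>ys zs. \<bar>\<psi> ys - \<psi> zs\<bar> \<le> D"
  shows "\<bar>(\<Sum>i<k. \<psi> (drop i (xs[j := y]))) - (\<Sum>i<k. \<psi> (drop i xs))\<bar> \<le> m * D"
proof -
  have D0: "D \<ge> 0" using D[of "[]" "[]"] by simp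
  have eq: "\<psi> (drop i (xs[j := y])) = \<psi> (drop i xs)" if "i \<notin> {Suc j - m..j}" for i
  proof (cases "i > j")
    case True
    thus ?thesis by (simp add: drop_update_cancel)
  next
    case False
    hence "i + m \<le> j" using that by auto
    hence "take m (drop i (xs[j := y])) = take m (drop i xs)"
      by (simp add: drop_update_swap take_update_cancel)
    thus ?thesis using take by metis
  qed
  have "\<bar>(\<Sum>i<k. \<psi> (drop i (xs[j := y]))) - (\<Sum>i<k. \<psi> (drop i xs))\<bar>
      \<le> (\<Sum>i<k. \<bar>\<psi> (drop i (xs[j := y])) - \<psi> (drop i xs)\<bar>)"
    by (simp add: sum_abs flip: sum_subtractf)
  also have "\<dots> \<le> (\<Sum>i<k. if i \<in> {Suc j - m..j} then D else 0)"
    by (intro sum_mono) (use eq D in auto)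
  also have "\<dots> = (\<Sum>i\<in>{..<k} \<inter> {Suc j - m..j}. D)"
    by (rule sum.inter_restrict[symmetric]) simp
  also have "\<dots> \<le> (\<Sum>i\<in>{Suc j - m..j}. D)"
    using D0 by (intro sum_mono2) auto
  also have "\<dots> \<le> m * D"
    using D0 by (auto intro!: mult_right_mono)
  finally show ?thesis .
qed

lemma prob_eq_expectation_of_bool:
  "prob p {x. A x} = expect p (\<lambda>x. of_bool (A x))"
proof -
  have "(\<lambda>x. of_bool (A x)) = (indicator {x. A x} :: _ \<Rightarrow> real)"
    by (auto simp: fun_eq_iff)
  thus ?thesis by simp
qed

section \<open>Forest probabilities and the tree generating function\<close>

definition forest_prob :: "nat pmf \<Rightarrow> nat \<Rightarrow> nat \<Rightarrow> real" where
  "forest_prob \<xi> n r = prob (replicate_pmf n \<xi>) {xs. fword r xs}"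

definition tree_prob :: "nat pmf \<Rightarrow> nat \<Rightarrow> real" where
  "tree_prob \<xi> n = (\<Sum>t | tsize t = n. weight (pmf \<xi>) t)"

lemma tree_prob_nonneg: "tree_prob \<xi> n \<ge> 0"
  unfolding tree_prob_def by (intro sum_nonneg weight_nonneg) auto

lemma prob_outdegs:
  "prob (replicate_pmf n \<xi>) (outdegs ` {t. tsize t = n \<and> A t})
     = (\<Sum>t | tsize t = n \<and> A t. weight (pmf \<xi>) t)"
proof -
  have fin: "finite {t. tsize t = n \<and> A t}"
    by (rule finite_subset[OF _ finite_tsize_eq[of n]]) auto
  have "prob (replicate_pmf n \<xi>) (outdegs ` {t. tsize t = n \<and> A t})
     = (\<Sum>t | tsize t = n \<and> A t. pmf (replicate_pmf n \<xi>) (outdegs t))"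
    using fin by (subst measure_measure_pmf_finite) 
      (auto intro!: sum.reindex inj_on_subset[OF inj_outdegs] simp: sum.reindex[OF inj_on_subset[OF inj_outdegs]])
  also have "\<dots> = (\<Sum>t | tsize t = n \<and> A t. weight (pmf \<xi>) t)"
    by (intro sum.cong refl) (auto simp: pmf_replicate_pmf weight_def tsize_def)
  finally show ?thesis .
qed

lemma prob_replicate_cong:
  assumes "\<And>xs. length xs = n \<Longrightarrow> xs \<in> A \<longleftrightarrow> xs \<in> B"
  shows "prob (replicate_pmf n p) A = prob (replicate_pmf n p) B"
  by (intro measure_pmf.finite_measure_eq_AE) (auto intro!: AE_pmfI simp: assms set_replicate_pmf)

lemma forest_prob_1: "forest_prob \<xi> n 1 = tree_prob \<xi> n"
proof -
  have "forest_prob \<xi> n 1 = prob (replicate_pmf n \<xi>) (outdegs ` {t. tsize t = n \<and> True})"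
    unfolding forest_prob_def by (rule prob_replicate_cong) (auto simp: fword_1_iff tsize_def simp del: One_nat_def)
  also have "\<dots> = tree_prob \<xi> n" unfolding prob_outdegs tree_prob_def by simp
  finally show ?thesis .
qed

lemma forest_prob_nonneg: "forest_prob \<xi> n r \<ge> 0"
  and forest_prob_le_1: "forest_prob \<xi> n r \<le> 1"
  by (simp_all add: forest_prob_def)

lemma abs_forest_prob_le_1: "\<bar>forest_prob \<xi> n r\<bar> \<le> 1"
  by (simp add: forest_prob_nonneg forest_prob_le_1)

lemma forest_prob_0: "forest_prob \<xi> 0 r = of_bool (r = 0)"
  by (cases r) (auto simp: forest_prob_def indicator_def)

lemma forest_prob_Suc_0: "forest_prob \<xi> (Suc n) 0 = 0"
proof -
  have "forest_prob \<xi> (Suc n) 0 = prob (replicate_pmf (Suc n) \<xi>) {}"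
    unfolding forest_prob_def by (rule prob_replicate_cong) auto
  thus ?thesis by simp
qed

lemma forest_prob_Suc_Suc:
  "forest_prob \<xi> (Suc n) (Suc r) = expect \<xi> (\<lambda>j. forest_prob \<xi> n (r + j))"
  unfolding forest_prob_def prob_eq_expectation_of_bool
  by (subst expectation_replicate_pmf_Suc[of _ 1]) auto

text \<open>A word of r trees followed by a word of s trees is a word of r + s trees; the induction
  follows the first letter instead of splitting the word.\<close>

lemma forest_prob_superadditive:
  "forest_prob \<xi> a r * forest_prob \<xi> b s \<le> forest_prob \<xi> (a + b) (r + s)"
proof (induction a arbitrary: r)
  case (Suc a)
  show ?case
  proof (cases r)
    case (Suc r')
    have i: "integrable (measure_pmf \<xi>) (\<lambda>j. forest_prob \<xi> k (f j))" for k f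
      by (rule integrable_pmf_bounded[OF abs_forest_prob_le_1])
    have "forest_prob \<xi> (Suc a) r * forest_prob \<xi> b s
        = expect \<xi> (\<lambda>j. forest_prob \<xi> a (r' + j) * forest_prob \<xi> b s)"
      by (simp add: Suc forest_prob_Suc_Suc)
    also have "\<dots> \<le> expect \<xi> (\<lambda>j. forest_prob \<xi> (a + b) (r' + j + s))"
      by (intro integral_mono Suc.IH i integrable_mult_left)
    also have "\<dots> = forest_prob \<xi> (Suc a + b) (r + s)"
      by (simp add: Suc forest_prob_Suc_Suc add_ac)
    finally show ?thesis .
  qed (simp add: forest_prob_Suc_0 forest_prob_nonneg)
qed (simp add: forest_prob_0 forest_prob_nonneg)

text \<open>Optional stopping for the martingale \<open>s ^ r * z ^ k\<close>, where \<open>r\<close> is the number of pending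
  trees after \<open>k\<close> letters.\<close>

lemma forest_gf_bounds:
  fixes s z :: real
  assumes s: "0 < s" "s \<le> 1" and z: "0 \<le> z" and sz: "z * expect \<xi> (\<lambda>j. s ^ j) = s"
  shows "s ^ r - z ^ n \<le> (\<Sum>k\<le>n. forest_prob \<xi> k r * z ^ k)"
    and "(\<Sum>k\<le>n. forest_prob \<xi> k r * z ^ k) \<le> s ^ r"
proof (induction n arbitrary: r)
  case 0
  {
    case 1
    show ?case using s power_le_one[of s r] by (cases "r = 0") (simp_all add: forest_prob_0)
  next
    case 2
    show ?case using s by (cases "r = 0") (simp_all add: forest_prob_0)
  }
next
  case (Suc n)
  have i: "integrable (measure_pmf \<xi>) (\<lambda>j. forest_prob \<xi> k (f j))" for k f
    by (rule integrable_pmf_bounded[OF abs_forest_prob_le_1])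
  have isp: "integrable (measure_pmf \<xi>) (\<lambda>j. s ^ (f j))" for f
    using s by (intro integrable_pmf_bounded[of _ 1]) (auto simp: power_le_one)
  have 0: "(\<Sum>k\<le>Suc n. forest_prob \<xi> k 0 * z ^ k) = 1"
    unfolding sum.atMost_Suc_shift by (simp add: forest_prob_0 forest_prob_Suc_0)
  have step: "(\<Sum>k\<le>Suc n. forest_prob \<xi> k (Suc r) * z ^ k)
      = z * expect \<xi> (\<lambda>j. \<Sum>k\<le>n. forest_prob \<xi> k (r + j) * z ^ k)" for r
  proof -
    have "(\<Sum>k\<le>Suc n. forest_prob \<xi> k (Suc r) * z ^ k) =
       (\<Sum>k\<le>n. expect \<xi> (\<lambda>j. forest_prob \<xi> k (r + j) * z ^ k) * z)"
      unfolding sum.atMost_Suc_shift by (simp add: forest_prob_0 forest_prob_Suc_Suc mult_ac)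
    also have "\<dots> = z * expect \<xi> (\<lambda>j. \<Sum>k\<le>n. forest_prob \<xi> k (r + j) * z ^ k)"
      by (subst Bochner_Integration.integral_sum)
         (auto intro!: i integrable_mult_left simp: sum_distrib_left mult_ac)
    finally show ?thesis .
  qed
  have pow: "z * expect \<xi> (\<lambda>j. s ^ (r + j)) = s ^ Suc r" for r
    using sz by (simp add: power_add mult_ac)
  {
    case 1
    show ?case
    proof (cases r)
      case 0
      thus ?thesis using \<open>(\<Sum>k\<le>Suc n. forest_prob \<xi> k 0 * z ^ k) = 1\<close> z
        by (simp del: sum.atMost_Suc)
    next
      case (Suc r')
      have "s ^ r - z ^ Suc n = z * expect \<xi> (\<lambda>j. s ^ (r' + j) - z ^ n)"
        using pow[of r'] isp by (simp add: Suc right_diff_distrib)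
      also have "\<dots> \<le> z * expect \<xi> (\<lambda>j. \<Sum>k\<le>n. forest_prob \<xi> k (r' + j) * z ^ k)"
        using z by (intro mult_left_mono integral_mono Suc.IH isp i integrable_mult_left
            Bochner_Integration.integrable_sum Bochner_Integration.integrable_diff) auto
      finally show ?thesis using step[of r'] by (simp add: Suc del: sum.atMost_Suc)
    qed
  next
    case 2
    show ?case
    proof (cases r)
      case 0
      thus ?thesis using \<open>(\<Sum>k\<le>Suc n. forest_prob \<xi> k 0 * z ^ k) = 1\<close>
        by (simp del: sum.atMost_Suc)
    next
      case (Suc r')
      have "z * expect \<xi> (\<lambda>j. \<Sum>k\<le>n. forest_prob \<xi> k (r' + j) * z ^ k)
          \<le> z * expect \<xi> (\<lambda>j. s ^ (r' + j))"
        using z by (intro mult_left_mono integral_mono Suc.IH isp i integrable_mult_left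
            Bochner_Integration.integrable_sum) auto
      thus ?thesis using step[of r'] pow[of r'] by (simp add: Suc del: sum.atMost_Suc)
    qed
  }
qed

text \<open>The bounds for a single tree differ by z^n, which vanishes for z < 1. Parametrising by s
  makes it unnecessary to solve s = z E(s^\<xi>) for s.\<close>

lemma tree_gf:
  fixes s z :: real
  assumes s: "0 < s" "s \<le> 1" and z: "0 \<le> z" "z < 1" and sz: "z * expect \<xi> (\<lambda>j. s ^ j) = s"
  shows "(\<lambda>k. tree_prob \<xi> k * z ^ k) sums s"
proof -
  have "(\<lambda>n. \<Sum>k\<le>n. tree_prob \<xi> k * z ^ k) \<longlonglongrightarrow> s"
  proof (rule tendsto_sandwich)
    show "(\<lambda>n. s - z ^ n) \<longlonglongrightarrow> s"
      using z LIMSEQ_realpow_zero[of z] tendsto_diff[OF tendsto_const[of s], of "\<lambda>n. z ^ n" 0] by simp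
  qed (use forest_gf_bounds[OF s z(1) sz, of 1, unfolded forest_prob_1] in auto)
  thus ?thesis by (simp add: sums_def_le)
qed

lemma sum_tree_prob_le_1: "(\<Sum>k\<le>n. tree_prob \<xi> k) \<le> 1"
  using forest_gf_bounds(2)[of 1 1 \<xi> 1 n] by (simp add: forest_prob_1 del: One_nat_def)

section \<open>Critical offspring distributions\<close>

lemma continuous_on_expectation:
  fixes h :: "'a \<Rightarrow> real \<Rightarrow> real"
  assumes cont: "\<And>j. continuous_on S (h j)" and bound: "\<And>j s. s \<in> S \<Longrightarrow> \<bar>h j s\<bar> \<le> g j"
    and g: "integrable (measure_pmf p) g"
  shows "continuous_on S (\<lambda>s. expect p (\<lambda>j. h j s))"
  unfolding continuous_on_sequentially
proof safe
  fix x and a assume a: "a \<in> S" "\<forall>n. x n \<in> S" "x \<longlonglongrightarrow> a"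
  have "(\<lambda>n. expect p (\<lambda>j. h j (x n))) \<longlonglongrightarrow> expect p (\<lambda>j. h j a)"
  proof (rule integral_dominated_convergence[where w = g])
    show "AE j in p. (\<lambda>n. h j (x n)) \<longlonglongrightarrow> h j a"
      using cont a by (auto simp: continuous_on_sequentially comp_def)
  qed (use bound a g in auto)
  thus "((\<lambda>s. expect p (\<lambda>j. h j s)) \<circ> x) \<longlonglongrightarrow> expect p (\<lambda>j. h j a)"
    by (simp add: comp_def)
qed

lemma power_taylor2:
  fixes s :: real
  shows "s ^ j - 1 + real j * (1 - s) = (1 - s)\<^sup>2 * (\<Sum>i<j. \<Sum>l<i. s ^ l)"
proof (induction j)
  case (Suc j)
  have "s ^ Suc j - 1 + real (Suc j) * (1 - s) = (s ^ j - 1 + real j * (1 - s)) + (1 - s) * (1 - s ^ j)"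
    by (simp add: algebra_simps)
  also have "\<dots> = (1 - s)\<^sup>2 * (\<Sum>i<j. \<Sum>l<i. s ^ l) + (1 - s)\<^sup>2 * (\<Sum>l<j. s ^ l)"
    by (simp add: Suc.IH one_diff_power_eq power2_eq_square)
  finally show ?case by (simp add: algebra_simps)
qed simp

locale critical_offspring =
  fixes \<xi> :: "nat pmf"
  assumes integrable_square: "integrable (measure_pmf \<xi>) (\<lambda>j. (real j)\<^sup>2)"
    and mean: "expect \<xi> real = 1"
    and pmf_0_pos: "pmf \<xi> 0 > 0"
begin

lemma integrable_real: "integrable (measure_pmf \<xi>) real"
  by (rule Bochner_Integration.integrable_bound[OF integrable_square])
     (auto intro!: AE_I2 simp: power2_eq_square, metis of_nat_le_iff le_square of_nat_mult)

text \<open>The second factorial moment, which is the variance since the mean is 1.\<close>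

definition \<sigma>2 :: real where
  "\<sigma>2 = expect \<xi> (\<lambda>j. real j * (real j - 1))"

lemma integrable_\<sigma>2: "integrable (measure_pmf \<xi>) (\<lambda>j. real j * (real j - 1))"
proof -
  have "integrable (measure_pmf \<xi>) (\<lambda>j. (real j)\<^sup>2 - real j)"
    by (intro Bochner_Integration.integrable_diff integrable_square integrable_real)
  thus ?thesis by (simp add: power2_eq_square algebra_simps)
qed

text \<open>Otherwise \<xi> would be 0 or 1 and its mean at most 1 - P(\<xi> = 0) < 1. Such a degree
  g is where two branches are grafted later.\<close>

lemma pmf_ge_2: obtains g where "g \<ge> 2" "pmf \<xi> g > 0"
proof (rule ccontr)
  assume "\<not> thesis"
  hence "pmf \<xi> g = 0" if "g \<ge> 2" for g
    using that \<open>(\<And>g. 2 \<le> g \<Longrightarrow> 0 < pmf \<xi> g \<Longrightarrow> thesis)\<close> by (metis pmf_nonneg order_le_less)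
  hence supp: "j < 2" if "j \<in> set_pmf \<xi>" for j
    using that by (meson linorder_not_le set_pmf_iff)
  have "expect \<xi> real \<le> expect \<xi> (\<lambda>j. 1 - indicator {0} j)"
  proof (rule integral_mono_AE[OF integrable_real])
    show "integrable (measure_pmf \<xi>) (\<lambda>j. 1 - indicator {0} j :: real)"
      by (rule integrable_pmf_bounded[of _ 1]) (simp add: indicator_def)
    show "AE j in \<xi>. real j \<le> 1 - indicator {0} j"
      using supp by (auto intro!: AE_pmfI simp: indicator_def less_2_cases_iff)
  qed
  also have "\<dots> = 1 - pmf \<xi> 0"
    by (subst Bochner_Integration.integral_diff)
       (auto simp: measure_pmf_single intro!: integrable_pmf_bounded[of _ 1])
  finally show False using mean pmf_0_pos by simp
qed

definition \<Phi> :: "real \<Rightarrow> real" where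
  "\<Phi> s = expect \<xi> (\<lambda>j. s ^ j)"

text \<open>The quotient (\<Phi>(s) - s) / (1 - s)^2, expanded into nonnegative terms so that it
  makes sense and is continuous up to s = 1, where its value is half the variance.\<close>

definition \<Delta> :: "real \<Rightarrow> real" where
  "\<Delta> s = expect \<xi> (\<lambda>j. \<Sum>i<j. \<Sum>l<i. s ^ l)"

lemma sum_sum_power_le:
  assumes "s \<in> {0..1::real}"
  shows "\<bar>\<Sum>i<j. \<Sum>l<i. s ^ l\<bar> \<le> real j * (real j - 1)"
proof -
  have "\<bar>\<Sum>i<j. \<Sum>l<i. s ^ l\<bar> \<le> (\<Sum>i<j. \<Sum>l<i. \<bar>s ^ l\<bar>)"
    by (rule order_trans[OF sum_abs]) (intro sum_mono sum_abs)
  also have "\<dots> \<le> (\<Sum>i<j. \<Sum>l<i. 1)"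
    using assms by (intro sum_mono) (auto simp: power_le_one)
  also have "\<dots> \<le> (\<Sum>i<j. real j - 1)" by (intro sum_mono) auto
  finally show ?thesis by simp
qed

lemma integrable_\<Delta>:
  assumes "s \<in> {0..1::real}"
  shows "integrable (measure_pmf \<xi>) (\<lambda>j. \<Sum>i<j. \<Sum>l<i. s ^ l)"
  by (rule Bochner_Integration.integrable_bound[OF integrable_\<sigma>2])
     (use sum_sum_power_le[OF assms] in \<open>auto intro!: AE_I2 intro: order_trans[OF _ abs_ge_self]\<close>)

lemma \<Phi>_eq:
  assumes s: "s \<in> {0..1}"
  shows "\<Phi> s - s = (1 - s)\<^sup>2 * \<Delta> s"
proof -
  have i: "integrable (measure_pmf \<xi>) (\<lambda>j. s ^ j)"
    using s by (intro integrable_pmf_bounded[of _ 1]) (auto simp: power_le_one)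
  have "(1 - s)\<^sup>2 * \<Delta> s = expect \<xi> (\<lambda>j. s ^ j - 1 + real j * (1 - s))"
    unfolding \<Delta>_def power_taylor2 by simp
  also have "\<dots> = \<Phi> s - 1 + (1 - s)"
    using i integrable_real mean by (simp add: \<Phi>_def)
  finally show ?thesis by simp
qed

lemma \<Delta>_pos:
  assumes s: "s \<in> {0..1}"
  shows "\<Delta> s > 0"
proof -
  obtain g where g: "g \<ge> 2" "pmf \<xi> g > 0" using pmf_ge_2 .
  have "pmf \<xi> g = expect \<xi> (indicator {g})" by (simp add: measure_pmf_single)
  also have "\<dots> \<le> \<Delta> s" unfolding \<Delta>_def
  proof (rule integral_mono[OF _ integrable_\<Delta>[OF s]])
    fix j
    have nn: "0 \<le> (\<Sum>l<i. s ^ l)" for i using s by (intro sum_nonneg) auto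
    have "1 = (\<Sum>l<1. s ^ l)" by simp
    also have "\<dots> \<le> (\<Sum>i<g. \<Sum>l<i. s ^ l)"
      using g(1) nn by (intro member_le_sum[of 1 _ "\<lambda>i. \<Sum>l<i. s ^ l"]) auto
    finally have "1 \<le> (\<Sum>i<g. \<Sum>l<i. s ^ l)" .
    moreover have "0 \<le> (\<Sum>i<j. \<Sum>l<i. s ^ l)" by (rule sum_nonneg) (rule nn)
    ultimately show "indicator {g} j \<le> (\<Sum>i<j. \<Sum>l<i. s ^ l)"
      by (auto simp: indicator_def)
  qed (rule integrable_pmf_bounded[of _ 1], simp add: indicator_def)
  finally show ?thesis using g by simp
qed

lemma \<Delta>_1: "\<Delta> 1 = \<sigma>2 / 2"
proof -
  have "(\<Sum>i<j. real i) = real j * (real j - 1) / 2" for j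
    by (induction j) (auto simp: field_simps)
  hence "(\<Sum>i<j. \<Sum>l<i. (1::real) ^ l) = real j * (real j - 1) / 2" for j by simp
  hence "\<Delta> 1 = expect \<xi> (\<lambda>j. real j * (real j - 1) / 2)"
    unfolding \<Delta>_def by presburger
  thus ?thesis unfolding \<sigma>2_def by simp
qed

lemma \<sigma>2_pos: "\<sigma>2 > 0"
  using \<Delta>_pos[of 1] by (simp add: \<Delta>_1)

lemma continuous_on_\<Phi>: "continuous_on {0..1} \<Phi>"
  unfolding \<Phi>_def
  by (rule continuous_on_expectation[where g = "\<lambda>_. 1"]) (auto intro!: continuous_intros simp: power_le_one)

lemma continuous_on_\<Delta>: "continuous_on {0..1} \<Delta>"
  unfolding \<Delta>_def
  by (rule continuous_on_expectation[OF _ _ integrable_\<sigma>2]) (use sum_sum_power_le in \<open>auto intro!: continuous_intros\<close>)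

lemma \<Phi>_pos: "s \<in> {0..1} \<Longrightarrow> \<Phi> s > 0"
proof -
  assume s: "s \<in> {0..1}"
  have "\<Phi> s = s + (1 - s)\<^sup>2 * \<Delta> s" using \<Phi>_eq[OF s] by simp
  thus ?thesis using s \<Delta>_pos[OF s] by (cases "s = 1") (auto intro!: add_nonneg_pos)
qed

lemma \<Phi>_1: "\<Phi> 1 = 1"
  by (simp add: \<Phi>_def)

section \<open>Size tail of the unconditioned tree\<close>

definition Z :: "real \<Rightarrow> real" where "Z s = s / \<Phi> s"

lemma one_minus_Z: "s \<in> {0..1} \<Longrightarrow> 1 - Z s = (1 - s)\<^sup>2 * \<Delta> s / \<Phi> s"
  using \<Phi>_eq[of s] \<Phi>_pos[of s] by (simp add: Z_def field_simps)

lemma Z_bounds: "0 < s \<Longrightarrow> s < 1 \<Longrightarrow> 0 < Z s \<and> Z s < 1"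
proof -
  assume s: "0 < s" "s < 1"
  have "1 - Z s > 0" using s \<Delta>_pos[of s] \<Phi>_pos[of s] by (subst one_minus_Z) auto
  moreover have "Z s > 0" using s \<Phi>_pos[of s] by (simp add: Z_def)
  ultimately show ?thesis by simp
qed

definition tail :: "nat \<Rightarrow> real" where
  "tail m = 1 - (\<Sum>k\<le>m. tree_prob \<xi> k)"

lemma tail_nonneg: "tail m \<ge> 0"
  using sum_tree_prob_le_1 by (simp add: tail_def)

lemma decseq_tail: "decseq tail"
  by (rule decseq_SucI) (simp add: tail_def tree_prob_nonneg)

lemma tree_prob_0: "tree_prob \<xi> 0 = 0"
proof -
  have "{t. tsize t = 0} = {}" using tsize_pos by (metis (mono_tags) empty_Collect_eq less_irrefl)
  thus ?thesis by (simp only: tree_prob_def sum.empty)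
qed

lemma tail_0: "tail 0 = 1"
  by (simp add: tail_def tree_prob_0)

lemma tail_le_1: "tail m \<le> 1"
  using decseqD[OF decseq_tail, of 0 m] by (simp add: tail_0)

text \<open>\<open>Z s\<close> is the argument at which the tree generating function takes the value
  s. The identity is summation by parts, as consecutive tails differ by a
  \<open>tree_prob\<close>.\<close>

lemma tail_gf:
  assumes s: "0 < s" "s < 1"
  shows "(1 - Z s) * (\<Sum>m. tail m * Z s ^ m) = 1 - s"
proof -
  let ?z = "Z s"
  have z: "0 < ?z" "?z < 1" using Z_bounds[OF s] by auto
  have "(\<lambda>k. tree_prob \<xi> k * ?z ^ k) sums s"
    by (rule tree_gf) (use s z \<Phi>_pos[of s] in \<open>auto simp: Z_def \<Phi>_def[symmetric]\<close>)
  hence "(\<lambda>k. tree_prob \<xi> (Suc k) * ?z ^ Suc k) sums s"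
    by (subst sums_Suc_iff) (simp add: tree_prob_0)
  moreover have sm: "summable (\<lambda>m. tail m * ?z ^ m)"
    using z tail_nonneg tail_le_1 by (intro summable_bounded_power[of _ 1]) auto
  have tz: "(\<lambda>m. tail m * ?z ^ m) sums (\<Sum>m. tail m * ?z ^ m)" using sm by (rule summable_sums)
  hence "(\<lambda>m. tail (Suc m) * ?z ^ Suc m) sums ((\<Sum>m. tail m * ?z ^ m) - 1)"
    by (subst sums_Suc_iff) (simp add: tail_0)
  ultimately have "(\<lambda>m. tail (Suc m) * ?z ^ Suc m + tree_prob \<xi> (Suc m) * ?z ^ Suc m) sums ((\<Sum>m. tail m * ?z ^ m) - 1 + s)"
    by (rule sums_add[rotated])
  moreover have "tail (Suc m) * ?z ^ Suc m + tree_prob \<xi> (Suc m) * ?z ^ Suc m = ?z * (tail m * ?z ^ m)" for m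
    by (simp add: tail_def algebra_simps)
  ultimately have "(\<lambda>m. ?z * (tail m * ?z ^ m)) sums ((\<Sum>m. tail m * ?z ^ m) - 1 + s)"
    by simp
  with sums_mult[OF tz, of ?z] have "?z * (\<Sum>m. tail m * ?z ^ m) = (\<Sum>m. tail m * ?z ^ m) - 1 + s"
    using sums_unique2 by blast
  thus ?thesis by (simp add: algebra_simps)
qed

text \<open>Since 1 - Z s is quadratic in 1 - s, division of the previous identity by sqrt(1 - Z s)
  leaves a quantity that is continuous at s = 1.\<close>

lemma sqrt_tail_gf:
  assumes s: "0 < s" "s < 1"
  shows "sqrt (1 - Z s) * (\<Sum>m. tail m * Z s ^ m) = sqrt (\<Phi> s / \<Delta> s)"
proof -
  have p: "\<Phi> s > 0" "\<Delta> s > 0" using s \<Phi>_pos \<Delta>_pos by auto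
  have pos: "1 - Z s > 0" using Z_bounds[OF s] by simp
  have "sqrt (1 - Z s) * (sqrt (1 - Z s) * (\<Sum>m. tail m * Z s ^ m)) = 1 - s"
    using tail_gf[OF s] pos by (simp add: mult.assoc[symmetric])
  moreover have "sqrt (1 - Z s) * sqrt (\<Phi> s / \<Delta> s) = 1 - s"
  proof -
    have "(1 - Z s) * (\<Phi> s / \<Delta> s) = (1 - s)\<^sup>2" using s p by (simp add: one_minus_Z)
    hence "sqrt ((1 - Z s) * (\<Phi> s / \<Delta> s)) = 1 - s" using s by simp
    thus ?thesis by (simp only: real_sqrt_mult)
  qed
  ultimately show ?thesis using pos
    by (metis mult_cancel_left real_sqrt_eq_zero_cancel_iff less_irrefl)
qed

text \<open>Z is continuous with Z 1 = 1, so by the intermediate value theorem every z close to 1 is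
  Z s for some s close to 1, and the limit can be taken in s.\<close>

lemma tail_Abel:
  "((\<lambda>z. sqrt (1 - z) * (\<Sum>m. tail m * z ^ m)) \<longlongrightarrow> sqrt (2 / \<sigma>2)) (at_left 1)"
proof (rule tendstoI)
  fix e :: real assume e: "e > 0"
  have "continuous_on {0..1} (\<lambda>s. sqrt (\<Phi> s / \<Delta> s))"
    using \<Delta>_pos by (intro continuous_intros continuous_on_\<Phi> continuous_on_\<Delta>) force
  hence "((\<lambda>s. sqrt (\<Phi> s / \<Delta> s)) \<longlongrightarrow> sqrt (\<Phi> 1 / \<Delta> 1)) (at 1 within {0..1})"
    by (auto simp: continuous_on)
  hence "((\<lambda>s. sqrt (\<Phi> s / \<Delta> s)) \<longlongrightarrow> sqrt (2 / \<sigma>2)) (at_left 1)"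
    by (simp add: at_within_Icc_at_left \<Phi>_1 \<Delta>_1)
  from tendstoD[OF this e] obtain b where b: "b < 1" "\<And>s. b < s \<Longrightarrow> s < 1 \<Longrightarrow> dist (sqrt (\<Phi> s / \<Delta> s)) (sqrt (2 / \<sigma>2)) < e"
    unfolding eventually_at_left_field by blast
  define s0 where "s0 = max b (1/2)"
  have s0: "s0 < 1" "0 < s0" "b \<le> s0" using b(1) by (auto simp: s0_def)
  have "\<forall>\<^sub>F z in at_left 1. z \<in> {Z s0<..<1}"
    by (rule eventually_at_left_real) (use Z_bounds[of s0] s0 in auto)
  thus "\<forall>\<^sub>F z in at_left 1. dist (sqrt (1 - z) * (\<Sum>m. tail m * z ^ m)) (sqrt (2 / \<sigma>2)) < e"
  proof eventually_elim
    case (elim z)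
    have "\<forall>s\<in>{s0..1}. \<Phi> s \<noteq> 0"
    proof
      fix s assume "s \<in> {s0..1}"
      hence "\<Phi> s > 0" using s0 by (intro \<Phi>_pos) auto
      thus "\<Phi> s \<noteq> 0" by simp
    qed
    hence "continuous_on {s0..1} Z" unfolding Z_def
      by (intro continuous_intros continuous_on_subset[OF continuous_on_\<Phi>]) (use s0 in auto)
    hence "\<exists>s\<ge>s0. s \<le> 1 \<and> Z s = z"
      using elim s0 by (intro IVT') (auto simp: Z_def \<Phi>_1)
    then obtain s where s: "s0 \<le> s" "s \<le> 1" "Z s = z" by blast
    have "s \<noteq> 1" "s \<noteq> s0" using s(3) elim by (auto simp: Z_def \<Phi>_1)
    hence "b < s" "s < 1" "0 < s" using s s0 by auto
    thus ?case using b(2)[of s] sqrt_tail_gf[of s] by (simp add: s(3))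
  qed
qed

theorem tail_asymptotics: "(\<lambda>m. sqrt (real m) * tail m) \<longlonglongrightarrow> sqrt (2 / (pi * \<sigma>2))"
proof -
  have "(\<lambda>m. sqrt (real m) * tail m) \<longlonglongrightarrow> sqrt (2 / \<sigma>2) / sqrt pi"
    by (rule Karamata_half[OF decseq_tail tail_nonneg _ tail_Abel]) (use \<sigma>2_pos in auto)
  thus ?thesis by (simp add: real_sqrt_divide real_sqrt_mult mult_ac)
qed

lemma tail_diff: "a \<le> b \<Longrightarrow> tail a - tail b = (\<Sum>k\<in>{a<..b}. tree_prob \<xi> k)"
proof -
  assume "a \<le> b"
  hence "{..b} = {..a} \<union> {a<..b}" by auto
  hence "(\<Sum>k\<le>b. tree_prob \<xi> k) = (\<Sum>k\<le>a. tree_prob \<xi> k) + (\<Sum>k\<in>{a<..b}. tree_prob \<xi> k)"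
    by (simp add: sum.union_disjoint ivl_disj_int)
  thus ?thesis by (simp add: tail_def)
qed

end

section \<open>A lower bound for the probability of a given size\<close>

context critical_offspring
begin

lemma tree_prob_1: "tree_prob \<xi> 1 = pmf \<xi> 0"
proof -
  have "tree_prob \<xi> 1 = expect \<xi> (\<lambda>j. of_bool (j = 0))"
    unfolding forest_prob_1[symmetric] One_nat_def forest_prob_Suc_Suc by (simp add: forest_prob_0)
  thus ?thesis using expectation_of_bool_eq_mult[of \<xi> 0 "\<lambda>_. 1"] by simp
qed

lemma forest_prob_ge_pmf_0_power: "forest_prob \<xi> n n \<ge> pmf \<xi> 0 ^ n"
proof (induction n)
  case (Suc n)
  have "pmf \<xi> 0 ^ Suc n \<le> forest_prob \<xi> 1 1 * forest_prob \<xi> n n"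
    using Suc tree_prob_1 by (simp add: forest_prob_1 mult_left_mono del: One_nat_def)
  also have "\<dots> \<le> forest_prob \<xi> (Suc n) (Suc n)"
    using forest_prob_superadditive[of \<xi> 1 1 n n] by simp
  finally show ?case .
qed (simp add: forest_prob_0)

lemma tree_prob_Suc_ge: "tree_prob \<xi> (Suc a) \<ge> pmf \<xi> g * forest_prob \<xi> a g"
proof -
  have "pmf \<xi> g * forest_prob \<xi> a g = expect \<xi> (\<lambda>j. of_bool (j = g) * forest_prob \<xi> a j)"
    by (rule expectation_of_bool_eq_mult[symmetric])
  also have "\<dots> \<le> expect \<xi> (\<lambda>j. forest_prob \<xi> a j)"
    by (intro integral_mono integrable_pmf_bounded[of _ 1]) (auto simp: forest_prob_nonneg forest_prob_le_1)
  also have "\<dots> = tree_prob \<xi> (Suc a)"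
    unfolding forest_prob_1[symmetric] One_nat_def forest_prob_Suc_Suc by simp
  finally show ?thesis .
qed

text \<open>A root of degree \<open>g\<close> carrying two given branches and \<open>g - 2\<close> leaves.\<close>

lemma tree_prob_graft:
  assumes g: "g \<ge> 2" "pmf \<xi> g > 0"
  obtains c where "0 < c" "\<And>x y. tree_prob \<xi> (Suc (x + y + g)) \<ge> c * tree_prob \<xi> (Suc x) * tree_prob \<xi> (Suc y)"
proof (rule that)
  show "pmf \<xi> g * pmf \<xi> 0 ^ (g - 2) > 0" using g pmf_0_pos by simp
  fix x y
  have "tree_prob \<xi> (Suc x) * tree_prob \<xi> (Suc y) * pmf \<xi> 0 ^ (g - 2)
      \<le> forest_prob \<xi> (Suc x) 1 * forest_prob \<xi> (Suc y) 1 * forest_prob \<xi> (g - 2) (g - 2)"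
    unfolding forest_prob_1 by (intro mult_mono forest_prob_ge_pmf_0_power) (auto simp: tree_prob_nonneg)
  also have "\<dots> \<le> forest_prob \<xi> (Suc x + Suc y) (1 + 1) * forest_prob \<xi> (g - 2) (g - 2)"
    by (intro mult_right_mono forest_prob_superadditive forest_prob_nonneg)
  also have "\<dots> \<le> forest_prob \<xi> (Suc x + Suc y + (g - 2)) (1 + 1 + (g - 2))"
    by (rule forest_prob_superadditive)
  also have "Suc x + Suc y + (g - 2) = x + y + g" using g by simp
  also have "1 + 1 + (g - 2) = g" using g by simp
  finally have "pmf \<xi> g * (tree_prob \<xi> (Suc x) * tree_prob \<xi> (Suc y) * pmf \<xi> 0 ^ (g - 2))
      \<le> pmf \<xi> g * forest_prob \<xi> (x + y + g) g" using g by simp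
  also have "\<dots> \<le> tree_prob \<xi> (Suc (x + y + g))" by (rule tree_prob_Suc_ge)
  finally show "tree_prob \<xi> (Suc (x + y + g)) \<ge> pmf \<xi> g * pmf \<xi> 0 ^ (g - 2) * tree_prob \<xi> (Suc x) * tree_prob \<xi> (Suc y)"
    by (simp add: mult_ac)
qed

text \<open>By the tail asymptotics the sizes in (m, 16 m] carry mass of order m^(-1/2), so not all
  of the 15 m sizes in the window can be very unlikely. The pigeonhole argument would even give
  m^(-3/2); the weaker exponent 2 is an integer.\<close>

lemma tree_prob_window:
  obtains c m0 where "c > 0" "m0 > 0" "\<And>m. m \<ge> m0 \<Longrightarrow> \<exists>k. m < k \<and> k \<le> 16 * m \<and> tree_prob \<xi> k \<ge> c / real m ^ 2"
proof -
  define \<kappa> where "\<kappa> = sqrt (2 / (pi * \<sigma>2))"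
  have \<kappa>: "\<kappa> > 0" using \<sigma>2_pos by (simp add: \<kappa>_def)
  have "\<forall>\<^sub>F m in sequentially. 3/4 * \<kappa> < sqrt (real m) * tail m"
    using tail_asymptotics \<kappa> unfolding \<kappa>_def[symmetric] by (intro order_tendstoD(1)) auto
  moreover have "\<forall>\<^sub>F m in sequentially. sqrt (real m) * tail m < 5/4 * \<kappa>"
    using tail_asymptotics \<kappa> unfolding \<kappa>_def[symmetric] by (intro order_tendstoD(2)) auto
  ultimately have "\<forall>\<^sub>F m in sequentially. 3/4 * \<kappa> < sqrt (real m) * tail m \<and> sqrt (real m) * tail m < 5/4 * \<kappa>"
    by eventually_elim auto
  then obtain m0 where m0: "\<And>m. m \<ge> m0 \<Longrightarrow> 3/4 * \<kappa> < sqrt (real m) * tail m \<and> sqrt (real m) * tail m < 5/4 * \<kappa>"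
    unfolding eventually_sequentially by blast
  show ?thesis
  \<comment> \<open>The tails at m and 16 m differ asymptotically by the factor sqrt 16 = 4. If
    every size in the window failed, sqrt m times \<open>tail m\<close> would be at most 5/16
    \<kappa> + 15/48 \<kappa> = 5/8 \<kappa>, below its lower bound 3/4 \<kappa>.\<close>
  proof (rule that[of "\<kappa> / 48" "Suc m0"])
    fix m assume m: "m \<ge> Suc m0"
    have mp: "real m > 0" "sqrt (real m) > 0" using m by auto
    show "\<exists>k. m < k \<and> k \<le> 16 * m \<and> tree_prob \<xi> k \<ge> \<kappa> / 48 / real m ^ 2"
    proof (rule ccontr)
      assume "\<not> ?thesis"
      hence *: "tree_prob \<xi> k \<le> \<kappa> / 48 / real m ^ 2" if "k \<in> {m<..16 * m}" for k
        using that by force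
      have "tail m - tail (16 * m) = (\<Sum>k\<in>{m<..16 * m}. tree_prob \<xi> k)"
        by (rule tail_diff) simp
      also have "\<dots> \<le> (\<Sum>k\<in>{m<..16 * m}. \<kappa> / 48 / real m ^ 2)" by (intro sum_mono *)
      also have "\<dots> = real (16 * m - m) * (\<kappa> / 48 / real m ^ 2)" by simp
      also have "\<dots> = 15 * \<kappa> / 48 / real m" using mp by (simp add: power2_eq_square)
      finally have "sqrt m * (tail m - tail (16 * m)) \<le> sqrt m * (15 * \<kappa> / 48 / real m)"
        by (rule mult_left_mono) simp
      hence "sqrt m * tail m - sqrt m * tail (16 * m) \<le> sqrt m * (15 * \<kappa> / 48 / real m)"
        by (simp only: right_diff_distrib)
      also have "\<dots> = (15 * \<kappa> / 48) / sqrt m" using mp by (simp add: real_div_sqrt field_simps)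
      also have "\<dots> \<le> (15 * \<kappa> / 48) / 1" using \<kappa> m by (intro divide_left_mono) auto
      finally have "sqrt m * tail m \<le> sqrt m * tail (16 * m) + 15 * \<kappa> / 48" by simp
      moreover have "sqrt (real (16 * m)) = 4 * sqrt m" by (simp add: real_sqrt_mult)
      moreover have "sqrt (real (16 * m)) * tail (16 * m) < 5/4 * \<kappa>" using m0[of "16 * m"] m by simp
      moreover have "3/4 * \<kappa> < sqrt (real m) * tail m" using m0[of m] m by simp
      ultimately show False using \<kappa> by simp
    qed
  qed (use \<kappa> in auto)
qed

text \<open>The numbers x for which x + 1 is a possible size contain 0 and are closed under adding
  two of them and g, so in each residue class modulo g that they meet they contain everything from
  the least element on. This settles periodicity: what remains after splitting off a branch of
  possible size is possible again as soon as it is large.\<close>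

lemma tree_prob_support_diff:
  assumes g: "g \<ge> 2" "pmf \<xi> g > 0"
  obtains X0 where "\<And>x x1. tree_prob \<xi> (Suc x) > 0 \<Longrightarrow> tree_prob \<xi> (Suc x1) > 0 \<Longrightarrow> x1 + X0 \<le> x \<Longrightarrow>
      x1 + g \<le> x \<and> tree_prob \<xi> (Suc (x - x1 - g)) > 0"
proof -
  define D where "D = {x. tree_prob \<xi> (Suc x) > 0}"
  obtain c where c: "0 < c" "\<And>x y. tree_prob \<xi> (Suc (x + y + g)) \<ge> c * tree_prob \<xi> (Suc x) * tree_prob \<xi> (Suc y)"
    using tree_prob_graft[OF g] by blast
  have D_add: "x + y + g \<in> D" if "x \<in> D" "y \<in> D" for x y
  proof -
    have "c * tree_prob \<xi> (Suc x) * tree_prob \<xi> (Suc y) > 0" using that c(1) by (simp add: D_def)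
    thus ?thesis using c(2)[of x y] by (simp add: D_def)
  qed
  have D_0: "0 \<in> D" using tree_prob_1 pmf_0_pos by (simp add: D_def)
  have D_g: "x + j * g \<in> D" if "x \<in> D" for x j
  proof (induction j)
    case (Suc j)
    show ?case using D_add[OF Suc D_0] by (simp add: add_ac)
  qed (use that in simp)
  have D_mult: "\<exists>j. k * x + j * g \<in> D" if "x \<in> D" for k x
  proof (induction k)
    case 0
    show ?case using D_0 by (intro exI[of _ 0]) simp
  next
    case (Suc k)
    then obtain j where "k * x + j * g \<in> D" by blast
    from D_add[OF this that] show ?case by (intro exI[of _ "Suc j"]) (simp add: add_ac)
  qed
  define L where "L r = (LEAST d. d \<in> D \<and> d mod g = r)" for r
  have L: "y \<in> D" if "d \<in> D" "d mod g = y mod g" "y \<ge> L (y mod g)" for y d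
  proof -
    have *: "L (y mod g) \<in> D \<and> L (y mod g) mod g = y mod g"
      unfolding L_def by (rule LeastI[of _ d]) (use that in auto)
    hence "g dvd y - L (y mod g)" using that(3) by (metis mod_eq_dvd_iff_nat)
    then obtain j where "y - L (y mod g) = j * g" by (auto simp: dvd_def mult.commute)
    hence "y = L (y mod g) + j * g" using that(3) by simp
    thus ?thesis using D_g[of "L (y mod g)" j] * by metis
  qed
  define X0 where "X0 = g + (\<Sum>r<g. L r)"
  show ?thesis
  proof (rule that[of X0])
    fix x x1 assume "tree_prob \<xi> (Suc x) > 0" "tree_prob \<xi> (Suc x1) > 0" and le: "x1 + X0 \<le> x"
    hence D: "x \<in> D" "x1 \<in> D" by (auto simp: D_def)
    have le': "x1 + g \<le> x" using le by (simp add: X0_def)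
    define y where "y = x - x1 - g"
    have "y mod g < g" using g by simp
    hence "L (y mod g) \<le> (\<Sum>r<g. L r)" by (intro member_le_sum) auto
    hence "L (y mod g) \<le> y" using le by (simp add: y_def X0_def)
    moreover obtain j where j: "(g - 1) * x1 + j * g \<in> D" using D_mult[OF D(2)] by blast
    \<comment> \<open>A possible value in the residue class of y: modulo g, adding (g - 1) x1
      amounts to subtracting x1.\<close>
    define e where "e = x + ((g - 1) * x1 + j * g) + g"
    have "e \<in> D" unfolding e_def by (rule D_add[OF D(1) j])
    moreover have "x = y + x1 + g" using le' by (simp add: y_def)
    moreover have "g * x1 = (g - 1) * x1 + x1" using g by (cases g) auto
    ultimately have "e = y + (g * x1) + j * g + g + g" unfolding e_def by linarith
    hence "e = y + (x1 + j + 2) * g" by (simp add: algebra_simps)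
    hence "e mod g = y mod g" by (simp only: mod_mult_self1)
    from L[OF \<open>e \<in> D\<close> this \<open>L (y mod g) \<le> y\<close>] show "x1 + g \<le> x \<and> tree_prob \<xi> (Suc (x - x1 - g)) > 0"
      using le' by (simp add: y_def D_def)
  qed
qed

text \<open>Strong induction: a root of degree g receives one branch with size in a window of
  \<open>tree_prob_window\<close>, which costs a factor polynomial in x, and one of size y + 1 with
  sqrt y <= 0.999 sqrt x. The saving exp(-sqrt x / 1000) in the induction hypothesis pays for the
  polynomial.\<close>

theorem tree_prob_lower_bound:
  obtains c0 where "c0 > 0" "\<And>n. tree_prob \<xi> n > 0 \<Longrightarrow> tree_prob \<xi> n \<ge> c0 * exp (- sqrt (real n))"
proof -
  obtain g where g: "g \<ge> 2" "pmf \<xi> g > 0" using pmf_ge_2 .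
  obtain c where c: "0 < c" "\<And>x y. tree_prob \<xi> (Suc (x + y + g)) \<ge> c * tree_prob \<xi> (Suc x) * tree_prob \<xi> (Suc y)"
    using tree_prob_graft[OF g] by blast
  obtain c2 m0 where c2: "c2 > 0" "m0 > 0"
    "\<And>m. m \<ge> m0 \<Longrightarrow> \<exists>k. m < k \<and> k \<le> 16 * m \<and> tree_prob \<xi> k \<ge> c2 / real m ^ 2"
    using tree_prob_window by blast
  obtain X0 where X0: "\<And>x x1. tree_prob \<xi> (Suc x) > 0 \<Longrightarrow> tree_prob \<xi> (Suc x1) > 0 \<Longrightarrow> x1 + X0 \<le> x \<Longrightarrow>
      x1 + g \<le> x \<and> tree_prob \<xi> (Suc (x - x1 - g)) > 0"
    using tree_prob_support_diff[OF g] by blast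
  have "((\<lambda>x::real. x ^ 2 * exp (- (sqrt x / 1000))) \<longlongrightarrow> 0) at_top" by real_asymp
  from order_tendstoD(2)[OF filterlim_compose[OF this filterlim_real_sequentially], of "c * c2"]
  have "\<forall>\<^sub>F x in sequentially. real x ^ 2 * exp (- (sqrt (real x) / 1000)) < c * c2"
    using c c2 by simp
  then obtain X1 where X1: "\<And>x. x \<ge> X1 \<Longrightarrow> real x ^ 2 * exp (- (sqrt (real x) / 1000)) < c * c2"
    unfolding eventually_sequentially by blast
  \<comment> \<open>The threshold from which all estimates of the induction step hold; below it the
    finitely many positive values are absorbed into \<open>c0\<close>.\<close>
  define X where "X = X1 + 2 * X0 + 64 * m0 + 128"
  define S where "S = insert 1 {tree_prob \<xi> (Suc x) | x. x < X \<and> tree_prob \<xi> (Suc x) > 0}"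
  have fin: "finite S" by (simp add: S_def)
  define c0 where "c0 = Min S"
  have "c0 \<in> S" unfolding c0_def using fin by (intro Min_in) (auto simp: S_def)
  hence c0: "c0 > 0" by (auto simp: S_def)
  have main: "tree_prob \<xi> (Suc x) \<ge> c0 * exp (- sqrt (real x))" if "tree_prob \<xi> (Suc x) > 0" for x
    using that
  proof (induction x rule: less_induct)
    case (less x)
    show ?case
    proof (cases "x < X")
      case True
      hence "c0 \<le> tree_prob \<xi> (Suc x)" unfolding c0_def using fin less.prems
        by (intro Min_le) (auto simp: S_def)
      moreover have "c0 * exp (- sqrt (real x)) \<le> c0 * 1" using c0 by (intro mult_left_mono) auto
      ultimately show ?thesis by simp
    next
      case False
      \<comment> \<open>The branch that is split off then has more than m >= x / 128 and at most 16
        m <= x / 4 vertices: enough to shrink the rest by the factor 127/128, and few enough to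
        leave room for \<open>X0\<close>.\<close>
      define m where "m = x div 64"
      have xm: "64 * m \<le> x" "x < 64 * m + 64" unfolding m_def by auto
      have "m \<ge> m0" using False by (simp add: m_def X_def)
      then obtain k where k: "m < k" "k \<le> 16 * m" "tree_prob \<xi> k \<ge> c2 / real m ^ 2"
        using c2(3) by blast
      define x1 where "x1 = k - 1"
      have k': "k = Suc x1" using k by (simp add: x1_def)
      have m: "m > 0" using \<open>m \<ge> m0\<close> c2 by simp
      have "c2 / real m ^ 2 > 0" using c2 m by simp
      hence t1: "tree_prob \<xi> (Suc x1) > 0" using k(3) unfolding k' by linarith
      have "x1 + X0 \<le> x" using k(2) xm False by (simp add: k' X_def)
      from X0[OF less.prems t1 this] have y: "x1 + g \<le> x" "tree_prob \<xi> (Suc (x - x1 - g)) > 0" by auto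
      define y where "y = x - x1 - g"
      have xy: "x = x1 + y + g" using y by (simp add: y_def)
      have "y < x" using xy g by simp
      have "128 * y \<le> 127 * x"
      proof -
        have "y \<le> x - m" using k by (simp add: y_def k')
        moreover have "128 * m \<ge> x" using xm False by (simp add: X_def)
        ultimately show ?thesis by linarith
      qed
      hence "real y \<le> (999 / 1000)\<^sup>2 * real x" by (simp add: power2_eq_square)
      hence "sqrt (real y) \<le> sqrt ((999 / 1000)\<^sup>2 * real x)" by simp
      hence y': "sqrt (real y) \<le> 999 / 1000 * sqrt (real x)" by (simp add: real_sqrt_mult)
      have "c0 * exp (- sqrt (real x)) \<le> c0 * (c * c2 / real x ^ 2 * exp (- (999 / 1000 * sqrt (real x))))"
      proof -
        have "x > 0" using False by (simp add: X_def)
        have "real x ^ 2 * exp (- (sqrt (real x) / 1000)) \<le> c * c2"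
          using X1[of x] False by (simp add: X_def)
        hence "exp (- sqrt (real x)) \<le> c * c2 / real x ^ 2 * exp (- (999 / 1000 * sqrt (real x)))"
        proof -
          have "exp (- sqrt (real x)) = exp (- (sqrt (real x) / 1000)) * exp (- (999 / 1000 * sqrt (real x)))"
            by (simp flip: exp_add)
          also have "\<dots> \<le> c * c2 / real x ^ 2 * exp (- (999 / 1000 * sqrt (real x)))"
            using \<open>x > 0\<close> \<open>real x ^ 2 * exp (- (sqrt (real x) / 1000)) \<le> c * c2\<close>
            by (intro mult_right_mono) (simp_all add: field_simps)
          finally show ?thesis .
        qed
        thus ?thesis using c0 by (intro mult_left_mono) auto
      qed
      also have "\<dots> \<le> c0 * (c * c2 / real m ^ 2 * exp (- sqrt (real y)))"
        using c0 c c2 m y' xm(1) by (intro mult_left_mono mult_mono divide_left_mono power_mono) auto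
      also have "\<dots> = c * (c2 / real m ^ 2) * (c0 * exp (- sqrt (real y)))" by simp
      also have "\<dots> \<le> c * tree_prob \<xi> (Suc x1) * tree_prob \<xi> (Suc y)"
        using c c0 c2(1) k(3) less.IH[OF \<open>y < x\<close>] y(2) unfolding y_def k'
        by (intro mult_mono) (auto simp: tree_prob_nonneg)
      also have "\<dots> \<le> tree_prob \<xi> (Suc x)" unfolding xy by (rule c(2))
      finally show ?thesis .
    qed
  qed
  show ?thesis
  proof (rule that[OF c0])
    fix n assume n: "tree_prob \<xi> n > 0"
    then obtain x where x: "n = Suc x" using tree_prob_0 by (cases n) auto
    have "c0 * exp (- sqrt (real n)) \<le> c0 * exp (- sqrt (real x))" using c0 by (simp add: x)
    also have "\<dots> \<le> tree_prob \<xi> n" using main n by (simp add: x)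
    finally show "tree_prob \<xi> n \<ge> c0 * exp (- sqrt (real n))" .
  qed
qed

end

section \<open>Counting shapes in a word\<close>

lemma distinct_fringe_le_tsize: "distinct_fringe t \<le> tsize t"
  unfolding distinct_fringe_def set_subs[symmetric] length_subs[symmetric]
  by (metis card_image_le card_length finite_set le_trans)

lemma finite_unordered: "finite {u. size (uoutdegs u) = k \<and> set_mset (uoutdegs u) \<subseteq> M}"
proof (rule finite_subset)
  show "{u. size (uoutdegs u) = k \<and> set_mset (uoutdegs u) \<subseteq> M} \<subseteq> shape ` {t. tsize t = k}"
  proof
    fix u assume u: "u \<in> {u. size (uoutdegs u) = k \<and> set_mset (uoutdegs u) \<subseteq> M}"
    obtain t where "shape t = u" using surj_shape by blast
    thus "u \<in> shape ` {t. tsize t = k}" using u tsize_shape[of t] by auto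
  qed
qed (simp add: finite_tsize_eq)

lemma set_outdegs_subs: "s \<in> set (subs t) \<Longrightarrow> set (outdegs s) \<subseteq> set (outdegs t)"
proof -
  assume "s \<in> set (subs t)"
  then obtain i where "i < tsize t" "s = subs t ! i" by (auto simp: in_set_conv_nth length_subs)
  with prefix_subs[of i t] show ?thesis
    by (auto dest!: set_mono_prefix in_set_dropD simp: subset_iff)
qed

lemma tree_functional_subs:
  assumes "i < tsize t"
  shows "tree_functional m G (drop i (outdegs t)) = (if tsize (subs t ! i) \<le> m then G (subs t ! i) else 0)"
proof (cases "tsize (subs t ! i) \<le> m")
  case True
  thus ?thesis using tree_functional_eq[OF prefix_subs[OF assms]] by simp
next
  case False
  thus ?thesis using prefix_outdegs_unique[OF prefix_subs[OF assms]]
    by (auto intro!: tree_functional_eq_0)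
qed

text \<open>Vertices with a small fringe subtree contribute at most all shapes in that range of
  sizes, the others are counted individually. The window sum is the number of the former, so n minus
  it is the number of the latter.\<close>

lemma distinct_fringe_upper:
  assumes t: "tsize t = n" and M: "set (outdegs t) \<subseteq> M"
  shows "real (distinct_fringe t) \<le>
     (\<Sum>k\<le>m. real (unordered_count M k)) + n - (\<Sum>i<n. tree_functional m (\<lambda>_. 1) (drop i (outdegs t)))"
proof -
  define A where "A = {i. i < n \<and> tsize (subs t ! i) \<le> m}"
  define B where "B = {i. i < n \<and> \<not> tsize (subs t ! i) \<le> m}"
  have fin: "finite A" "finite B" by (auto simp: A_def B_def)
  have AB: "{..<n} = A \<union> B" "A \<inter> B = {}" by (auto simp: A_def B_def)
  have "shape ` fringe_subtrees t = (\<lambda>i. shape (subs t ! i)) ` {..<n}"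
    unfolding set_subs[symmetric] set_conv_nth length_subs t by auto
  hence "distinct_fringe t \<le> card ((\<lambda>i. shape (subs t ! i)) ` A) + card ((\<lambda>i. shape (subs t ! i)) ` B)"
    unfolding distinct_fringe_def by (simp add: AB(1) image_Un card_Un_le)
  also have "card ((\<lambda>i. shape (subs t ! i)) ` A) \<le> card (\<Union>k\<le>m. {u. size (uoutdegs u) = k \<and> set_mset (uoutdegs u) \<subseteq> M})"
  proof (rule card_mono)
    show "(\<lambda>i. shape (subs t ! i)) ` A \<subseteq> (\<Union>k\<le>m. {u. size (uoutdegs u) = k \<and> set_mset (uoutdegs u) \<subseteq> M})"
    proof safe
      fix i assume i: "i \<in> A"
      hence "subs t ! i \<in> set (subs t)" by (simp add: A_def length_subs t)
      hence "set (outdegs (subs t ! i)) \<subseteq> M" using set_outdegs_subs M by blast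
      thus "shape (subs t ! i) \<in> (\<Union>k\<le>m. {u. size (uoutdegs u) = k \<and> set_mset (uoutdegs u) \<subseteq> M})"
        using i by (auto simp: A_def tsize_shape) (auto simp: uoutdegs_shape)
    qed
  qed (simp add: finite_unordered)
  also have "\<dots> \<le> (\<Sum>k\<le>m. unordered_count M k)"
    unfolding unordered_count_def by (rule card_UN_le) simp
  also have "card ((\<lambda>i. shape (subs t ! i)) ` B) \<le> card B" by (rule card_image_le[OF fin(2)])
  finally have "real (distinct_fringe t) \<le> (\<Sum>k\<le>m. real (unordered_count M k)) + real (card B)"
    by (simp flip: of_nat_sum of_nat_add)
  moreover have "(\<Sum>i<n. tree_functional m (\<lambda>_. 1) (drop i (outdegs t))) = (\<Sum>i<n. if i \<in> A then 1 else 0)"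
    by (intro sum.cong) (auto simp: tree_functional_subs t A_def)
  moreover have "\<dots> = real (card A)" using fin by (simp add: AB(1) sum.If_cases Int_absorb1 flip: AB(1))
       (simp add: AB(1) Int_Un_distrib2 AB(2) Int_commute)
  moreover have "n = card A + card B"
    using card_Un_disjoint[OF fin AB(2)] by (simp flip: AB(1))
  ultimately show ?thesis by simp
qed

text \<open>The count of fringe shapes extended to arbitrary words, since McDiarmid's inequality
  refers to all of them. Restriction to a set G of trees of bounded size will keep the influence of
  a letter small.\<close>

definition shapes_at :: "ptree set \<Rightarrow> nat \<Rightarrow> nat list \<Rightarrow> utree set" where
  "shapes_at G n xs = {shape s | s i. s \<in> G \<and> i < n \<and> prefix (outdegs s) (drop i xs)}"

lemma shapes_at_subset: "shapes_at G n xs \<subseteq> shape ` G"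
  by (auto simp: shapes_at_def)

lemma finite_shapes_at: "finite G \<Longrightarrow> finite (shapes_at G n xs)"
  by (rule finite_subset[OF shapes_at_subset]) simp

lemma card_shapes_at_le_distinct_fringe:
  assumes "tsize t = n"
  shows "card (shapes_at G n (outdegs t)) \<le> distinct_fringe t"
  unfolding distinct_fringe_def set_subs[symmetric]
proof (rule card_mono)
  show "shapes_at G n (outdegs t) \<subseteq> shape ` set (subs t)"
  proof (clarsimp simp: shapes_at_def)
    fix s i assume "i < n" "prefix (outdegs s) (drop i (outdegs t))"
    hence "s = subs t ! i" using prefix_outdegs_unique prefix_subs[of i t] assms by blast
    thus "shape s \<in> shape ` set (subs t)" using \<open>i < n\<close> assms by (auto simp: length_subs)
  qed
qed simp

text \<open>Only the at most N windows that contain position j can create new shapes, and each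
  window starts with at most one tree.\<close>

lemma card_shapes_at_local:
  assumes G: "G \<subseteq> {t. tsize t \<le> N}"
    and eq: "\<And>i. i \<notin> {Suc j - N..j} \<Longrightarrow> take N (drop i xs') = take N (drop i xs)"
  shows "card (shapes_at G n xs') \<le> card (shapes_at G n xs) + N"
proof -
  have finG: "finite G" by (rule finite_subset[OF G]) (rule finite_tsize_le)
  define W where "W = (\<Union>i\<in>{Suc j - N..j}. {shape s | s. prefix (outdegs s) (drop i xs')})"
  have single: "finite {shape s | s. prefix (outdegs s) (drop i xs')} \<and> card {shape s | s. prefix (outdegs s) (drop i xs')} \<le> 1" for i
  proof (cases "\<exists>s. prefix (outdegs s) (drop i xs')")
    case True
    then obtain s where "prefix (outdegs s) (drop i xs')" by blast
    hence "{shape s | s. prefix (outdegs s) (drop i xs')} = {shape s}"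
      using prefix_outdegs_unique by blast
    thus ?thesis by simp
  qed simp
  have finW: "finite W" unfolding W_def using single by blast
  have "card W \<le> (\<Sum>i\<in>{Suc j - N..j}. card {shape s | s. prefix (outdegs s) (drop i xs')})"
    unfolding W_def by (rule card_UN_le) simp
  also have "\<dots> \<le> (\<Sum>i\<in>{Suc j - N..j}. 1)" using single by (intro sum_mono) blast
  also have "\<dots> \<le> N" by simp
  finally have W: "card W \<le> N" .
  have "shapes_at G n xs' \<subseteq> shapes_at G n xs \<union> W"
  proof
    fix u assume "u \<in> shapes_at G n xs'"
    then obtain s i where s: "u = shape s" "s \<in> G" "i < n" "prefix (outdegs s) (drop i xs')"
      by (auto simp: shapes_at_def)
    show "u \<in> shapes_at G n xs \<union> W"
    proof (cases "i \<in> {Suc j - N..j}")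
      case True
      thus ?thesis using s unfolding W_def by blast
    next
      case False
      have "length (outdegs s) \<le> N" using s(2) G by (auto simp: tsize_def)
      hence "prefix (outdegs s) (drop i xs)"
        using s(4) eq[OF False] by (metis prefix_take_iff)
      thus ?thesis using s by (auto simp: shapes_at_def)
    qed
  qed
  hence "card (shapes_at G n xs') \<le> card (shapes_at G n xs \<union> W)"
    using finW finite_shapes_at[OF finG] by (intro card_mono) auto
  also have "\<dots> \<le> card (shapes_at G n xs) + card W" by (rule card_Un_le)
  finally show ?thesis using W by simp
qed

lemma card_shapes_at_update:
  assumes G: "G \<subseteq> {t. tsize t \<le> N}"
  shows "\<bar>real (card (shapes_at G n (xs[j := y]))) - real (card (shapes_at G n xs))\<bar> \<le> N"
proof -
  have eq: "take N (drop i (xs[j := y])) = take N (drop i xs)" if "i \<notin> {Suc j - N..j}" for i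
  proof (cases "i > j")
    case True
    thus ?thesis by (simp add: drop_update_cancel)
  next
    case False
    hence "i + N \<le> j" using that by auto
    thus ?thesis by (simp add: drop_update_swap take_update_cancel)
  qed
  have "card (shapes_at G n (xs[j := y])) \<le> card (shapes_at G n xs) + N"
    by (rule card_shapes_at_local[OF G eq])
  moreover have "card (shapes_at G n xs) \<le> card (shapes_at G n (xs[j := y])) + N"
    by (rule card_shapes_at_local[OF G eq[symmetric]])
  ultimately show ?thesis by linarith
qed

text \<open>To be applied to the letters zs behind an occurrence of s, so that the event is
  independent of that occurrence.\<close>

definition repeats :: "ptree \<Rightarrow> nat \<Rightarrow> nat list \<Rightarrow> bool" where
  "repeats s n zs \<longleftrightarrow> (\<exists>j<n. \<exists>s'. shape s' = shape s \<and> prefix (outdegs s') (drop j zs))"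

text \<open>Two occurrences of the same shape have the same size, so they cannot be nested and the
  later one lies completely behind the earlier one.\<close>

lemma same_shape_disjoint:
  assumes "prefix (outdegs s) (drop i xs)" "prefix (outdegs s') (drop j xs)" "shape s = shape s'" "i < j"
  shows "i + tsize s \<le> j"
proof (rule ccontr)
  assume *: "\<not> ?thesis"
  define l where "l = j - i"
  have l: "l < tsize s" "l > 0" "j = i + l" using * assms(4) by (auto simp: l_def)
  obtain vs where vs: "drop i xs = outdegs s @ vs" using assms(1) by (auto simp: prefix_def)
  have "drop j xs = drop l (drop i xs)" by (simp add: l(3) add.commute)
  also have "\<dots> = drop l (outdegs s) @ vs" using l(1) by (simp add: vs tsize_def)
  finally have "prefix (outdegs (subs s ! l)) (drop j xs)"
    using prefix_subs[OF l(1)] by (auto simp: prefix_def)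
  hence "s' = subs s ! l" using assms(2) prefix_outdegs_unique by blast
  hence "tsize s' < tsize s" using tsize_subs_le[OF l(1)] l by simp
  thus False using tsize_eq_if_shape_eq[OF assms(3)] by simp
qed

text \<open>Each shape is counted at its last occurrence: two positions whose trees are not repeated
  further on carry different shapes.\<close>

lemma card_shapes_at_ge:
  assumes G: "G \<subseteq> {t. tsize t \<le> N}"
  shows "real (card (shapes_at G n xs)) \<ge>
     (\<Sum>i<n. tree_functional N (\<lambda>s. of_bool (s \<in> G)) (drop i xs)
        - tree_functional N (\<lambda>s. of_bool (s \<in> G \<and> repeats s n (drop (tsize s) (drop i xs)))) (drop i xs))"
proof -
  have finG: "finite G" by (rule finite_subset[OF G]) (rule finite_tsize_le)
  define I where "I = {i. i < n \<and> (\<exists>s\<in>G. prefix (outdegs s) (drop i xs) \<and> \<not> repeats s n (drop (tsize s) (drop i xs)))}"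
  have finI: "finite I" by (simp add: I_def)
  have "\<forall>i\<in>I. \<exists>s\<in>G. prefix (outdegs s) (drop i xs) \<and> \<not> repeats s n (drop (tsize s) (drop i xs))"
    by (simp add: I_def)
  then obtain T where T: "\<And>i. i \<in> I \<Longrightarrow> T i \<in> G \<and> prefix (outdegs (T i)) (drop i xs) \<and> \<not> repeats (T i) n (drop (tsize (T i)) (drop i xs))"
    by metis
  have I_less: "i < n" if "i \<in> I" for i using that by (simp add: I_def)
  have no: False if "i \<in> I" "j \<in> I" "i < j" "shape (T i) = shape (T j)" for i j
  proof -
    have "i + tsize (T i) \<le> j" using same_shape_disjoint T that by blast
    hence "drop j xs = drop (j - (i + tsize (T i))) (drop (tsize (T i)) (drop i xs))"
      by (simp add: add.commute)
    moreover have "j - (i + tsize (T i)) < n" using I_less[OF that(2)] by simp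
    ultimately have "repeats (T i) n (drop (tsize (T i)) (drop i xs))"
      unfolding repeats_def using T[OF that(2)] that(4) by metis
    thus False using T[OF that(1)] by blast
  qed
  have inj: "inj_on (\<lambda>i. shape (T i)) I"
  proof (rule inj_onI)
    fix i j assume "i \<in> I" "j \<in> I" "shape (T i) = shape (T j)"
    thus "i = j" using no[of i j] no[of j i] by (cases i j rule: linorder_cases) auto
  qed
  have "(\<lambda>i. shape (T i)) ` I \<subseteq> shapes_at G n xs"
    using T I_less unfolding shapes_at_def by blast
  hence "card I \<le> card (shapes_at G n xs)"
    using card_inj_on_le[OF inj _ finite_shapes_at[OF finG]] by blast
  moreover have "(\<Sum>i<n. tree_functional N (\<lambda>s. of_bool (s \<in> G)) (drop i xs)
        - tree_functional N (\<lambda>s. of_bool (s \<in> G \<and> repeats s n (drop (tsize s) (drop i xs)))) (drop i xs))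
     \<le> (\<Sum>i<n. of_bool (i \<in> I))"
  proof (rule sum_mono)
    fix i assume i: "i \<in> {..<n}"
    show "tree_functional N (\<lambda>s. of_bool (s \<in> G)) (drop i xs)
        - tree_functional N (\<lambda>s. of_bool (s \<in> G \<and> repeats s n (drop (tsize s) (drop i xs)))) (drop i xs)
        \<le> of_bool (i \<in> I)"
    proof (rule tree_functional_cases[of "drop i xs" N])
      fix s assume s: "prefix (outdegs s) (drop i xs)" "\<And>G. tree_functional N G (drop i xs) = G s"
      show ?thesis unfolding s(2) using i s(1) by (auto simp: I_def)
    next
      assume "\<And>G. tree_functional N G (drop i xs) = 0"
      thus ?thesis by simp
    qed
  qed
  moreover have "(\<Sum>i<n. of_bool (i \<in> I)) = real (card I)"
  proof -
    have "I = {..<n} \<inter> I" using I_less by auto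
    thus ?thesis by simp
  qed
  ultimately show ?thesis by linarith
qed

section \<open>Tail bounds for the conditioned tree\<close>

lemma expectation_prefix_outdegs_le:
  "expect (replicate_pmf k \<xi>) (\<lambda>xs. of_bool (prefix (outdegs t) xs)) \<le> weight (pmf \<xi>) t"
proof (cases "tsize t \<le> k")
  case True
  thus ?thesis using expectation_prefix_outdegs[OF True, of \<xi>] by simp
next
  case False
  have "prob (replicate_pmf k \<xi>) {xs. prefix (outdegs t) xs} = prob (replicate_pmf k \<xi>) {}"
    by (rule prob_replicate_cong) (use False prefix_length_le in \<open>fastforce simp: tsize_def\<close>)
  thus ?thesis unfolding prob_eq_expectation_of_bool by (simp add: weight_nonneg)
qed

text \<open>A union bound over the n positions and the finitely many plane trees of the
  shape.\<close>

lemma expectation_repeats: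
  "expect (replicate_pmf k \<xi>) (\<lambda>xs. of_bool (repeats s n xs)) \<le> n * shape_weight (pmf \<xi>) (shape s)"
proof -
  let ?P = "replicate_pmf k \<xi>"
  define S where "S = {s'. shape s' = shape s}"
  have finS: "finite S" unfolding S_def by (rule finite_shape_eq)
  have ib: "integrable (measure_pmf ?P) (\<lambda>xs. of_bool (A xs) :: real)" for A
    by (rule integrable_pmf_bounded[of _ 1]) auto
  have le: "of_bool (repeats s n xs) \<le> (\<Sum>j<n. \<Sum>s'\<in>S. of_bool (prefix (outdegs s') (drop j xs)) :: real)" for xs
  proof (cases "repeats s n xs")
    case True
    then obtain j s' where "j < n" "s' \<in> S" "prefix (outdegs s') (drop j xs)"
      unfolding repeats_def S_def by blast
    have "(1::real) = of_bool (prefix (outdegs s') (drop j xs))" using \<open>prefix _ _\<close> by simp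
    also have "\<dots> \<le> (\<Sum>s'\<in>S. of_bool (prefix (outdegs s') (drop j xs)))"
      using \<open>s' \<in> S\<close> finS by (intro member_le_sum) auto
    also have "\<dots> \<le> (\<Sum>j<n. \<Sum>s'\<in>S. of_bool (prefix (outdegs s') (drop j xs)))"
      using \<open>j < n\<close> by (intro member_le_sum[of j _ "\<lambda>j. \<Sum>s'\<in>S. of_bool (prefix (outdegs s') (drop j xs))"]) (auto intro: sum_nonneg)
    finally show ?thesis using True by simp
  qed (auto intro!: sum_nonneg)
  have "expect ?P (\<lambda>xs. of_bool (repeats s n xs) :: real)
      \<le> expect ?P (\<lambda>xs. \<Sum>j<n. \<Sum>s'\<in>S. of_bool (prefix (outdegs s') (drop j xs)))"
    by (intro integral_mono le ib Bochner_Integration.integrable_sum)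
  also have "\<dots> = (\<Sum>j<n. \<Sum>s'\<in>S. expect ?P (\<lambda>xs. of_bool (prefix (outdegs s') (drop j xs))))"
    by (simp add: Bochner_Integration.integral_sum Bochner_Integration.integrable_sum ib)
  also have "\<dots> \<le> (\<Sum>j<n. \<Sum>s'\<in>S. weight (pmf \<xi>) s')"
  proof (intro sum_mono)
    fix j s'
    have "expect ?P (\<lambda>xs. of_bool (prefix (outdegs s') (drop j xs)))
       = expect (replicate_pmf (k - j) \<xi>) (\<lambda>xs. of_bool (prefix (outdegs s') xs) :: real)"
      by (rule expectation_drop[of _ 1]) auto
    thus "expect ?P (\<lambda>xs. of_bool (prefix (outdegs s') (drop j xs))) \<le> weight (pmf \<xi>) s'"
      using expectation_prefix_outdegs_le by simp
  qed
  also have "\<dots> = n * shape_weight (pmf \<xi>) (shape s)"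
    by (simp add: shape_weight_def S_def)
  finally show ?thesis .
qed

lemma expectation_prefix_repeats:
  "expect (replicate_pmf k \<xi>) (\<lambda>xs. of_bool (prefix (outdegs s) xs) * of_bool (repeats s n (drop (tsize s) xs)))
     \<le> weight (pmf \<xi>) s * (n * shape_weight (pmf \<xi>) (shape s))"
proof (cases "tsize s \<le> k")
  case True
  have "expect (replicate_pmf k \<xi>) (\<lambda>xs. of_bool (prefix (outdegs s) xs) * of_bool (repeats s n (drop (tsize s) xs)))
      = weight (pmf \<xi>) s * expect (replicate_pmf (k - tsize s) \<xi>) (\<lambda>xs. of_bool (repeats s n xs))"
    using expectation_prefix[of "\<lambda>xs. of_bool (repeats s n xs)" 1 "outdegs s" k \<xi>] True
    by (simp add: weight_def tsize_def)
  also have "\<dots> \<le> weight (pmf \<xi>) s * (n * shape_weight (pmf \<xi>) (shape s))"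
    by (intro mult_left_mono expectation_repeats weight_nonneg) simp
  finally show ?thesis .
next
  case False
  have "AE xs in replicate_pmf k \<xi>. of_bool (prefix (outdegs s) xs) * of_bool (repeats s n (drop (tsize s) xs)) = (0::real)"
  proof (rule AE_pmfI)
    fix xs assume "xs \<in> set_pmf (replicate_pmf k \<xi>)"
    hence "\<not> prefix (outdegs s) xs" using False
      by (auto simp: set_replicate_pmf tsize_def dest: prefix_length_le)
    thus "of_bool (prefix (outdegs s) xs) * of_bool (repeats s n (drop (tsize s) xs)) = (0::real)" by simp
  qed
  hence "expect (replicate_pmf k \<xi>) (\<lambda>xs. of_bool (prefix (outdegs s) xs) * of_bool (repeats s n (drop (tsize s) xs))) = (0::real)"
    by (rule integral_eq_zero_AE)
  thus ?thesis by (simp add: weight_nonneg shape_weight_nonneg)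
qed

text \<open>The last positions are given up, since there a tree of size N need not fit into the
  word. As G is nonnegative, this loses only in one direction.\<close>

lemma expectation_window_sum_ge:
  assumes G: "\<And>t. G t \<ge> 0" "\<And>t. G t \<le> 1"
  shows "expect (replicate_pmf n \<xi>) (\<lambda>xs. \<Sum>i<n. tree_functional N G (drop i xs))
     \<ge> (real n - real N) * (\<Sum>t | tsize t \<le> N. G t * weight (pmf \<xi>) t)"
proof -
  define w where "w = (\<Sum>t | tsize t \<le> N. G t * weight (pmf \<xi>) t)"
  have w: "w \<ge> 0" unfolding w_def by (intro sum_nonneg mult_nonneg_nonneg G weight_nonneg) simp
  have b: "\<bar>tree_functional N G xs\<bar> \<le> 1" for xs
    using tree_functional_abs_le[of N G 1 xs] G by auto
  have nn: "tree_functional N G xs \<ge> 0" for xs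
    unfolding tree_functional_def by (intro sum_nonneg mult_nonneg_nonneg G) auto
  have "(real n - real N) * w \<le> real (card {i. i + N \<le> n \<and> i < n}) * w"
  proof (intro mult_right_mono w)
    have "{..<n - N} \<subseteq> {i. i + N \<le> n \<and> i < n}" by auto
    hence "card {..<n - N} \<le> card {i. i + N \<le> n \<and> i < n}" by (intro card_mono) auto
    thus "real n - real N \<le> real (card {i. i + N \<le> n \<and> i < n})" by simp
  qed
  also have "\<dots> = (\<Sum>i<n. if i + N \<le> n then w else 0)"
  proof -
    have "{i. i + N \<le> n \<and> i < n} = {i \<in> {..<n}. i + N \<le> n}" by auto
    thus ?thesis by (simp add: sum.inter_filter[symmetric])
  qed
  also have "\<dots> \<le> (\<Sum>i<n. expect (replicate_pmf n \<xi>) (\<lambda>xs. tree_functional N G (drop i xs)))"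
  proof (rule sum_mono)
    fix i
    have *: "expect (replicate_pmf n \<xi>) (\<lambda>xs. tree_functional N G (drop i xs))
       = expect (replicate_pmf (n - i) \<xi>) (tree_functional N G)"
      by (rule expectation_drop[OF b])
    show "(if i + N \<le> n then w else 0) \<le> expect (replicate_pmf n \<xi>) (\<lambda>xs. tree_functional N G (drop i xs))"
      unfolding * using nn expectation_tree_functional[of N "n - i" \<xi> G]
      by (auto simp: w_def intro!: integral_nonneg_AE)
  qed
  also have "\<dots> = expect (replicate_pmf n \<xi>) (\<lambda>xs. \<Sum>i<n. tree_functional N G (drop i xs))"
    by (rule Bochner_Integration.integral_sum[symmetric]) (rule integrable_pmf_bounded[OF b])
  finally show ?thesis unfolding w_def .
qed

text \<open>The expected number of occurrences minus that of repeated ones. By independence an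
  occurrence of s is repeated with probability at most n \<epsilon>, and summation over n positions
  gives n^2 \<epsilon>.\<close>

lemma expectation_card_shapes_at:
  assumes G: "G \<subseteq> {t. tsize t \<le> N}"
    and \<epsilon>: "\<And>s. s \<in> G \<Longrightarrow> shape_weight (pmf \<xi>) (shape s) \<le> \<epsilon>" "\<epsilon> \<ge> 0"
    and le1: "(\<Sum>t\<in>G. weight (pmf \<xi>) t) \<le> 1"
  shows "expect (replicate_pmf n \<xi>) (\<lambda>xs. real (card (shapes_at G n xs)))
     \<ge> (real n - real N) * (\<Sum>t\<in>G. weight (pmf \<xi>) t) - real n ^ 2 * \<epsilon>"
proof -
  let ?P = "replicate_pmf n \<xi>"
  have finG: "finite G" by (rule finite_subset[OF G]) (rule finite_tsize_le)
  define A where "A xs = tree_functional N (\<lambda>s. of_bool (s \<in> G)) xs" for xs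
  define B where "B xs = tree_functional N (\<lambda>s. of_bool (s \<in> G \<and> repeats s n (drop (tsize s) xs))) xs" for xs
  have bA: "\<bar>A xs\<bar> \<le> 1" and bB: "\<bar>B xs\<bar> \<le> 1" for xs
    unfolding A_def B_def using tree_functional_abs_le[of N _ 1 xs] by auto
  have iA: "integrable (measure_pmf p) (\<lambda>xs. A (f xs))" and iB: "integrable (measure_pmf p) (\<lambda>xs. B (f xs))" for p :: "'a pmf" and f
    by (rule integrable_pmf_bounded[OF bA], rule integrable_pmf_bounded[OF bB])
  have bY: "\<bar>real (card (shapes_at G n xs))\<bar> \<le> real (card (shape ` G))" for xs
    using card_mono[OF _ shapes_at_subset[of G n xs]] finG by simp
  have ib: "integrable (measure_pmf p) (\<lambda>xs. of_bool (C xs) * of_bool (D xs) :: real)" for p :: "'b pmf" and C D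
    by (rule integrable_pmf_bounded[of _ 1]) auto
  have "(real n - real N) * (\<Sum>t\<in>G. weight (pmf \<xi>) t) \<le> expect ?P (\<lambda>xs. \<Sum>i<n. A (drop i xs))"
  proof -
    have "(\<Sum>t | tsize t \<le> N. of_bool (t \<in> G) * weight (pmf \<xi>) t) = (\<Sum>t\<in>G. weight (pmf \<xi>) t)"
      by (rule sum.mono_neutral_cong_right) (use finite_tsize_le G in auto)
    thus ?thesis using expectation_window_sum_ge[of "\<lambda>s. of_bool (s \<in> G)" n N \<xi>]
      unfolding A_def by simp
  qed
  moreover have "expect ?P (\<lambda>xs. \<Sum>i<n. B (drop i xs)) \<le> real n ^ 2 * \<epsilon>"
  proof -
    have one: "expect ?P (\<lambda>xs. B (drop i xs)) \<le> n * \<epsilon>" for i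
    proof -
      let ?Q = "replicate_pmf (n - i) \<xi>"
      have eqB: "B xs = (\<Sum>s\<in>G. of_bool (prefix (outdegs s) xs) * of_bool (repeats s n (drop (tsize s) xs)))" for xs
        unfolding B_def tree_functional_def
        by (rule sum.mono_neutral_cong_right) (use finite_tsize_le G in auto)
      have "expect ?P (\<lambda>xs. B (drop i xs)) = expect ?Q B"
        by (rule expectation_drop[OF bB])
      also have "\<dots> = (\<Sum>s\<in>G. expect ?Q (\<lambda>xs. of_bool (prefix (outdegs s) xs) * of_bool (repeats s n (drop (tsize s) xs))))"
        unfolding eqB by (rule Bochner_Integration.integral_sum) (rule ib)
      also have "\<dots> \<le> (\<Sum>s\<in>G. weight (pmf \<xi>) s * (n * \<epsilon>))"
      proof (rule sum_mono)
        fix s assume s: "s \<in> G"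
        have "weight (pmf \<xi>) s * (n * shape_weight (pmf \<xi>) (shape s)) \<le> weight (pmf \<xi>) s * (n * \<epsilon>)"
          using \<epsilon>(1)[OF s] by (intro mult_left_mono weight_nonneg) auto
        thus "expect ?Q (\<lambda>xs. of_bool (prefix (outdegs s) xs) * of_bool (repeats s n (drop (tsize s) xs)))
           \<le> weight (pmf \<xi>) s * (n * \<epsilon>)"
          using expectation_prefix_repeats[of "n - i" \<xi> s n] by linarith
      qed
      also have "\<dots> = (\<Sum>s\<in>G. weight (pmf \<xi>) s) * (n * \<epsilon>)" by (simp add: sum_distrib_right)
      also have "\<dots> \<le> 1 * (n * \<epsilon>)" using le1 \<epsilon>(2) by (intro mult_right_mono) auto
      finally show ?thesis by simp
    qed
    have "expect ?P (\<lambda>xs. \<Sum>i<n. B (drop i xs)) = (\<Sum>i<n. expect ?P (\<lambda>xs. B (drop i xs)))"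
      by (rule Bochner_Integration.integral_sum) (rule iB)
    also have "\<dots> \<le> (\<Sum>i<n. n * \<epsilon>)" by (intro sum_mono one)
    finally show ?thesis by (simp add: power2_eq_square mult.assoc)
  qed
  moreover have "expect ?P (\<lambda>xs. \<Sum>i<n. A (drop i xs)) - expect ?P (\<lambda>xs. \<Sum>i<n. B (drop i xs))
      = expect ?P (\<lambda>xs. \<Sum>i<n. A (drop i xs) - B (drop i xs))"
    by (simp add: sum_subtractf iA iB)
  moreover have "(\<Sum>i<n. A (drop i xs) - B (drop i xs)) \<le> real (card (shapes_at G n xs))" for xs
    using card_shapes_at_ge[OF G, where n = n and xs = xs] unfolding A_def B_def .
  hence "expect ?P (\<lambda>xs. \<Sum>i<n. A (drop i xs) - B (drop i xs))
      \<le> expect ?P (\<lambda>xs. real (card (shapes_at G n xs)))"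
    by (intro integral_mono integrable_pmf_bounded[OF bY] Bochner_Integration.integrable_sum Bochner_Integration.integrable_diff iA iB)
  ultimately show ?thesis by linarith
qed

text \<open>Fixes the law by its point probabilities only, so that the results carry over to the
  random tree of the simply generated family, which is defined by other weights.\<close>

definition conditioned_tree :: "nat pmf \<Rightarrow> nat \<Rightarrow> ptree pmf \<Rightarrow> bool" where
  "conditioned_tree \<xi> n R \<longleftrightarrow> tree_prob \<xi> n > 0 \<and>
     (\<forall>t. pmf R t = (if tsize t = n then weight (pmf \<xi>) t / tree_prob \<xi> n else 0))"

lemma conditioned_tree_tsize:
  assumes "conditioned_tree \<xi> n R" "t \<in> set_pmf R"
  shows "tsize t = n" "weight (pmf \<xi>) t > 0"
proof -
  have "pmf R t > 0" using assms(2) by (simp add: pmf_positive)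
  thus "tsize t = n" "weight (pmf \<xi>) t > 0"
    using assms(1) by (auto simp: conditioned_tree_def zero_less_divide_iff split: if_splits)
qed

text \<open>Conditioning the random word on being a tree word costs at most the factor 1 / P(|T| =
  n).\<close>

lemma conditioned_tree_prob_le:
  assumes R: "conditioned_tree \<xi> n R"
    and AB: "\<And>t. tsize t = n \<Longrightarrow> weight (pmf \<xi>) t > 0 \<Longrightarrow> t \<in> A \<Longrightarrow> outdegs t \<in> B"
  shows "prob R A \<le> prob (replicate_pmf n \<xi>) B / tree_prob \<xi> n"
proof -
  define A' where "A' t \<longleftrightarrow> t \<in> A \<and> weight (pmf \<xi>) t > 0" for t
  have fin: "finite {t. tsize t = n \<and> A' t}"
    by (rule finite_subset[OF _ finite_tsize_eq[of n]]) auto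
  have "prob R A = prob R {t. tsize t = n \<and> A' t}"
    using conditioned_tree_tsize[OF R] 
    by (intro measure_pmf.finite_measure_eq_AE) (auto intro!: AE_pmfI simp: A'_def)
  also have "\<dots> = (\<Sum>t | tsize t = n \<and> A' t. weight (pmf \<xi>) t / tree_prob \<xi> n)"
    using R fin by (subst measure_measure_pmf_finite) (auto simp: conditioned_tree_def intro!: sum.cong)
  also have "\<dots> = prob (replicate_pmf n \<xi>) (outdegs ` {t. tsize t = n \<and> A' t}) / tree_prob \<xi> n"
    unfolding prob_outdegs by (simp add: sum_divide_distrib)
  also have "\<dots> \<le> prob (replicate_pmf n \<xi>) B / tree_prob \<xi> n"
    using R AB by (intro divide_right_mono measure_pmf.finite_measure_mono) (auto simp: conditioned_tree_def A'_def)
  finally show ?thesis .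
qed

context critical_offspring
begin

lemma sum_weight_le: "(\<Sum>t | tsize t \<le> m. weight (pmf \<xi>) t) = 1 - tail m"
proof -
  have "{t. tsize t \<le> m} = (\<Union>k\<le>m. {t. tsize t = k})" by auto
  hence "(\<Sum>t | tsize t \<le> m. weight (pmf \<xi>) t) = (\<Sum>k\<le>m. tree_prob \<xi> k)"
    unfolding tree_prob_def by (simp only:) (rule sum.UNION_disjoint, auto simp: finite_tsize_eq)
  thus ?thesis by (simp add: tail_def)
qed

lemma sum_weight_le_1:
  assumes "finite G"
  shows "(\<Sum>t\<in>G. weight (pmf \<xi>) t) \<le> 1"
proof -
  have "(\<Sum>t\<in>G. weight (pmf \<xi>) t) \<le> (\<Sum>t | tsize t \<le> Max (tsize ` G). weight (pmf \<xi>) t)"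
    using assms finite_tsize_le by (intro sum_mono2) (auto simp: weight_nonneg)
  thus ?thesis using tail_nonneg[of "Max (tsize ` G)"] by (simp add: sum_weight_le)
qed

text \<open>McDiarmid's inequality is applied to the number of small fringe subtrees, on which a
  letter has influence at most m. The extra summand m comes from the end of the word: (n - m) (1 -
  \<open>tail m\<close>) is at least n - n \<open>tail m\<close> - m.\<close>

theorem distinct_fringe_upper_tail:
  assumes R: "conditioned_tree \<xi> n R" and "n > 0" "m > 0" "d \<ge> 0"
    and M: "\<And>j. pmf \<xi> j > 0 \<Longrightarrow> j \<in> M"
  shows "prob R {t. real (distinct_fringe t) \<ge>
           (\<Sum>k\<le>m. real (unordered_count M k)) + n * tail m + m + d}
       \<le> exp (- 2 * d\<^sup>2 / (n * (real m)\<^sup>2)) / tree_prob \<xi> n"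
proof -
  let ?\<psi> = "tree_functional m (\<lambda>_. 1)"
  let ?f = "\<lambda>xs. \<Sum>i<n. ?\<psi> (drop i xs)"
  let ?E = "expect (replicate_pmf n \<xi>) ?f"
  have \<psi>: "0 \<le> ?\<psi> xs" "?\<psi> xs \<le> 1" for xs
    using tree_functional_abs_le[of m "\<lambda>_. 1" 1 xs]
    by (auto simp: tree_functional_def intro!: sum_nonneg)
  have \<psi>D: "\<bar>?\<psi> ys - ?\<psi> zs\<bar> \<le> 1" for ys zs
    using \<psi>[of ys] \<psi>[of zs] by linarith
  have "\<bar>?f xs\<bar> \<le> n" for xs
  proof -
    have "?f xs \<le> (\<Sum>i<n. 1)" by (intro sum_mono \<psi>)
    moreover have "?f xs \<ge> 0" by (intro sum_nonneg \<psi>)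
    ultimately show ?thesis by simp
  qed
  hence mcd: "prob (replicate_pmf n \<xi>) {xs. ?f xs \<le> ?E - d} \<le> exp (- 2 * d\<^sup>2 / (n * (real m)\<^sup>2))"
    using window_sum_update[where \<psi> = ?\<psi> and m = m, OF tree_functional_take \<psi>D] assms
    by (intro McDiarmid_lower) auto
  have E: "?E \<ge> (real n - real m) * (1 - tail m)"
    using expectation_window_sum_ge[of "\<lambda>_. 1" n m \<xi>] by (simp add: sum_weight_le)
  have "prob R {t. real (distinct_fringe t) \<ge> (\<Sum>k\<le>m. real (unordered_count M k)) + n * tail m + m + d}
      \<le> prob (replicate_pmf n \<xi>) {xs. ?f xs \<le> ?E - d} / tree_prob \<xi> n"
  proof (rule conditioned_tree_prob_le[OF R], safe)
    fix t assume t: "n = tsize t" "weight (pmf \<xi>) t > 0"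
      and *: "(\<Sum>k\<le>m. real (unordered_count M k)) + real (tsize t) * tail m + m + d \<le> real (distinct_fringe t)"
    have "set (outdegs t) \<subseteq> M" using t(2) M by (auto simp: weight_pos_iff)
    from distinct_fringe_upper[OF t(1)[symmetric] this, of m]
    have "n * tail m + m + d \<le> n - ?f (outdegs t)" using * by (simp add: t)
    moreover have "(real n - real m) * (1 - tail m) = n - n * tail m - m + m * tail m"
      by (simp add: algebra_simps)
    moreover have "m * tail m \<ge> 0" using tail_nonneg by simp
    ultimately show "(\<Sum>i<tsize t. ?\<psi> (drop i (outdegs t))) 
        \<le> expect (replicate_pmf (tsize t) \<xi>) (\<lambda>xs. \<Sum>i<tsize t. ?\<psi> (drop i xs)) - d"
      using E unfolding t(1) by linarith
  qed
  also have "\<dots> \<le> exp (- 2 * d\<^sup>2 / (n * (real m)\<^sup>2)) / tree_prob \<xi> n"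
    by (intro divide_right_mono mcd tree_prob_nonneg)
  finally show ?thesis .
qed

theorem distinct_fringe_lower_tail:
  assumes R: "conditioned_tree \<xi> n R" and "n > 0" "N > 0" "d \<ge> 0"
    and G: "G \<subseteq> {t. tsize t \<le> N}"
    and \<epsilon>: "\<And>s. s \<in> G \<Longrightarrow> shape_weight (pmf \<xi>) (shape s) \<le> \<epsilon>" "\<epsilon> \<ge> 0"
  shows "prob R {t. real (distinct_fringe t) \<le>
           (real n - real N) * (\<Sum>t\<in>G. weight (pmf \<xi>) t) - real n ^ 2 * \<epsilon> - d}
       \<le> exp (- 2 * d\<^sup>2 / (n * (real N)\<^sup>2)) / tree_prob \<xi> n"
proof -
  let ?f = "\<lambda>xs. real (card (shapes_at G n xs))"
  let ?E = "expect (replicate_pmf n \<xi>) ?f"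
  have finG: "finite G" by (rule finite_subset[OF G]) (rule finite_tsize_le)
  have bY: "\<bar>?f xs\<bar> \<le> real (card (shape ` G))" for xs
    using card_mono[OF _ shapes_at_subset[of G n xs]] finG by simp
  have mcd: "prob (replicate_pmf n \<xi>) {xs. ?f xs \<le> ?E - d} \<le> exp (- 2 * d\<^sup>2 / (n * (real N)\<^sup>2))"
    using card_shapes_at_update[OF G] assms by (intro McDiarmid_lower[OF bY]) auto
  have E: "?E \<ge> (real n - real N) * (\<Sum>t\<in>G. weight (pmf \<xi>) t) - real n ^ 2 * \<epsilon>"
    by (rule expectation_card_shapes_at[OF G \<epsilon> sum_weight_le_1[OF finG]])
  have "prob R {t. real (distinct_fringe t) \<le>
           (real n - real N) * (\<Sum>t\<in>G. weight (pmf \<xi>) t) - real n ^ 2 * \<epsilon> - d}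
      \<le> prob (replicate_pmf n \<xi>) {xs. ?f xs \<le> ?E - d} / tree_prob \<xi> n"
  proof (rule conditioned_tree_prob_le[OF R])
    fix t assume t: "tsize t = n"
      and *: "t \<in> {t. real (distinct_fringe t) \<le> (real n - real N) * (\<Sum>t\<in>G. weight (pmf \<xi>) t) - real n ^ 2 * \<epsilon> - d}"
    thus "outdegs t \<in> {xs. ?f xs \<le> ?E - d}"
      using card_shapes_at_le_distinct_fringe[OF t, of G] E by simp
  qed
  also have "\<dots> \<le> exp (- 2 * d\<^sup>2 / (n * (real N)\<^sup>2)) / tree_prob \<xi> n"
    by (intro divide_right_mono mcd tree_prob_nonneg)
  finally show ?thesis .
qed

end

section \<open>A law of large numbers for shape probabilities\<close>

text \<open>Cutting off with \<open>take\<close> bounds the sum on words of every length, although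
  only words of length n have positive probability; integrability then follows from boundedness
  everywhere.\<close>

lemma abs_sum_list_take_le:
  fixes f :: "'a \<Rightarrow> real"
  assumes H: "\<And>x. \<bar>f x\<bar> \<le> H"
  shows "\<bar>\<Sum>x\<leftarrow>take k xs. f x\<bar> \<le> k * H"
proof (induction k arbitrary: xs)
  case (Suc k)
  have "H \<ge> 0" using H[of undefined] by linarith
  thus ?case using Suc[of "tl xs"] H[of "hd xs"] by (cases xs) (auto simp: algebra_simps)
qed simp

lemma expectation_sum_list:
  fixes f :: "'a \<Rightarrow> real"
  assumes H: "\<And>x. \<bar>f x\<bar> \<le> H"
  shows "expect (replicate_pmf n p) (\<lambda>xs. \<Sum>x\<leftarrow>take n xs. f x) = n * expect p f"
proof (induction n)
  case (Suc n)
  note b = abs_sum_list_take_le[OF H]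
  have i: "integrable (measure_pmf (replicate_pmf n p)) (\<lambda>xs. \<Sum>x\<leftarrow>take n xs. f x)"
    by (rule integrable_pmf_bounded[OF b])
  have "expect (replicate_pmf (Suc n) p) (\<lambda>xs. \<Sum>x\<leftarrow>take (Suc n) xs. f x)
     = expect p (\<lambda>x. f x + n * expect p f)"
    unfolding expectation_replicate_pmf_Suc[OF b] using i Suc.IH by simp
  also have "\<dots> = Suc n * expect p f"
  proof -
    have "integrable (measure_pmf p) f" by (rule integrable_pmf_bounded[OF H])
    thus ?thesis by (simp add: algebra_simps)
  qed
  finally show ?case .
qed simp

lemma expectation_sum_list_square:
  fixes f :: "'a \<Rightarrow> real"
  assumes H: "\<And>x. \<bar>f x\<bar> \<le> H" and E0: "expect p f = 0"
  shows "expect (replicate_pmf n p) (\<lambda>xs. (\<Sum>x\<leftarrow>take n xs. f x)\<^sup>2)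
     = n * expect p (\<lambda>x. (f x)\<^sup>2)"
proof (induction n)
  case (Suc n)
  note b = abs_sum_list_take_le[OF H]
  have b2: "\<bar>(\<Sum>x\<leftarrow>take k xs. f x)\<^sup>2\<bar> \<le> (k * H)\<^sup>2" for k xs
    using power_mono[OF b[where k = k and xs = xs], where n = 2] by simp
  have i: "integrable (measure_pmf (replicate_pmf n p)) (\<lambda>xs. \<Sum>x\<leftarrow>take n xs. f x)"
    "integrable (measure_pmf (replicate_pmf n p)) (\<lambda>xs. (\<Sum>x\<leftarrow>take n xs. f x)\<^sup>2)"
    by (rule integrable_pmf_bounded[OF b] integrable_pmf_bounded[OF b2])+
  have ip: "integrable (measure_pmf p) (\<lambda>x. (f x)\<^sup>2)"
    by (rule integrable_pmf_bounded[of _ "H\<^sup>2"]) (use power_mono[OF H, where n = 2] in simp)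
  have "expect (replicate_pmf (Suc n) p) (\<lambda>xs. (\<Sum>x\<leftarrow>take (Suc n) xs. f x)\<^sup>2)
     = expect p (\<lambda>x. expect (replicate_pmf n p)
         (\<lambda>xs. (f x)\<^sup>2 + (2 * f x * (\<Sum>x\<leftarrow>take n xs. f x) + (\<Sum>x\<leftarrow>take n xs. f x)\<^sup>2)))"
    unfolding expectation_replicate_pmf_Suc[OF b2] by (simp add: power2_sum algebra_simps)
  also have "\<dots> = expect p (\<lambda>x. (f x)\<^sup>2 + n * expect p (\<lambda>x. (f x)\<^sup>2))"
    using i Suc.IH expectation_sum_list[OF H, of n p] E0 by simp
  also have "\<dots> = Suc n * expect p (\<lambda>x. (f x)\<^sup>2)"
    using ip by (simp add: algebra_simps)
  finally show ?case .
qed simp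

lemma Chebyshev_sum_list:
  fixes f :: "'a \<Rightarrow> real"
  assumes H: "\<And>x. \<bar>f x\<bar> \<le> H" and a: "a > 0"
  shows "prob (replicate_pmf n p) {xs. (\<Sum>x\<leftarrow>take n xs. f x) \<ge> n * expect p f + a}
     \<le> n * expect p (\<lambda>x. (f x)\<^sup>2) / a\<^sup>2"
proof -
  let ?P = "replicate_pmf n p"
  define \<mu> where "\<mu> = expect p f"
  define c where "c x = f x - \<mu>" for x
  have i: "integrable (measure_pmf p) f" by (rule integrable_pmf_bounded[OF H])
  have i2: "integrable (measure_pmf p) (\<lambda>x. (f x)\<^sup>2)"
    by (rule integrable_pmf_bounded[of _ "H\<^sup>2"]) (use power_mono[OF H, where n = 2] in simp)
  have \<mu>: "\<bar>\<mu>\<bar> \<le> H" unfolding \<mu>_def by (rule expectation_pmf_bounded[OF H])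
  have c: "\<bar>c x\<bar> \<le> 2 * H" for x using H[of x] \<mu> unfolding c_def by linarith
  note b = abs_sum_list_take_le[OF c]
  have b2: "\<bar>(\<Sum>x\<leftarrow>take k xs. c x)\<^sup>2\<bar> \<le> (k * (2 * H))\<^sup>2" for k xs
    using power_mono[OF b[where k = k and xs = xs], where n = 2] by simp
  have Ec: "expect p c = 0"
    unfolding c_def using i by (simp add: \<mu>_def)
  have "expect p (\<lambda>x. (c x)\<^sup>2) = expect p (\<lambda>x. (f x)\<^sup>2) - \<mu>\<^sup>2"
    unfolding c_def power2_diff using i i2
    by (simp add: \<mu>_def power2_eq_square)
  hence Ec2: "expect p (\<lambda>x. (c x)\<^sup>2) \<le> expect p (\<lambda>x. (f x)\<^sup>2)" by simp
  have sub: "(\<Sum>x\<leftarrow>xs. c x) = (\<Sum>x\<leftarrow>xs. f x) - length xs * \<mu>" for xs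
    by (induction xs) (auto simp: c_def algebra_simps)
  have "prob ?P {xs. (\<Sum>x\<leftarrow>take n xs. f x) \<ge> n * \<mu> + a} \<le> prob ?P {xs \<in> space (measure_pmf ?P). a\<^sup>2 \<le> (\<Sum>x\<leftarrow>take n xs. c x)\<^sup>2}"
  proof (rule measure_pmf.finite_measure_mono_AE)
    show "AE xs in measure_pmf ?P. xs \<in> {xs. (\<Sum>x\<leftarrow>take n xs. f x) \<ge> n * \<mu> + a} \<longrightarrow> xs \<in> {xs \<in> space (measure_pmf ?P). a\<^sup>2 \<le> (\<Sum>x\<leftarrow>take n xs. c x)\<^sup>2}"
    proof (rule AE_pmfI)
      fix xs assume "xs \<in> set_pmf ?P"
      hence "length xs = n" by (simp add: set_replicate_pmf)
      thus "xs \<in> {xs. (\<Sum>x\<leftarrow>take n xs. f x) \<ge> n * \<mu> + a} \<longrightarrow> xs \<in> {xs \<in> space (measure_pmf ?P). a\<^sup>2 \<le> (\<Sum>x\<leftarrow>take n xs. c x)\<^sup>2}"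
        using a by (auto simp: sub intro!: power_mono)
    qed
  qed simp
  also have "\<dots> \<le> expect ?P (\<lambda>xs. (\<Sum>x\<leftarrow>take n xs. c x)\<^sup>2) / a\<^sup>2"
    by (rule integral_Markov_inequality_measure[of _ _ UNIV])
       (use a in \<open>auto intro!: integrable_pmf_bounded[OF b2]\<close>)
  also have "\<dots> = n * expect p (\<lambda>x. (c x)\<^sup>2) / a\<^sup>2"
    by (simp add: expectation_sum_list_square[OF c Ec])
  also have "\<dots> \<le> n * expect p (\<lambda>x. (f x)\<^sup>2) / a\<^sup>2"
    using Ec2 by (intro divide_right_mono mult_left_mono) auto
  finally show ?thesis unfolding \<mu>_def .
qed

lemma prob_exists_in_list:
  "prob (replicate_pmf n p) {xs. \<exists>x\<in>set xs. A x} \<le> n * prob p {x. A x}"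
proof -
  have nn: "(\<Sum>x\<leftarrow>xs. of_bool (A x)) \<ge> (0::real)" for xs by (induction xs) auto
  have b: "\<bar>\<Sum>x\<leftarrow>take k xs. of_bool (A x)\<bar> \<le> real k" for k xs
  proof (induction k arbitrary: xs)
    case (Suc k)
    show ?case using Suc[of "tl xs"] by (cases xs) auto
  qed simp
  have "prob (replicate_pmf n p) {xs. \<exists>x\<in>set xs. A x}
     = expect (replicate_pmf n p) (\<lambda>xs. of_bool (\<exists>x\<in>set xs. A x))"
    by (rule prob_eq_expectation_of_bool)
  also have "\<dots> \<le> expect (replicate_pmf n p) (\<lambda>xs. \<Sum>x\<leftarrow>take n xs. of_bool (A x))"
  proof (rule integral_mono_AE)
    show "AE xs in replicate_pmf n p. of_bool (\<exists>x\<in>set xs. A x) \<le> (\<Sum>x\<leftarrow>take n xs. of_bool (A x) :: real)"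
    proof (rule AE_pmfI)
      fix xs assume "xs \<in> set_pmf (replicate_pmf n p)"
      hence len: "length xs = n" by (simp add: set_replicate_pmf)
      have "of_bool (\<exists>x\<in>set ys. A x) \<le> (\<Sum>x\<leftarrow>ys. of_bool (A x) :: real)" for ys
      proof (induction ys)
        case (Cons a ys)
        thus ?case using nn[of ys] by (cases "A a"; cases "\<exists>x\<in>set ys. A x") auto
      qed simp
      thus "of_bool (\<exists>x\<in>set xs. A x) \<le> (\<Sum>x\<leftarrow>take n xs. of_bool (A x) :: real)" using len by simp
    qed
  qed (auto intro!: integrable_pmf_bounded[OF b] integrable_pmf_bounded[of _ 1])
  also have "\<dots> = n * prob p {x. A x}"
    unfolding prob_eq_expectation_of_bool by (rule expectation_sum_list[of _ 1]) auto
  finally show ?thesis .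
qed

section \<open>Bounds for the toll\<close>

lemma ln_fact_le: "j \<le> n \<Longrightarrow> 0 < n \<Longrightarrow> ln (fact j) \<le> real j * ln (real n)"
proof -
  assume j: "j \<le> n" "0 < n"
  have "(fact j :: real) \<le> real n ^ j"
  proof -
    have "(fact j :: nat) \<le> j ^ j" using fact_le_power[of j, where 'a = nat] by simp
    also have "\<dots> \<le> n ^ j" using j by (intro power_mono) auto
    finally have "real (fact j) \<le> real (n ^ j)" by (rule of_nat_mono)
    thus ?thesis by simp
  qed
  hence "ln (fact j) \<le> ln (real n ^ j)" using j by (subst ln_le_cancel_iff) auto
  thus ?thesis using j by (simp add: ln_realpow)
qed

lemma ln_fact_le_square: "ln (fact j) \<le> (real j)\<^sup>2"
proof (cases "j = 0")
  case False
  have "ln (fact j) \<le> real j * ln (real j)" using False by (intro ln_fact_le) auto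
  also have "\<dots> \<le> real j * real j" using False ln_le_minus_one[of "real j"]
    by (intro mult_left_mono) auto
  finally show ?thesis by (simp add: power2_eq_square)
qed simp

lemma sum_weight_eq_prob:
  assumes G: "G \<subseteq> {t. tsize t \<le> N}" and "N \<le> n"
  shows "(\<Sum>t\<in>G. weight (pmf \<xi>) t) = prob (replicate_pmf n \<xi>) {xs. \<exists>t\<in>G. prefix (outdegs t) xs}"
proof -
  have "tree_functional N (\<lambda>t. of_bool (t \<in> G)) xs = of_bool (\<exists>t\<in>G. prefix (outdegs t) xs)" for xs
  proof (rule tree_functional_cases[of xs N])
    fix s assume s: "prefix (outdegs s) xs" "\<And>G. tree_functional N G xs = G s"
    show ?thesis unfolding s(2) using s(1) prefix_outdegs_unique by auto
  next
    assume *: "\<And>t. tsize t \<le> N \<Longrightarrow> \<not> prefix (outdegs t) xs" and "\<And>G. tree_functional N G xs = 0"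
    thus ?thesis using G by auto
  qed
  hence "prob (replicate_pmf n \<xi>) {xs. \<exists>t\<in>G. prefix (outdegs t) xs}
      = expect (replicate_pmf n \<xi>) (tree_functional N (\<lambda>t. of_bool (t \<in> G)))"
    unfolding prob_eq_expectation_of_bool by presburger
  also have "\<dots> = (\<Sum>t | tsize t \<le> N. of_bool (t \<in> G) * weight (pmf \<xi>) t)"
    by (rule expectation_tree_functional[OF assms(2)])
  also have "\<dots> = (\<Sum>t\<in>G. weight (pmf \<xi>) t)"
    by (rule sum.mono_neutral_cong_right) (use finite_tsize_le G in auto)
  finally show ?thesis ..
qed

lemma prob_replicate_mono:
  assumes "\<And>xs. length xs = n \<Longrightarrow> xs \<in> A \<Longrightarrow> xs \<in> B"
  shows "prob (replicate_pmf n p) A \<le> prob (replicate_pmf n p) B"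
  by (intro measure_pmf.finite_measure_mono_AE) (auto intro!: AE_pmfI simp: assms set_replicate_pmf)

text \<open>The probability of the degree and the multiplicities can only lower the toll. A
  one-sided bound by a function of the degree suffices, since only upper deviations of the sum of
  tolls have to be excluded.\<close>

lemma toll_le: "toll \<xi> t \<le> ln (fact (hd (outdegs t)))"
proof (cases t)
  case (PNode ts)
  define D where "D = (\<Prod>u\<in>set (map shape ts). fact (count (mset (map shape ts)) u) :: real)"
  have D: "D \<ge> 1" unfolding D_def by (rule prod_ge_1) (simp add: fact_ge_1)
  have "ln (pmf \<xi> (length ts) * fact (length ts)) - ln D \<le> ln (fact (length ts))" if "pmf \<xi> (length ts) > 0"
  proof -
    have "pmf \<xi> (length ts) * fact (length ts) \<le> 1 * fact (length ts)"
      by (intro mult_right_mono pmf_le_1) auto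
    hence "ln (pmf \<xi> (length ts) * fact (length ts)) \<le> ln (fact (length ts))"
      using that by simp
    thus ?thesis using D ln_ge_zero[of D] by linarith
  qed
  thus ?thesis using PNode by (auto simp: D_def fact_ge_1 simp del: mset_map set_map)
qed

context critical_offspring
begin

lemma tail_tendsto_0: "tail \<longlonglongrightarrow> 0"
proof -
  have "(\<lambda>m. inverse (sqrt (real m)) * (sqrt (real m) * tail m)) \<longlonglongrightarrow> 0 * sqrt (2 / (pi * \<sigma>2))"
    by (intro tendsto_mult tail_asymptotics) real_asymp
  moreover have "\<forall>\<^sub>F m in sequentially. inverse (sqrt (real m)) * (sqrt (real m) * tail m) = tail m"
    using eventually_gt_at_top[of 0] by eventually_elim simp
  ultimately have "tail \<longlonglongrightarrow> 0 * sqrt (2 / (pi * \<sigma>2))" by (rule Lim_transform_eventually)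
  thus ?thesis by simp
qed

text \<open>The weights sum to 1 because \<open>tail\<close> tends to 0, that is, because the tree
  is almost surely finite.\<close>

lemma pmf_gw_tree: "pmf (gw_tree \<xi>) t = weight (pmf \<xi>) t"
  unfolding gw_tree_def
proof (rule pmf_embed_pmf)
  show "0 \<le> weight (pmf \<xi>) x" for x by (rule weight_nonneg) simp
  define f where "f m t = ennreal (weight (pmf \<xi>) t) * indicator {t. tsize t \<le> m} t" for m t
  have "(\<lambda>t. ennreal (weight (pmf \<xi>) t)) = (\<lambda>t. SUP m. f m t)"
  proof
    fix t
    have "(SUP m. f m t) \<le> ennreal (weight (pmf \<xi>) t)"
      by (rule SUP_least) (simp add: f_def indicator_def)
    moreover have "ennreal (weight (pmf \<xi>) t) = f (tsize t) t" by (simp add: f_def)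
    moreover have "f (tsize t) t \<le> (SUP m. f m t)" by (rule SUP_upper) simp
    ultimately show "ennreal (weight (pmf \<xi>) t) = (SUP m. f m t)" by (metis antisym)
  qed
  hence "(\<integral>\<^sup>+t. ennreal (weight (pmf \<xi>) t) \<partial>count_space UNIV) = (\<integral>\<^sup>+t. (SUP m. f m t) \<partial>count_space UNIV)" by metis
  also have "\<dots> = (SUP m. \<integral>\<^sup>+t. f m t \<partial>count_space UNIV)"
    by (intro nn_integral_monotone_convergence_SUP) (auto simp: incseq_def le_fun_def f_def indicator_def)
  also have "(\<lambda>m. \<integral>\<^sup>+t. f m t \<partial>count_space UNIV) = (\<lambda>m. ennreal (1 - tail m))"
  proof
    fix m
    have "(\<integral>\<^sup>+t. f m t \<partial>count_space UNIV) = (\<Sum>t | tsize t \<le> m. f m t)"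
      by (rule nn_integral_count_space'[OF finite_tsize_le]) (auto simp: f_def)
    also have "\<dots> = (\<Sum>t | tsize t \<le> m. ennreal (weight (pmf \<xi>) t))"
      by (intro sum.cong) (auto simp: f_def)
    also have "\<dots> = ennreal (1 - tail m)"
      by (subst sum_ennreal) (auto simp: weight_nonneg sum_weight_le)
    finally show "(\<integral>\<^sup>+t. f m t \<partial>count_space UNIV) = ennreal (1 - tail m)" .
  qed
  also have "(SUP m. ennreal (1 - tail m)) = 1"
  proof (rule LIMSEQ_unique[OF LIMSEQ_SUP])
    show "incseq (\<lambda>m. ennreal (1 - tail m))"
      using decseqD[OF decseq_tail] by (auto simp: incseq_def intro!: ennreal_leI)
    have "(\<lambda>m. 1 - tail m) \<longlonglongrightarrow> 1 - 0" by (intro tendsto_intros tail_tendsto_0)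
    thus "(\<lambda>m. ennreal (1 - tail m)) \<longlonglongrightarrow> 1"
      using tendsto_ennrealI by fastforce
  qed
  finally show "(\<integral>\<^sup>+t. ennreal (weight (pmf \<xi>) t) \<partial>count_space UNIV) = 1" .
qed

lemma truncated_toll_limit:
  assumes "integrable (measure_pmf (gw_tree \<xi>)) (toll \<xi>)"
  shows "(\<lambda>B. \<Sum>t | tsize t \<le> B. toll \<xi> t * weight (pmf \<xi>) t) \<longlonglongrightarrow> expect (gw_tree \<xi>) (toll \<xi>)"
proof -
  have "(\<lambda>B. expect (gw_tree \<xi>) (\<lambda>t. if tsize t \<le> B then toll \<xi> t else 0))
      \<longlonglongrightarrow> expect (gw_tree \<xi>) (toll \<xi>)"
  proof (rule integral_dominated_convergence[where w = "\<lambda>t. \<bar>toll \<xi> t\<bar>"])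
    show "AE t in gw_tree \<xi>. (\<lambda>B. if tsize t \<le> B then toll \<xi> t else 0) \<longlonglongrightarrow> toll \<xi> t"
    proof (rule AE_I2)
      fix t
      have "\<forall>\<^sub>F B in sequentially. (if tsize t \<le> B then toll \<xi> t else 0) = toll \<xi> t"
        using eventually_ge_at_top[of "tsize t"] by eventually_elim simp
      thus "(\<lambda>B. if tsize t \<le> B then toll \<xi> t else 0) \<longlonglongrightarrow> toll \<xi> t" by (rule tendsto_eventually)
    qed
  qed (use assms in \<open>auto intro: integrable_abs\<close>)
  moreover have "expect (gw_tree \<xi>) (\<lambda>t. if tsize t \<le> B then toll \<xi> t else 0)
      = (\<Sum>t | tsize t \<le> B. toll \<xi> t * weight (pmf \<xi>) t)" for B
    by (subst integral_measure_pmf_real[OF finite_tsize_le[of B]])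
       (auto simp: pmf_gw_tree intro!: sum.cong split: if_splits)
  ultimately show ?thesis by simp
qed

text \<open>Dominated convergence with the majorant j^2: the finite second moment makes large
  degrees harmless.\<close>

lemma ln_fact_tail_limit:
  "(\<lambda>R. expect \<xi> (\<lambda>j. if R \<le> j then ln (fact j) else 0 :: real)) \<longlonglongrightarrow> 0"
proof -
  have "(\<lambda>R. expect \<xi> (\<lambda>j. if R \<le> j then ln (fact j) else 0 :: real)) \<longlonglongrightarrow> expect \<xi> (\<lambda>j. 0)"
  proof (rule integral_dominated_convergence[OF _ _ integrable_square])
    show "AE j in \<xi>. (\<lambda>R. if R \<le> j then ln (fact j) else 0) \<longlonglongrightarrow> (0::real)"
    proof (rule AE_I2)
      fix j
      have "\<forall>\<^sub>F R in sequentially. (if R \<le> j then ln (fact j) else 0) = (0::real)"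
        using eventually_gt_at_top[of j] by eventually_elim simp
      thus "(\<lambda>R. if R \<le> j then ln (fact j) else 0) \<longlonglongrightarrow> (0::real)" by (rule tendsto_eventually)
    qed
    show "AE j in \<xi>. norm (if R \<le> j then ln (fact j) else 0 :: real) \<le> (real j)\<^sup>2" for R
      using ln_fact_le_square by (auto simp: abs_of_nonneg fact_ge_1)
  qed auto
  thus ?thesis by simp
qed

text \<open>The toll of a vertex is bounded by a bounded functional of the next \<open>B\<close> letters plus a function
  of the current letter alone that vanishes below \<open>R\<close>.\<close>

lemma toll_split:
  assumes t: "prefix (outdegs t) xs" and i: "i < tsize t"
  shows "toll \<xi> (subs t ! i) \<le> ln (fact R) + tree_functional B (\<lambda>s. toll \<xi> s - ln (fact R)) (drop i xs)
       + (if R \<le> xs ! i then ln (fact (xs ! i)) else 0)"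
proof -
  have ts: "prefix (outdegs (subs t ! i)) (drop i xs)"
  proof -
    obtain vs where "xs = outdegs t @ vs" using t by (auto simp: prefix_def)
    hence "drop i xs = drop i (outdegs t) @ vs" using i by (simp add: tsize_def)
    thus ?thesis using prefix_subs[OF i] by (auto simp: prefix_def)
  qed
  have len: "i < length xs" using i prefix_length_le[OF t] by (simp add: tsize_def)
  have hd: "hd (outdegs (subs t ! i)) = xs ! i"
    using ts outdegs_nonempty[of "subs t ! i"] len by (auto simp: prefix_def hd_append hd_drop_conv_nth[symmetric])
  show ?thesis
  proof (cases "tsize (subs t ! i) \<le> B")
    case True
    thus ?thesis using tree_functional_eq[OF ts True] by (simp add: fact_ge_1)
  next
    case False
    have "tree_functional B (\<lambda>s. toll \<xi> s - ln (fact R)) (drop i xs) = 0"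
      by (rule tree_functional_eq_0) (use False prefix_outdegs_unique[OF ts] in auto)
    moreover have "toll \<xi> (subs t ! i) \<le> ln (fact (xs ! i))"
      using toll_le[of \<xi> "subs t ! i"] by (simp add: hd)
    moreover have "ln (fact (xs ! i)) \<le> ln (fact R) + (if R \<le> xs ! i then ln (fact (xs ! i)) else 0 :: real)"
      by (auto simp: fact_mono)
    ultimately show ?thesis by linarith
  qed
qed

text \<open>Subtracting ln R! inside the functional and adding it outside gives every window without
  a tree of size at most B the value ln R!. So the mean per position is the truncated expected toll
  plus ln R! P(|T| > B). The condition k + B <= n makes all k windows complete.\<close>

lemma local_toll_deviation:
  fixes \<eta> D :: real
  assumes D: "D > 0" "\<And>t. tsize t \<le> B \<Longrightarrow> \<bar>toll \<xi> t - ln (fact R)\<bar> \<le> D / 2"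
    and B: "B > 0" and k: "k + B \<le> n" and \<eta>: "\<eta> \<ge> 0"
    and \<mu>: "(\<Sum>t | tsize t \<le> B. toll \<xi> t * weight (pmf \<xi>) t) + ln (fact R) * tail B \<le> \<mu>"
  shows "prob (replicate_pmf n \<xi>)
     {xs. (\<Sum>i<k. ln (fact R) + tree_functional B (\<lambda>s. toll \<xi> s - ln (fact R)) (drop i xs)) \<ge> k * \<mu> + \<eta>}
     \<le> exp (- 2 * \<eta>\<^sup>2 / (n * (B * D)\<^sup>2))"
proof -
  define c :: real where "c = ln (fact R)"
  have c: "c \<ge> 0" by (simp add: c_def fact_ge_1)
  define \<psi> where "\<psi> = tree_functional B (\<lambda>s. toll \<xi> s - c)"
  define f where "f xs = (\<Sum>i<k. c + \<psi> (drop i xs))" for xs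
  have \<psi>: "\<bar>\<psi> ys\<bar> \<le> D / 2" for ys
    unfolding \<psi>_def using tree_functional_abs_le[of B _ "D/2" ys] D by (auto simp: c_def)
  have \<psi>D: "\<bar>\<psi> ys - \<psi> zs\<bar> \<le> D" for ys zs
    using \<psi>[of ys] \<psi>[of zs] by linarith
  have f: "\<bar>f xs\<bar> \<le> k * (c + D / 2)" for xs
  proof -
    have "\<bar>f xs\<bar> \<le> (\<Sum>i<k. \<bar>c + \<psi> (drop i xs)\<bar>)" unfolding f_def by (rule sum_abs)
    also have "\<dots> \<le> (\<Sum>i<k. c + D / 2)"
      by (intro sum_mono order_trans[OF abs_triangle_ineq] add_mono \<psi>) (use c in simp)
    finally show ?thesis by simp
  qed
  have i: "integrable (measure_pmf p) (\<lambda>x. \<psi> (g x))" for p :: "nat list pmf" and g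
    by (rule integrable_pmf_bounded[OF \<psi>])
  have "expect (replicate_pmf n \<xi>) f
      = (\<Sum>i<k. expect (replicate_pmf n \<xi>) (\<lambda>xs. c + \<psi> (drop i xs)))"
    unfolding f_def
    by (rule Bochner_Integration.integral_sum) (intro Bochner_Integration.integrable_add i measure_pmf.integrable_const)
  also have "\<dots> = (\<Sum>i<k. c + (\<Sum>t | tsize t \<le> B. (toll \<xi> t - c) * weight (pmf \<xi>) t))"
  proof (rule sum.cong[OF refl])
    fix i' assume "i' \<in> {..<k}"
    hence "B \<le> n - i'" using k by auto
    moreover have "expect (replicate_pmf n \<xi>) (\<lambda>xs. \<psi> (drop i' xs)) = expect (replicate_pmf (n - i') \<xi>) \<psi>"
      by (rule expectation_drop[OF \<psi>])
    ultimately have "expect (replicate_pmf n \<xi>) (\<lambda>xs. \<psi> (drop i' xs)) = (\<Sum>t | tsize t \<le> B. (toll \<xi> t - c) * weight (pmf \<xi>) t)"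
      using expectation_tree_functional[of B "n - i'" \<xi>] by (simp add: \<psi>_def)
    thus "expect (replicate_pmf n \<xi>) (\<lambda>xs. c + \<psi> (drop i' xs)) = c + (\<Sum>t | tsize t \<le> B. (toll \<xi> t - c) * weight (pmf \<xi>) t)"
      using Bochner_Integration.integral_add[OF measure_pmf.integrable_const i, of "replicate_pmf n \<xi>" c "drop i'"]
      by simp
  qed
  also have "c + (\<Sum>t | tsize t \<le> B. (toll \<xi> t - c) * weight (pmf \<xi>) t)
      = (\<Sum>t | tsize t \<le> B. toll \<xi> t * weight (pmf \<xi>) t) + c * tail B"
    using sum_weight_le[of B]
    by (simp only: left_diff_distrib sum_subtractf sum_distrib_left[symmetric]) (simp add: algebra_simps)
  also have "(\<Sum>i<k. \<dots>) \<le> k * \<mu>"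
    using \<mu> by (simp add: c_def mult_left_mono)
  finally have E: "expect (replicate_pmf n \<xi>) f \<le> k * \<mu>" .
  have "prob (replicate_pmf n \<xi>) {xs. f xs \<ge> k * \<mu> + \<eta>}
     \<le> prob (replicate_pmf n \<xi>) {xs. f xs \<ge> expect (replicate_pmf n \<xi>) f + \<eta>}"
    using E by (intro measure_pmf.finite_measure_mono) auto
  also have "\<dots> \<le> exp (- 2 * \<eta>\<^sup>2 / (n * (B * D)\<^sup>2))"
  proof (rule McDiarmid_upper[OF f])
    show "\<bar>f (xs[j := y]) - f xs\<bar> \<le> B * D" for xs j y
      using window_sum_update[where \<psi> = \<psi> and m = B and D = D and xs = xs and j = j and y = y and k = k] \<psi>D
      unfolding f_def by (simp add: \<psi>_def tree_functional_take sum.distrib)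
  qed (use B k D \<eta> in auto)
  finally show ?thesis by (simp add: f_def \<psi>_def c_def)
qed

text \<open>Degrees are truncated at n. By Markov's inequality some letter exceeds n with
  probability at most V / n, and for j <= n the bound ln j! <= j ln n yields a second moment of at
  most V ln^2 n for Chebyshev's inequality. For a of order n the total is O(ln^2 n / n).\<close>

lemma large_degree_deviation:
  assumes n: "n > 0" and a: "a > 0"
    and \<gamma>: "n * expect \<xi> (\<lambda>j. if R \<le> j then ln (fact j) else 0 :: real) \<le> a"
  shows "prob (replicate_pmf n \<xi>) {xs. (\<Sum>x\<leftarrow>xs. if R \<le> x then ln (fact x) else 0 :: real) \<ge> 2 * a}
     \<le> expect \<xi> (\<lambda>j. (real j)\<^sup>2) * (1 / n + n * (ln n)\<^sup>2 / a\<^sup>2)"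
proof -
  define V where "V = expect \<xi> (\<lambda>j. (real j)\<^sup>2)"
  define g :: "nat \<Rightarrow> real" where "g j = (if R \<le> j then ln (fact j) else 0)" for j
  define h :: "nat \<Rightarrow> real" where "h j = (if j \<le> n then g j else 0)" for j
  have g0: "g j \<ge> 0" for j by (simp add: g_def fact_ge_1)
  have gsq: "g j \<le> (real j)\<^sup>2" for j using ln_fact_le_square[of j] by (auto simp: g_def)
  have h: "0 \<le> h j" "h j \<le> g j" for j using g0 by (auto simp: h_def)
  have hle: "h j \<le> real j * ln n" for j
    using ln_fact_le[of j n] n by (auto simp: h_def g_def)
  have hb: "\<bar>h j\<bar> \<le> n * ln n" for j
    using h(1)[of j] hle[of j] n by (cases "j \<le> n") (auto simp: h_def intro: order_trans[OF _ mult_right_mono])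
  have ig: "integrable (measure_pmf \<xi>) g"
    by (rule Bochner_Integration.integrable_bound[OF integrable_square]) (use g0 gsq in auto)
  have Eh: "n * expect \<xi> h \<le> a"
  proof -
    have "expect \<xi> h \<le> expect \<xi> g"
      by (intro integral_mono integrable_pmf_bounded[OF hb] ig h)
    hence "n * expect \<xi> h \<le> n * expect \<xi> g" by (intro mult_left_mono) auto
    also have "\<dots> \<le> a" using \<gamma> by (simp add: g_def[abs_def])
    finally show ?thesis .
  qed
  have Eh2: "expect \<xi> (\<lambda>j. (h j)\<^sup>2) \<le> V * (ln n)\<^sup>2"
  proof -
    have "expect \<xi> (\<lambda>j. (h j)\<^sup>2) \<le> expect \<xi> (\<lambda>j. (real j)\<^sup>2 * (ln n)\<^sup>2)"
    proof (intro integral_mono)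
      show "integrable (measure_pmf \<xi>) (\<lambda>j. (h j)\<^sup>2)"
        by (rule integrable_pmf_bounded[of _ "(n * ln n)\<^sup>2"]) (use power_mono[OF hb, where n = 2] in simp)
      show "(h j)\<^sup>2 \<le> (real j)\<^sup>2 * (ln n)\<^sup>2" for j
        using power_mono[OF hle h(1), of j 2] by (simp add: power_mult_distrib)
    qed (use integrable_square in auto)
    thus ?thesis by (simp add: V_def)
  qed
  have big: "prob \<xi> {j. n < j} \<le> V / (real n)\<^sup>2"
  proof -
    have "prob \<xi> {j. n < j} \<le> prob \<xi> {j \<in> space (measure_pmf \<xi>). (real n)\<^sup>2 \<le> (real j)\<^sup>2}"
      by (intro measure_pmf.finite_measure_mono) (auto intro!: power_mono)
    also have "\<dots> \<le> V / (real n)\<^sup>2" unfolding V_def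
      by (rule integral_Markov_inequality_measure[of _ _ UNIV]) (use n integrable_square in auto)
    finally show ?thesis .
  qed
  have "prob (replicate_pmf n \<xi>) {xs. (\<Sum>x\<leftarrow>xs. g x) \<ge> 2 * a}
     \<le> prob (replicate_pmf n \<xi>) ({xs. \<exists>x\<in>set xs. n < x} \<union> {xs. (\<Sum>x\<leftarrow>take n xs. h x) \<ge> n * expect \<xi> h + a})"
  proof (rule prob_replicate_mono)
    fix xs :: "nat list" assume len: "length xs = n" and xs: "xs \<in> {xs. (\<Sum>x\<leftarrow>xs. g x) \<ge> 2 * a}"
    show "xs \<in> {xs. \<exists>x\<in>set xs. n < x} \<union> {xs. (\<Sum>x\<leftarrow>take n xs. h x) \<ge> n * expect \<xi> h + a}"
    proof (cases "\<exists>x\<in>set xs. n < x")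
      case False
      hence "map h xs = map g xs" by (auto simp: h_def)
      hence "(\<Sum>x\<leftarrow>xs. h x) = (\<Sum>x\<leftarrow>xs. g x)" by (rule arg_cong)
      thus ?thesis using xs len Eh by simp
    qed simp
  qed
  also have "\<dots> \<le> prob (replicate_pmf n \<xi>) {xs. \<exists>x\<in>set xs. n < x}
     + prob (replicate_pmf n \<xi>) {xs. (\<Sum>x\<leftarrow>take n xs. h x) \<ge> n * expect \<xi> h + a}"
    by (rule measure_Un_le) auto
  also have "\<dots> \<le> n * (V / (real n)\<^sup>2) + n * (V * (ln n)\<^sup>2) / a\<^sup>2"
  proof (rule add_mono)
    show "prob (replicate_pmf n \<xi>) {xs. \<exists>x\<in>set xs. n < x} \<le> n * (V / (real n)\<^sup>2)"
      by (rule order_trans[OF prob_exists_in_list]) (intro mult_left_mono big, simp)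
    show "prob (replicate_pmf n \<xi>) {xs. (\<Sum>x\<leftarrow>take n xs. h x) \<ge> n * expect \<xi> h + a}
       \<le> n * (V * (ln n)\<^sup>2) / a\<^sup>2"
      by (rule order_trans[OF Chebyshev_sum_list[OF hb a]]) (intro divide_right_mono mult_left_mono Eh2, auto)
  qed
  also have "\<dots> = V * (1 / n + n * (ln n)\<^sup>2 / a\<^sup>2)"
    using n by (simp add: field_simps power2_eq_square)
  finally show ?thesis by (simp add: g_def V_def)
qed

text \<open>The trees are read off as prefixes of one word of length L m + B. The excess \<eta> k
  over \<theta> k is spent as \<eta> k / 4 on the mean, \<eta> m / 4 on McDiarmid's inequality and
  \<eta> m / 2 on large degrees, where m < k. The union over the sizes k concerns only exponentially
  small probabilities: for the degrees a single event, about the sum over the whole word, serves all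
  k.\<close>

lemma shape_weight_deviation:
  fixes \<theta> \<eta> D :: real
  assumes D: "D > 0" "\<And>t. tsize t \<le> B \<Longrightarrow> \<bar>toll \<xi> t - ln (fact R)\<bar> \<le> D / 2"
    and B: "B > 0" and L: "L > 0" and m: "m > 0" and \<eta>: "\<eta> > 0"
    and \<mu>: "(\<Sum>t | tsize t \<le> B. toll \<xi> t * weight (pmf \<xi>) t) + ln (fact R) * tail B \<le> \<theta> + \<eta> / 4"
    and \<gamma>: "real (L * m + B) * expect \<xi> (\<lambda>j. if R \<le> j then ln (fact j) else 0 :: real) \<le> \<eta> * m / 4"
  shows "(\<Sum>t | m < tsize t \<and> tsize t \<le> L * m \<and> exp ((\<theta> + \<eta>) * tsize t) < shape_weight (pmf \<xi>) (shape t). weight (pmf \<xi>) t)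
     \<le> L * m * exp (- 2 * (\<eta> * m / 4)\<^sup>2 / (real (L * m + B) * (B * D)\<^sup>2))
       + expect \<xi> (\<lambda>j. (real j)\<^sup>2) * (1 / real (L * m + B) + real (L * m + B) * (ln (real (L * m + B)))\<^sup>2 / (\<eta> * m / 4)\<^sup>2)"
proof -
  let ?bad = "{t. m < tsize t \<and> tsize t \<le> L * m \<and> exp ((\<theta> + \<eta>) * tsize t) < shape_weight (pmf \<xi>) (shape t)}"
  define N where "N = L * m"
  define n where "n = N + B"
  define bad where "bad = {t \<in> ?bad. weight (pmf \<xi>) t > 0}"
  define g :: "nat \<Rightarrow> real" where "g j = (if R \<le> j then ln (fact j) else 0)" for j
  define f where "f k xs = (\<Sum>i<k. ln (fact R) + tree_functional B (\<lambda>s. toll \<xi> s - ln (fact R)) (drop i xs))" for k xs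
  have g0: "g j \<ge> 0" for j by (simp add: g_def fact_ge_1)
  define E1 where "E1 k = {xs. f k xs \<ge> k * (\<theta> + \<eta> / 4) + \<eta> * m / 4}" for k
  define E2 where "E2 = {xs. (\<Sum>x\<leftarrow>xs. g x) \<ge> 2 * (\<eta> * m / 4)}"
  let ?P = "replicate_pmf n \<xi>"
  have "finite ?bad" by (rule finite_subset[OF _ finite_tsize_le[of N]]) (auto simp: N_def)
  hence "(\<Sum>t\<in>?bad. weight (pmf \<xi>) t) = (\<Sum>t\<in>bad. weight (pmf \<xi>) t)"
    by (intro sum.mono_neutral_right) (auto simp: bad_def order_less_le weight_nonneg)
  also have "\<dots> = prob ?P {xs. \<exists>t\<in>bad. prefix (outdegs t) xs}"
    by (rule sum_weight_eq_prob[of _ N]) (auto simp: bad_def n_def N_def)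
  also have "\<dots> \<le> prob ?P ((\<Union>k\<in>{m<..N}. E1 k) \<union> E2)"
  proof (rule prob_replicate_mono)
    fix xs :: "nat list" assume len: "length xs = n" and "xs \<in> {xs. \<exists>t\<in>bad. prefix (outdegs t) xs}"
    then obtain t where t: "t \<in> bad" "prefix (outdegs t) xs" by blast
    define k where "k = tsize t"
    have k: "m < k" "k \<le> N" and gt: "exp ((\<theta> + \<eta>) * k) < shape_weight (pmf \<xi>) (shape t)" and w: "weight (pmf \<xi>) t > 0"
      using t(1) by (auto simp: bad_def k_def N_def)
    have "(\<theta> + \<eta>) * k < (\<Sum>s\<leftarrow>subs t. toll \<xi> s)"
      using gt unfolding shape_weight_eq_exp_toll[OF w] by simp
    also have "\<dots> = (\<Sum>i<k. toll \<xi> (subs t ! i))"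
      by (simp add: sum_list_sum_nth length_subs k_def atLeast0LessThan)
    also have "\<dots> \<le> (\<Sum>i<k. (ln (fact R) + tree_functional B (\<lambda>s. toll \<xi> s - ln (fact R)) (drop i xs)) + g (xs ! i))"
      unfolding g_def by (intro sum_mono toll_split[OF t(2)]) (simp add: k_def)
    also have "\<dots> = f k xs + (\<Sum>i<k. g (xs ! i))"
      by (simp add: f_def sum.distrib)
    also have "(\<Sum>i<k. g (xs ! i)) \<le> (\<Sum>i<n. g (xs ! i))"
      using k g0 by (intro sum_mono2) (auto simp: n_def)
    also have "\<dots> = (\<Sum>x\<leftarrow>xs. g x)"
      by (simp add: sum_list_sum_nth len atLeast0LessThan)
    finally have *: "(\<theta> + \<eta>) * k < f k xs + (\<Sum>x\<leftarrow>xs. g x)" by simp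
    show "xs \<in> (\<Union>k\<in>{m<..N}. E1 k) \<union> E2"
    proof (rule ccontr)
      assume "\<not> ?thesis"
      hence "xs \<notin> E1 k" "xs \<notin> E2" using k by auto
      hence "f k xs < k * (\<theta> + \<eta> / 4) + \<eta> * m / 4" "(\<Sum>x\<leftarrow>xs. g x) < 2 * (\<eta> * m / 4)"
        by (simp_all add: E1_def E2_def)
      moreover have "\<eta> * m \<le> \<eta> * k" using k \<eta> by simp
      ultimately show False using * by (simp add: algebra_simps)
    qed
  qed
  also have "\<dots> \<le> prob ?P (\<Union>k\<in>{m<..N}. E1 k) + prob ?P E2"
    by (rule measure_Un_le) auto
  also have "prob ?P (\<Union>k\<in>{m<..N}. E1 k) \<le> (\<Sum>k\<in>{m<..N}. prob ?P (E1 k))"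
    by (rule measure_UNION_le) auto
  also have "\<dots> \<le> (\<Sum>k\<in>{m<..N}. exp (- 2 * (\<eta> * m / 4)\<^sup>2 / (n * (B * D)\<^sup>2)))"
    unfolding E1_def f_def by (intro sum_mono local_toll_deviation[OF D B _ _ \<mu>]) (use \<eta> in \<open>auto simp: n_def\<close>)
  also have "\<dots> \<le> real N * exp (- 2 * (\<eta> * m / 4)\<^sup>2 / (n * (B * D)\<^sup>2))"
    by (simp add: mult_right_mono)
  also have "prob ?P E2 \<le> expect \<xi> (\<lambda>j. (real j)\<^sup>2) * (1 / n + n * (ln n)\<^sup>2 / (\<eta> * m / 4)\<^sup>2)"
    unfolding E2_def g_def by (rule large_degree_deviation) (use \<gamma> \<eta> m B in \<open>auto simp: n_def N_def\<close>)
  finally show ?thesis by (simp add: n_def N_def)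
qed

text \<open>The factor sqrt m is essential: the trees of size above m have probability of order
  m^(-1/2), and the exceptional ones must be negligible among them. The large degrees contribute
  O(ln^2 m / m), which is small enough.\<close>

theorem shape_weight_LLN:
  fixes \<eta> :: real
  assumes int: "integrable (measure_pmf (gw_tree \<xi>)) (toll \<xi>)" and \<eta>: "\<eta> > 0" and L: "L > 0"
  defines "\<theta> \<equiv> expect (gw_tree \<xi>) (toll \<xi>)"
  shows "(\<lambda>m. sqrt (real m) * (\<Sum>t | m < tsize t \<and> tsize t \<le> L * m \<and>
     exp ((\<theta> + \<eta>) * tsize t) < shape_weight (pmf \<xi>) (shape t). weight (pmf \<xi>) t)) \<longlonglongrightarrow> 0"
proof -
  \<comment> \<open>Order of the choices: R lets large degrees use at most half of the budget \<eta>
    m / 4 on L m letters, B depends on R through ln R!, and D bounds the finitely many values of the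
    functional for these B and R.\<close>
  define \<gamma> where "\<gamma> R = expect \<xi> (\<lambda>j. if R \<le> j then ln (fact j) else 0 :: real)" for R
  have "\<forall>\<^sub>F R in sequentially. \<gamma> R < \<eta> / (8 * L)"
    by (rule order_tendstoD(2)[OF ln_fact_tail_limit, folded \<gamma>_def]) (use \<eta> L in auto)
  then obtain R where R: "\<gamma> R < \<eta> / (8 * L)" by (auto simp: eventually_sequentially)
  have "(\<lambda>B. (\<Sum>t | tsize t \<le> B. toll \<xi> t * weight (pmf \<xi>) t) + ln (fact R) * tail B) \<longlonglongrightarrow> \<theta> + ln (fact R) * 0"
    unfolding \<theta>_def by (intro tendsto_intros truncated_toll_limit int tail_tendsto_0)
  hence "\<forall>\<^sub>F B in sequentially. (\<Sum>t | tsize t \<le> B. toll \<xi> t * weight (pmf \<xi>) t) + ln (fact R) * tail B < \<theta> + \<eta> / 4"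
    by (rule order_tendstoD(2)) (use \<eta> in simp)
  hence "\<forall>\<^sub>F B in sequentially. B > 0 \<and> (\<Sum>t | tsize t \<le> B. toll \<xi> t * weight (pmf \<xi>) t) + ln (fact R) * tail B < \<theta> + \<eta> / 4"
    using eventually_gt_at_top[of 0] by eventually_elim simp
  then obtain B where B: "B > 0" "(\<Sum>t | tsize t \<le> B. toll \<xi> t * weight (pmf \<xi>) t) + ln (fact R) * tail B \<le> \<theta> + \<eta> / 4"
    unfolding eventually_sequentially by (meson less_imp_le order_refl)
  define D where "D = 2 * (1 + (\<Sum>t | tsize t \<le> B. \<bar>toll \<xi> t - ln (fact R)\<bar>))"
  have D: "D > 0" "\<bar>toll \<xi> t - ln (fact R)\<bar> \<le> D / 2" if "tsize t \<le> B" for t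
  proof -
    have "\<bar>toll \<xi> t - ln (fact R)\<bar> \<le> (\<Sum>t | tsize t \<le> B. \<bar>toll \<xi> t - ln (fact R)\<bar>)"
      using that finite_tsize_le by (intro member_le_sum) auto
    thus "D > 0" "\<bar>toll \<xi> t - ln (fact R)\<bar> \<le> D / 2" by (auto simp: D_def)
  qed
  have D0: "D > 0" unfolding D_def by (intro mult_pos_pos add_pos_nonneg sum_nonneg) auto
  define V where "V = expect \<xi> (\<lambda>j. (real j)\<^sup>2)"
  define L' where "L' = real L" define B' where "B' = real B"
  have pos: "L' > 0" "B' > 0" using L B by (auto simp: L'_def B'_def)
  define bound where "bound m = L' * m * exp (- 2 * (\<eta> * m / 4)\<^sup>2 / ((L' * m + B') * (B' * D)\<^sup>2))
       + V * (1 / (L' * m + B') + (L' * m + B') * (ln (L' * m + B'))\<^sup>2 / (\<eta> * m / 4)\<^sup>2)" for m :: real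
  have "((\<lambda>x. sqrt x * bound x) \<longlongrightarrow> 0) at_top"
  proof -
    have a: "((\<lambda>x. sqrt x * (1 / (L' * x + B') + (L' * x + B') * (ln (L' * x + B'))\<^sup>2 / (\<eta> * x / 4)\<^sup>2)) \<longlongrightarrow> 0) at_top"
      using pos \<eta> by real_asymp
    define c where "c = (\<eta> / 4)\<^sup>2 * 2 / (B' * D)\<^sup>2"
    have c: "c > 0" using \<eta> pos D0 by (simp add: c_def)
    have "((\<lambda>x. sqrt x * (L' * x * exp (- c * x\<^sup>2 / (L' * x + B')))) \<longlongrightarrow> 0) at_top"
      using pos c by real_asymp
    moreover have "- 2 * (\<eta> * x / 4)\<^sup>2 / ((L' * x + B') * (B' * D)\<^sup>2) = - c * x\<^sup>2 / (L' * x + B')" for x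
      by (simp add: c_def power_mult_distrib power_divide)
    ultimately have b: "((\<lambda>x. sqrt x * (L' * x * exp (- 2 * (\<eta> * x / 4)\<^sup>2 / ((L' * x + B') * (B' * D)\<^sup>2)))) \<longlongrightarrow> 0) at_top"
      by presburger
    from tendsto_add[OF b tendsto_mult_left[OF a, of V]] show ?thesis
      by (simp add: bound_def algebra_simps)
  qed
  from filterlim_compose[OF this filterlim_real_sequentially]
  have lim: "(\<lambda>m. sqrt (real m) * bound (real m)) \<longlonglongrightarrow> 0" .
  have "\<forall>\<^sub>F m in sequentially. real m \<ge> B * \<gamma> R * 8 / \<eta>"
    using filterlim_real_sequentially unfolding filterlim_at_top by blast
  hence ev: "\<forall>\<^sub>F m in sequentially. (\<Sum>t | m < tsize t \<and> tsize t \<le> L * m \<and>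
     exp ((\<theta> + \<eta>) * tsize t) < shape_weight (pmf \<xi>) (shape t). weight (pmf \<xi>) t) \<le> bound (real m)"
    using eventually_gt_at_top[of 0]
  proof eventually_elim
    case (elim m)
    have "real (L * m) * \<gamma> R \<le> real (L * m) * (\<eta> / (8 * L))" using R by (intro mult_left_mono) auto
    also have "\<dots> = \<eta> * m / 8" using L by simp
    finally have "real (L * m + B) * \<gamma> R \<le> \<eta> * m / 4"
      using elim(1) \<eta> by (simp add: field_simps)
    from shape_weight_deviation[OF D0 D(2) B(1) L elim(2) \<eta> B(2) this[unfolded \<gamma>_def]]
    show ?case by (simp add: bound_def V_def L'_def B'_def)
  qed
  show ?thesis
  proof (rule tendsto_sandwich[OF _ _ tendsto_const lim])
    show "\<forall>\<^sub>F m in sequentially. 0 \<le> sqrt (real m) * (\<Sum>t | m < tsize t \<and> tsize t \<le> L * m \<and>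
     exp ((\<theta> + \<eta>) * tsize t) < shape_weight (pmf \<xi>) (shape t). weight (pmf \<xi>) t)"
      by (intro always_eventually allI mult_nonneg_nonneg sum_nonneg weight_nonneg) auto
    show "\<forall>\<^sub>F m in sequentially. sqrt (real m) * (\<Sum>t | m < tsize t \<and> tsize t \<le> L * m \<and>
     exp ((\<theta> + \<eta>) * tsize t) < shape_weight (pmf \<xi>) (shape t). weight (pmf \<xi>) t) \<le> sqrt (real m) * bound (real m)"
      using ev by eventually_elim (intro mult_left_mono, auto)
  qed
qed

end

section \<open>Asymptotics\<close>

lemma sqrt_ln_div_sqrt_floor:
  fixes q :: real
  assumes "q > 0"
  shows "(\<lambda>n::nat. sqrt (ln (real n)) / sqrt (real (nat \<lfloor>q * ln (real n)\<rfloor>))) \<longlonglongrightarrow> 1 / sqrt q"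
    and "(\<lambda>n::nat. sqrt (ln (real n)) / sqrt (real (nat \<lceil>q * ln (real n)\<rceil>))) \<longlonglongrightarrow> 1 / sqrt q"
proof -
  have eq: "1 / sqrt q = inverse (q powr (1/2))"
    using assms by (simp add: powr_half_sqrt inverse_eq_divide)
  show "(\<lambda>n::nat. sqrt (ln (real n)) / sqrt (real (nat \<lfloor>q * ln (real n)\<rfloor>))) \<longlonglongrightarrow> 1 / sqrt q"
    unfolding eq using assms by real_asymp
  show "(\<lambda>n::nat. sqrt (ln (real n)) / sqrt (real (nat \<lceil>q * ln (real n)\<rceil>))) \<longlonglongrightarrow> 1 / sqrt q"
    unfolding eq using assms by real_asymp
qed

context critical_offspring
begin

definition \<kappa> :: real where "\<kappa> = sqrt (2 / (pi * \<sigma>2))"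

lemma \<kappa>_pos: "\<kappa> > 0"
  using \<sigma>2_pos by (simp add: \<kappa>_def)

lemma tail_compose:
  assumes M: "filterlim M sequentially sequentially"
    and lim: "(\<lambda>n. sqrt (ln (real n)) / sqrt (real (M n))) \<longlonglongrightarrow> l"
  shows "(\<lambda>n. sqrt (ln (real n)) * tail (M n)) \<longlonglongrightarrow> l * \<kappa>"
proof -
  have "(\<lambda>n. sqrt (ln (real n)) / sqrt (real (M n)) * (sqrt (real (M n)) * tail (M n))) \<longlonglongrightarrow> l * \<kappa>"
    unfolding \<kappa>_def by (intro tendsto_mult lim filterlim_compose[OF tail_asymptotics M])
  moreover have "\<forall>\<^sub>F n in sequentially. sqrt (ln (real n)) / sqrt (real (M n)) * (sqrt (real (M n)) * tail (M n)) = sqrt (ln (real n)) * tail (M n)"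
    using eventually_compose_filterlim[OF eventually_gt_at_top[of 0] M] by eventually_elim simp
  ultimately show ?thesis by (rule Lim_transform_eventually)
qed

text \<open>A deviation \<delta> n / sqrt(ln n) with influence O(ln n) per letter has a McDiarmid
  exponent of order n / ln^3 n, which beats the sqrt n lost by conditioning. The bound n^(-2) is
  small enough for expectations, since the count is at most n.\<close>

lemma conditioning_cost:
  assumes c: "c > 0" and \<delta>: "\<delta> > 0"
  shows "\<forall>\<^sub>F n in sequentially. \<forall>R M. conditioned_tree \<xi> n R \<longrightarrow> 0 < M \<longrightarrow> real M \<le> c * ln (real n) \<longrightarrow>
     exp (- 2 * (\<delta> * (real n / sqrt (ln (real n))))\<^sup>2 / (n * (real M)\<^sup>2)) / tree_prob \<xi> n \<le> 1 / real n ^ 2"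
proof -
  obtain c0 where c0: "c0 > 0" "\<And>n. tree_prob \<xi> n > 0 \<Longrightarrow> tree_prob \<xi> n \<ge> c0 * exp (- sqrt (real n))"
    using tree_prob_lower_bound by blast
  have "((\<lambda>x. x\<^sup>2 * exp (sqrt x - 2 * (\<delta> / c)\<^sup>2 * x / (ln x) ^ 3)) \<longlongrightarrow> 0) at_top"
    using c \<delta> by real_asymp
  from order_tendstoD(2)[OF filterlim_compose[OF this filterlim_real_sequentially] c0(1)]
  show ?thesis using eventually_gt_at_top[of 1]
  proof eventually_elim
    case (elim n)
    show ?case
    proof (intro allI impI)
      fix R and M :: nat assume R: "conditioned_tree \<xi> n R" and M: "0 < M" "real M \<le> c * ln (real n)"
      have l: "ln (real n) > 0" using elim by simp
      have "2 * (\<delta> / c)\<^sup>2 * n / (ln n) ^ 3 = 2 * (\<delta> * (real n / sqrt (ln n)))\<^sup>2 / (n * (c * ln n)\<^sup>2)"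
        using c l elim by (simp add: field_simps power2_eq_square power3_eq_cube)
      also have "\<dots> \<le> 2 * (\<delta> * (real n / sqrt (ln n)))\<^sup>2 / (n * (real M)\<^sup>2)"
        using M elim by (intro divide_left_mono mult_left_mono power_mono mult_pos_pos) (auto simp: c l)
      finally have e: "exp (- 2 * (\<delta> * (real n / sqrt (ln n)))\<^sup>2 / (n * (real M)\<^sup>2)) \<le> exp (- (2 * (\<delta> / c)\<^sup>2 * n / (ln n) ^ 3))"
        by simp
      have tp: "tree_prob \<xi> n \<ge> c0 * exp (- sqrt n)" using R c0(2) by (auto simp: conditioned_tree_def)
      have "exp (- 2 * (\<delta> * (real n / sqrt (ln n)))\<^sup>2 / (n * (real M)\<^sup>2)) / tree_prob \<xi> n
          \<le> exp (- (2 * (\<delta> / c)\<^sup>2 * n / (ln n) ^ 3)) / (c0 * exp (- sqrt n))"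
        using tp e c0(1) by (intro frac_le) auto
      also have "\<dots> = exp (sqrt n - 2 * (\<delta> / c)\<^sup>2 * n / (ln n) ^ 3) / c0"
        by (simp add: exp_diff exp_minus field_simps)
      also have "\<dots> \<le> 1 / real n ^ 2"
        using elim c0(1) by (simp add: field_simps)
      finally show "exp (- 2 * (\<delta> * (real n / sqrt (ln (real n))))\<^sup>2 / (n * (real M)\<^sup>2)) / tree_prob \<xi> n \<le> 1 / real n ^ 2" .
    qed
  qed
qed

theorem distinct_fringe_upper_asymptotics:
  fixes b C e :: real
  assumes b: "b > 1" and C: "\<And>k. real (unordered_count M k) \<le> C * b ^ k" and e: "e > 0"
    and M: "\<And>j. pmf \<xi> j > 0 \<Longrightarrow> j \<in> M"
  shows "\<forall>\<^sub>F n in sequentially. \<forall>R. conditioned_tree \<xi> n R \<longrightarrow>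
     prob R {t. real (distinct_fringe t) \<ge> (1 + e) * (\<kappa> * sqrt (ln b) * (real n / sqrt (ln (real n))))} \<le> 1 / real n ^ 2"
proof -
  define l where "l = ln b"
  have l: "l > 0" using b by (simp add: l_def)
  have C0: "C \<ge> 0" using C[of 0] by (simp add: order_trans[OF of_nat_0_le_iff])
  \<comment> \<open>The tail may be too large by the factor r, so the size threshold is lowered to
    \<beta> ln n / ln b with \<beta> = 1 / r^2 < 1. Up to there are only O(n^\<beta> ln n) shapes. A
    further e / 4 goes to the deviation \<delta>.\<close>
  define r where "r = 1 + e / 2"
  have r: "r > 1" using e by (simp add: r_def)
  define \<beta> where "\<beta> = (1 / r)\<^sup>2"
  have \<beta>: "0 < \<beta>" "\<beta> < 1" using r by (auto simp: \<beta>_def power_less_one_iff)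
  have s\<beta>: "sqrt \<beta> = 1 / r" using r by (simp add: \<beta>_def)
  define m where "m n = nat \<lfloor>\<beta> / l * ln (real n)\<rfloor>" for n :: nat
  define \<delta> where "\<delta> = e / 4 * (\<kappa> * sqrt l)"
  have \<delta>: "\<delta> > 0" using e \<kappa>_pos l by (simp add: \<delta>_def)
  have c: "\<beta> / l > 0" using \<beta> l by simp
  have m_lim: "filterlim m sequentially sequentially" unfolding m_def using c by real_asymp
  have t: "(\<lambda>n. sqrt (ln (real n)) * tail (m n)) \<longlonglongrightarrow> 1 / sqrt (\<beta> / l) * \<kappa>"
    by (rule tail_compose[OF m_lim]) (use sqrt_ln_div_sqrt_floor(1)[OF c] in \<open>simp add: m_def\<close>)
  have "(\<lambda>n::nat. (C * (\<beta> / l * ln (real n) + 1) * real n powr \<beta> + \<beta> / l * ln (real n)) / (real n / sqrt (ln (real n)))) \<longlonglongrightarrow> 0"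
    using \<beta> c by real_asymp
  from tendsto_add[OF this tendsto_add[OF t tendsto_const[of \<delta>]]]
  have "(\<lambda>n. (C * (\<beta> / l * ln (real n) + 1) * real n powr \<beta> + \<beta> / l * ln (real n)) / (real n / sqrt (ln (real n)))
     + (sqrt (ln (real n)) * tail (m n) + \<delta>)) \<longlonglongrightarrow> 1 / sqrt (\<beta> / l) * \<kappa> + \<delta>" by simp
  moreover have "1 / sqrt (\<beta> / l) * \<kappa> + \<delta> < (1 + e) * (\<kappa> * sqrt l)"
  proof -
    have "1 / sqrt (\<beta> / l) = r * sqrt l" using r by (simp add: real_sqrt_divide s\<beta>)
    hence "1 / sqrt (\<beta> / l) * \<kappa> + \<delta> = (1 + e / 2 + e / 4) * (\<kappa> * sqrt l)"
      by (simp add: \<delta>_def r_def algebra_simps)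
    also have "\<dots> < (1 + e) * (\<kappa> * sqrt l)"
      using e \<kappa>_pos l by (intro mult_strict_right_mono) auto
    finally show ?thesis .
  qed
  ultimately have ev: "\<forall>\<^sub>F n in sequentially. (C * (\<beta> / l * ln (real n) + 1) * real n powr \<beta> + \<beta> / l * ln (real n)) / (real n / sqrt (ln (real n)))
     + (sqrt (ln (real n)) * tail (m n) + \<delta>) < (1 + e) * (\<kappa> * sqrt l)"
    by (rule order_tendstoD(2))
  show ?thesis
    using ev conditioning_cost[OF c \<delta>] eventually_compose_filterlim[OF eventually_gt_at_top[of 0] m_lim]
      eventually_gt_at_top[of 1]
  proof eventually_elim
    case (elim n)
    define x where "x = real n / sqrt (ln (real n))"
    have ln: "ln (real n) > 0" using elim by simp
    have x: "x > 0" using elim by (simp add: x_def)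
    have mle: "real (m n) \<le> \<beta> / l * ln (real n)" unfolding m_def using c ln by (intro of_nat_floor mult_nonneg_nonneg) auto
    have "b ^ m n \<le> real n powr \<beta>"
    proof -
      have "b ^ m n = exp (real (m n) * l)" using b by (simp add: l_def exp_of_nat_mult)
      also have "\<dots> \<le> exp (\<beta> * ln (real n))" using mle l by (simp add: field_simps)
      finally show ?thesis using elim by (simp add: powr_def)
    qed
    have U: "(\<Sum>k\<le>m n. real (unordered_count M k)) \<le> C * (\<beta> / l * ln (real n) + 1) * real n powr \<beta>"
    proof -
      have "(\<Sum>k\<le>m n. real (unordered_count M k)) \<le> (\<Sum>k\<le>m n. C * real n powr \<beta>)"
      proof (rule sum_mono)
        fix k assume "k \<in> {..m n}"
        hence "b ^ k \<le> b ^ m n" using b by (intro power_increasing) auto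
        hence "b ^ k \<le> real n powr \<beta>" using \<open>b ^ m n \<le> real n powr \<beta>\<close> by linarith
        thus "real (unordered_count M k) \<le> C * real n powr \<beta>"
          using C[of k] C0 by (meson mult_left_mono order_trans)
      qed
      also have "\<dots> = (real (m n) + 1) * (C * real n powr \<beta>)" by simp
      also have "\<dots> \<le> (\<beta> / l * ln (real n) + 1) * (C * real n powr \<beta>)"
        using mle C0 by (intro mult_right_mono) auto
      finally show ?thesis by (simp add: mult_ac)
    qed
    have nt: "n * tail (m n) = x * (sqrt (ln (real n)) * tail (m n))" using ln by (simp add: x_def)
    have "(\<Sum>k\<le>m n. real (unordered_count M k)) + n * tail (m n) + m n + \<delta> * x
       \<le> x * ((C * (\<beta> / l * ln (real n) + 1) * real n powr \<beta> + \<beta> / l * ln (real n)) / x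
         + (sqrt (ln (real n)) * tail (m n) + \<delta>))"
    proof -
      have eq: "x * ((p + q) / x + (t + \<delta>)) = p + q + x * t + \<delta> * x" for p q t
        using x by (simp add: field_simps)
      show ?thesis unfolding eq nt using U mle by linarith
    qed
    also have "\<dots> \<le> x * ((1 + e) * (\<kappa> * sqrt l))"
      using elim(1) x unfolding x_def[symmetric] by (intro mult_left_mono) auto
    finally have le: "(\<Sum>k\<le>m n. real (unordered_count M k)) + n * tail (m n) + m n + \<delta> * x
       \<le> (1 + e) * (\<kappa> * sqrt (ln b) * x)" by (simp add: l_def mult_ac)
    show ?case unfolding x_def[symmetric]
    proof (intro allI impI)
      fix R assume R: "conditioned_tree \<xi> n R"
      have "prob R {t. real (distinct_fringe t) \<ge> (1 + e) * (\<kappa> * sqrt (ln b) * x)}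
         \<le> prob R {t. real (distinct_fringe t) \<ge> (\<Sum>k\<le>m n. real (unordered_count M k)) + n * tail (m n) + m n + \<delta> * x}"
        by (intro measure_pmf.finite_measure_mono) (use le in auto)
      also have "\<dots> \<le> exp (- 2 * (\<delta> * x)\<^sup>2 / (n * (real (m n))\<^sup>2)) / tree_prob \<xi> n"
        by (rule distinct_fringe_upper_tail[OF R _ _ _ M]) (use elim \<delta> x in auto)
      also have "\<dots> \<le> 1 / real n ^ 2"
        using elim(2) R elim(3) mle unfolding x_def by blast
      finally show "prob R {t. real (distinct_fringe t) \<ge> (1 + e) * (\<kappa> * sqrt (ln b) * x)} \<le> 1 / real n ^ 2" .
    qed
  qed
qed

theorem distinct_fringe_lower_asymptotics:
  fixes e :: real
  assumes C2: "C2 = - expect (gw_tree \<xi>) (toll \<xi>)" "C2 > 0" and e: "0 < e" "e < 1"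
  shows "\<forall>\<^sub>F n in sequentially. \<forall>R. conditioned_tree \<xi> n R \<longrightarrow>
     prob R {t. real (distinct_fringe t) \<le> (1 - e) * (\<kappa> * sqrt C2 * (real n / sqrt (ln (real n))))} \<le> 1 / real n ^ 2"
proof -
  \<comment> \<open>A non-integrable function has expectation 0 by convention, so C2 > 0 forces
    integrability.\<close>
  have int: "integrable (measure_pmf (gw_tree \<xi>)) (toll \<xi>)"
    using C2 not_integrable_integral_eq[of "measure_pmf (gw_tree \<xi>)" "toll \<xi>"] by fastforce
  \<comment> \<open>A quarter of e each goes to the threshold \<alpha> ln n (through r), to cutting
    at size L m and to the deviation d; \<alpha> is slightly above 1 / C2.\<close>
  define r where "r = 1 - e / 4"
  have r: "0 < r" "r < 1" using e by (auto simp: r_def)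
  define \<alpha> where "\<alpha> = 1 / (C2 * r\<^sup>2)"
  have "\<alpha> * C2 = 1 / r\<^sup>2" using C2(2) by (simp add: \<alpha>_def)
  moreover have "r\<^sup>2 < 1" "r\<^sup>2 > 0" using r by (auto simp: power_less_one_iff)
  ultimately have \<alpha>: "\<alpha> > 0" "\<alpha> * C2 > 1" using C2(2) r by (auto simp: \<alpha>_def)
  have s\<alpha>: "1 / sqrt \<alpha> = r * sqrt C2" using r by (simp add: \<alpha>_def real_sqrt_divide real_sqrt_mult)
  \<comment> \<open>Chosen so that \<alpha> (C2 - \<eta>) = 1 + \<delta>: unexceptional shapes of
    size above \<alpha> ln n then have probability at most n^(-1-\<delta>), and n^2 n^(-1-\<delta>)
    repeats are negligible against n / sqrt(ln n).\<close>
  define \<eta> where "\<eta> = (\<alpha> * C2 - 1) / (2 * \<alpha>)"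
  define \<delta> where "\<delta> = (\<alpha> * C2 - 1) / 2"
  have \<eta>: "\<eta> > 0" and \<delta>: "\<delta> > 0" using \<alpha> by (auto simp: \<eta>_def \<delta>_def)
  have \<alpha>\<eta>: "\<alpha> * (C2 - \<eta>) = 1 + \<delta>" using \<alpha> by (simp add: \<eta>_def \<delta>_def field_simps)
  have C2\<eta>: "C2 - \<eta> > 0" using \<alpha>\<eta> \<alpha>(1) \<delta> zero_less_mult_pos[of \<alpha> "C2 - \<eta>"] by simp
  obtain L :: nat where L: "real L > (4 / e)\<^sup>2" using reals_Archimedean2 by blast
  have L0: "L > 0" using L e by (metis gr0I of_nat_0 not_less zero_le_power2)
  have sL: "1 / sqrt L \<le> e / 4"
  proof -
    have "4 / e \<le> sqrt L" using L e by (intro real_le_rsqrt) auto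
    thus ?thesis using e L0 by (simp add: field_simps)
  qed
  define m where "m n = nat \<lceil>\<alpha> * ln (real n)\<rceil>" for n :: nat
  define bad where "bad m = (\<Sum>t | m < tsize t \<and> tsize t \<le> L * m \<and>
     exp ((- C2 + \<eta>) * tsize t) < shape_weight (pmf \<xi>) (shape t). weight (pmf \<xi>) t)" for m
  define G where "G m = {t. m < tsize t \<and> tsize t \<le> L * m \<and> \<not> exp ((- C2 + \<eta>) * tsize t) < shape_weight (pmf \<xi>) (shape t)}" for m
  define W where "W m = (\<Sum>t\<in>G m. weight (pmf \<xi>) t)" for m
  have W: "W m = tail m - tail (L * m) - bad m" for m
  proof -
    have "m \<le> L * m" using L0 by simp
    have fin: "finite {t. m < tsize t \<and> tsize t \<le> L * m}"
      by (rule finite_subset[OF _ finite_tsize_le[of "L * m"]]) auto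
    have "tail m - tail (L * m) = (\<Sum>t | tsize t \<le> L * m. weight (pmf \<xi>) t) - (\<Sum>t | tsize t \<le> m. weight (pmf \<xi>) t)"
      by (simp add: sum_weight_le)
    also have "\<dots> = (\<Sum>t\<in>{t. tsize t \<le> L * m} - {t. tsize t \<le> m}. weight (pmf \<xi>) t)"
      by (rule sum_diff[symmetric]) (use finite_tsize_le in \<open>auto intro: le_trans[OF _ \<open>m \<le> L * m\<close>]\<close>)
    also have "{t. tsize t \<le> L * m} - {t. tsize t \<le> m} = {t. m < tsize t \<and> tsize t \<le> L * m}" by auto
    also have "(\<Sum>t | m < tsize t \<and> tsize t \<le> L * m. weight (pmf \<xi>) t) = bad m + W m"
      unfolding bad_def W_def G_def
      by (subst sum.union_disjoint[symmetric])
         (auto intro!: sum.cong finite_subset[OF _ fin])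
    finally show ?thesis by simp
  qed
  have m_lim: "filterlim m sequentially sequentially" unfolding m_def using \<alpha>(1) by real_asymp
  have ratio: "(\<lambda>n. sqrt (ln (real n)) / sqrt (real (m n))) \<longlonglongrightarrow> 1 / sqrt \<alpha>"
    unfolding m_def by (rule sqrt_ln_div_sqrt_floor(2)[OF \<alpha>(1)])
  have t1: "(\<lambda>n. sqrt (ln (real n)) * tail (m n)) \<longlonglongrightarrow> 1 / sqrt \<alpha> * \<kappa>"
    by (rule tail_compose[OF m_lim ratio])
  have t2: "(\<lambda>n. sqrt (ln (real n)) * tail (L * m n)) \<longlonglongrightarrow> (1 / sqrt \<alpha> / sqrt L) * \<kappa>"
  proof (rule tail_compose)
    show "filterlim (\<lambda>n. L * m n) sequentially sequentially"
      by (rule filterlim_at_top_mono[OF m_lim]) (use L0 in simp)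
    show "(\<lambda>n. sqrt (ln (real n)) / sqrt (real (L * m n))) \<longlonglongrightarrow> 1 / sqrt \<alpha> / sqrt L"
      using tendsto_divide[OF ratio tendsto_const[of "sqrt L"]] L0 by (simp add: real_sqrt_mult mult.commute)
  qed
  have "(\<lambda>m. sqrt (real m) * bad m) \<longlonglongrightarrow> 0"
    using shape_weight_LLN[OF int \<eta> L0] C2(1) by (simp add: bad_def)
  from tendsto_mult[OF ratio filterlim_compose[OF this m_lim]]
  have "(\<lambda>n. sqrt (ln (real n)) / sqrt (real (m n)) * (sqrt (real (m n)) * bad (m n))) \<longlonglongrightarrow> 0" by simp
  moreover have "\<forall>\<^sub>F n in sequentially. sqrt (ln (real n)) / sqrt (real (m n)) * (sqrt (real (m n)) * bad (m n)) = sqrt (ln (real n)) * bad (m n)"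
    using eventually_compose_filterlim[OF eventually_gt_at_top[of 0] m_lim] by eventually_elim simp
  ultimately have t3: "(\<lambda>n. sqrt (ln (real n)) * bad (m n)) \<longlonglongrightarrow> 0"
    by (rule Lim_transform_eventually)
  have Wlim: "(\<lambda>n. sqrt (ln (real n)) * W (m n)) \<longlonglongrightarrow> 1 / sqrt \<alpha> * \<kappa> * (1 - 1 / sqrt L)"
    using tendsto_diff[OF tendsto_diff[OF t1 t2] t3] by (simp add: W algebra_simps)
  define d where "d = e / 4 * (\<kappa> * sqrt C2)"
  have d: "d > 0" using e C2 \<kappa>_pos by (simp add: d_def)
  define L' where "L' = real L"
  have L': "L' > 0" using L0 by (simp add: L'_def)
  have one: "(\<lambda>n. 1 - L' * real (m n) / real n) \<longlonglongrightarrow> 1"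
    unfolding m_def using \<alpha>(1) L' by real_asymp
  have eps: "(\<lambda>n::nat. sqrt (ln (real n)) * real n powr - \<delta>) \<longlonglongrightarrow> 0"
    using \<delta> by real_asymp
  have lim: "(\<lambda>n. (1 - L' * real (m n) / real n) * (sqrt (ln (real n)) * W (m n)) - sqrt (ln (real n)) * real n powr - \<delta> - d)
     \<longlonglongrightarrow> 1 * (1 / sqrt \<alpha> * \<kappa> * (1 - 1 / sqrt L)) - 0 - d"
    by (intro tendsto_diff tendsto_mult one Wlim eps tendsto_const)
  have big: "(1 - e) * (\<kappa> * sqrt C2) < 1 * (1 / sqrt \<alpha> * \<kappa> * (1 - 1 / sqrt L)) - 0 - d"
  proof -
    have "r * (1 - e / 4) - e / 4 = (1 - e) + e / 4 + (e / 4)\<^sup>2"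
      by (simp add: r_def power2_eq_square algebra_simps)
    hence "(1 - e) < r * (1 - e / 4) - e / 4" using e(1) zero_le_power2[of "e / 4"] by linarith
    also have "\<dots> \<le> r * (1 - 1 / sqrt L) - e / 4"
      using sL r by (intro diff_right_mono mult_left_mono) auto
    finally have "(1 - e) * (\<kappa> * sqrt C2) < (r * (1 - 1 / sqrt L) - e / 4) * (\<kappa> * sqrt C2)"
      using \<kappa>_pos C2 by (intro mult_strict_right_mono) auto
    thus ?thesis unfolding s\<alpha> d_def by (simp add: algebra_simps)
  qed
  have cc: "L * (\<alpha> + 1) > 0" using L0 \<alpha> by simp
  have "\<forall>\<^sub>F n in sequentially. real (m n) \<le> (\<alpha> + 1) * ln (real n)"
    unfolding m_def using \<alpha>(1) by real_asymp
  thus ?thesis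
    using order_tendstoD(1)[OF lim big] conditioning_cost[OF cc d]
      eventually_compose_filterlim[OF eventually_gt_at_top[of 0] m_lim] eventually_gt_at_top[of 1]
  proof eventually_elim
    case (elim n)
    define x where "x = real n / sqrt (ln (real n))"
    have ln: "ln (real n) > 0" using elim by simp
    have x: "x > 0" using elim by (simp add: x_def)
    define N where "N = L * m n"
    define \<epsilon> where "\<epsilon> = real n powr (- 1 - \<delta>)"
    have N: "N > 0" "real N \<le> L * (\<alpha> + 1) * ln (real n)"
      using L0 elim by (auto simp: N_def)
    have GN: "G (m n) \<subseteq> {t. tsize t \<le> N}" by (auto simp: G_def N_def)
    have \<epsilon>: "shape_weight (pmf \<xi>) (shape s) \<le> \<epsilon>" if "s \<in> G (m n)" for s
    proof -
      have "shape_weight (pmf \<xi>) (shape s) \<le> exp ((- C2 + \<eta>) * tsize s)" "m n \<le> tsize s"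
        using that by (auto simp: G_def)
      note this(1)
      also have "exp ((- C2 + \<eta>) * tsize s) \<le> exp (- (C2 - \<eta>) * (\<alpha> * ln (real n)))"
      proof -
        have "\<alpha> * ln (real n) \<le> real (m n)" unfolding m_def by linarith
        hence "\<alpha> * ln (real n) \<le> tsize s" using \<open>m n \<le> tsize s\<close> by linarith
        hence "(C2 - \<eta>) * (\<alpha> * ln (real n)) \<le> (C2 - \<eta>) * tsize s" using C2\<eta> by (intro mult_left_mono) auto
        thus ?thesis by (simp add: algebra_simps)
      qed
      also have "- (C2 - \<eta>) * (\<alpha> * ln (real n)) = (- 1 - \<delta>) * ln (real n)"
      proof -
        have "- (C2 - \<eta>) * (\<alpha> * ln (real n)) = - (\<alpha> * (C2 - \<eta>)) * ln (real n)"
          by (simp add: algebra_simps)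
        also have "\<dots> = (- 1 - \<delta>) * ln (real n)" unfolding \<alpha>\<eta> by simp
        finally show ?thesis .
      qed
      finally show ?thesis using elim by (simp add: \<epsilon>_def powr_def)
    qed
    have "real n ^ 2 * \<epsilon> = x * (sqrt (ln (real n)) * real n powr - \<delta>)"
    proof -
      have "\<epsilon> = real n powr - \<delta> / real n" using elim by (simp add: \<epsilon>_def powr_diff powr_minus field_simps)
      thus ?thesis using ln elim by (simp add: x_def power2_eq_square)
    qed
    moreover have "(real n - real N) * W (m n) = x * ((1 - L' * real (m n) / real n) * (sqrt (ln (real n)) * W (m n)))"
      using ln elim by (simp add: x_def N_def L'_def field_simps)
    ultimately have "(real n - real N) * W (m n) - real n ^ 2 * \<epsilon> - d * x
      = x * ((1 - L' * real (m n) / real n) * (sqrt (ln (real n)) * W (m n)) - sqrt (ln (real n)) * real n powr - \<delta> - d)"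
      by (simp add: algebra_simps)
    moreover have "x * ((1 - e) * (\<kappa> * sqrt C2)) \<le> \<dots>"
      using elim(2) x by (intro mult_left_mono) auto
    ultimately have le: "(1 - e) * (\<kappa> * sqrt C2 * x) \<le> (real n - real N) * W (m n) - real n ^ 2 * \<epsilon> - d * x"
      by (simp add: mult_ac)
    show ?case unfolding x_def[symmetric]
    proof (intro allI impI)
      fix R assume R: "conditioned_tree \<xi> n R"
      have "prob R {t. real (distinct_fringe t) \<le> (1 - e) * (\<kappa> * sqrt C2 * x)}
         \<le> prob R {t. real (distinct_fringe t) \<le> (real n - real N) * (\<Sum>t\<in>G (m n). weight (pmf \<xi>) t) - real n ^ 2 * \<epsilon> - d * x}"
        by (intro measure_pmf.finite_measure_mono) (use le in \<open>auto simp: W_def\<close>)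
      also have "\<dots> \<le> exp (- 2 * (d * x)\<^sup>2 / (n * (real N)\<^sup>2)) / tree_prob \<xi> n"
        by (rule distinct_fringe_lower_tail[OF R _ _ _ GN \<epsilon>]) (use elim d x N in \<open>auto simp: \<epsilon>_def\<close>)
      also have "\<dots> \<le> 1 / real n ^ 2"
        using elim(3) R N unfolding x_def by blast
      finally show "prob R {t. real (distinct_fringe t) \<le> (1 - e) * (\<kappa> * sqrt C2 * x)} \<le> 1 / real n ^ 2" .
    qed
  qed
qed

end

section \<open>Simply generated families\<close>

lemma integrable_nat_pmf_iff:
  fixes f :: "nat \<Rightarrow> real"
  shows "integrable (measure_pmf p) f \<longleftrightarrow> summable (\<lambda>m. pmf p m * \<bar>f m\<bar>)"
proof -
  have "integrable (measure_pmf p) f \<longleftrightarrow> integrable (count_space UNIV) (\<lambda>m. pmf p m * f m)"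
    unfolding measure_pmf_eq_density by (subst integrable_density) auto
  also have "\<dots> \<longleftrightarrow> summable (\<lambda>m. norm (pmf p m * f m))"
    by (rule integrable_count_space_nat_iff)
  finally show ?thesis by (simp add: abs_mult)
qed

lemma expectation_nat_pmf_sums:
  fixes f :: "nat \<Rightarrow> real"
  assumes "integrable (measure_pmf p) f"
  shows "(\<lambda>m. pmf p m * f m) sums expect p f"
proof -
  have i: "integrable (count_space UNIV) (\<lambda>m. pmf p m * f m)"
    using assms unfolding measure_pmf_eq_density by (subst (asm) integrable_density) auto
  have "expect p f = integral\<^sup>L (count_space UNIV) (\<lambda>m. pmf p m * f m)"
    unfolding measure_pmf_eq_density by (subst integral_density) auto
  thus ?thesis using sums_integral_count_space_nat[OF i] by simp
qed

lemma pmf_offspring: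
  assumes \<phi>: "\<And>m. \<phi> m \<ge> 0" and \<tau>: "0 < \<tau>" and sm: "summable (\<lambda>m. \<phi> m * \<tau> ^ m)" and pos: "Phi \<phi> \<tau> > 0"
  shows "pmf (offspring \<phi> \<tau>) m = \<phi> m * \<tau> ^ m / Phi \<phi> \<tau>"
  unfolding offspring_def
proof (rule pmf_embed_pmf)
  show nn: "0 \<le> \<phi> m * \<tau> ^ m / Phi \<phi> \<tau>" for m using \<phi> \<tau> pos by simp
  have s: "summable (\<lambda>m. \<phi> m * \<tau> ^ m / Phi \<phi> \<tau>)" using sm by (rule summable_divide)
  have "(\<integral>\<^sup>+ m. ennreal (\<phi> m * \<tau> ^ m / Phi \<phi> \<tau>) \<partial>count_space UNIV) = (\<Sum>m. ennreal (\<phi> m * \<tau> ^ m / Phi \<phi> \<tau>))"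
    by (rule nn_integral_count_space_nat)
  also have "\<dots> = ennreal (\<Sum>m. \<phi> m * \<tau> ^ m / Phi \<phi> \<tau>)"
    by (rule suminf_ennreal2[OF nn s])
  also have "(\<Sum>m. \<phi> m * \<tau> ^ m / Phi \<phi> \<tau>) = 1"
    using suminf_divide[OF sm, of "Phi \<phi> \<tau>"] pos by (simp add: Phi_def)
  finally show "(\<integral>\<^sup>+ m. ennreal (\<phi> m * \<tau> ^ m / Phi \<phi> \<tau>) \<partial>count_space UNIV) = 1" by simp
qed

lemma sum_list_outdegs: "sum_list (outdegs t) = tsize t - 1"
  using fword_sum_list[OF fword_outdegs[of t]] by (simp add: tsize_def)

text \<open>The outdegrees sum to the size minus 1, so tilting multiplies all trees of one size by
  the same factor and leaves the conditioned law unchanged.\<close>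

lemma weight_rescale:
  "weight (\<lambda>m. \<phi> m * \<tau> ^ m / P) t = weight \<phi> t * (\<tau> ^ (tsize t - 1) / P ^ tsize t :: real)"
proof -
  have "(\<Prod>m\<leftarrow>xs. \<phi> m * \<tau> ^ m / P) = (\<Prod>m\<leftarrow>xs. \<phi> m) * (\<tau> ^ sum_list xs / P ^ length xs)" for xs
    by (induction xs) (auto simp: power_add)
  thus ?thesis unfolding weight_def sum_list_outdegs[symmetric] by (simp add: tsize_def)
qed

lemma pmf_random_tree:
  assumes \<phi>: "\<And>m. \<phi> m \<ge> 0" and pos: "(\<Sum>s | tsize s = n. weight \<phi> s) > 0"
  shows "pmf (random_tree \<phi> n) t = (if tsize t = n then weight \<phi> t / (\<Sum>s | tsize s = n. weight \<phi> s) else 0)"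
  unfolding random_tree_def
proof (rule pmf_embed_pmf)
  let ?S = "\<Sum>s | tsize s = n. weight \<phi> s"
  let ?f = "\<lambda>t. if tsize t = n then weight \<phi> t / ?S else 0"
  show nn: "0 \<le> ?f t" for t using weight_nonneg[OF \<phi>] pos by simp
  have "(\<integral>\<^sup>+ t. ennreal (?f t) \<partial>count_space UNIV) = (\<Sum>t | tsize t = n. ennreal (?f t))"
    by (rule nn_integral_count_space'[OF finite_tsize_eq]) auto
  also have "\<dots> = ennreal (\<Sum>t | tsize t = n. ?f t)" using nn by (rule sum_ennreal)
  also have "(\<Sum>t | tsize t = n. ?f t) = 1"
    using pos by (simp add: sum_divide_distrib[symmetric])
  finally show "(\<integral>\<^sup>+ t. ennreal (?f t) \<partial>count_space UNIV) = 1" by simp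
qed

lemma admissible_iff:
  assumes \<phi>: "\<And>m. \<phi> m \<ge> 0"
  shows "n \<in> admissible_sizes \<phi> \<longleftrightarrow> (\<Sum>s | tsize s = n. weight \<phi> s) > 0"
proof -
  have "(\<Sum>s | tsize s = n. weight \<phi> s) > 0 \<longleftrightarrow> (\<Sum>s | tsize s = n. weight \<phi> s) \<noteq> 0"
    using sum_nonneg[of "{s. tsize s = n}" "weight \<phi>"] weight_nonneg[OF \<phi>] by (auto simp: less_le)
  also have "\<dots> \<longleftrightarrow> \<not> (\<forall>s. tsize s = n \<longrightarrow> weight \<phi> s = 0)"
    using weight_nonneg[OF \<phi>] by (subst sum_nonneg_eq_0_iff) (auto simp: finite_tsize_eq)
  also have "\<dots> \<longleftrightarrow> n \<in> admissible_sizes \<phi>"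
    using weight_nonneg[OF \<phi>] by (auto simp: admissible_sizes_def less_le)
  finally show ?thesis ..
qed

text \<open>Every plane tree has a leaf. In this degenerate case \<open>size_filter\<close> is the
  trivial filter and the asymptotic claims hold vacuously.\<close>

lemma admissible_sizes_empty:
  assumes "\<phi> 0 = 0"
  shows "admissible_sizes \<phi> = {}"
proof -
  have "weight \<phi> t = 0" for t
    using zero_in_outdegs[of t] assms by (auto simp: weight_def prod_list_zero_iff image_iff intro: bexI[of _ 0])
  thus ?thesis by (auto simp: admissible_sizes_def)
qed

lemma eventually_size_filter: "eventually P (size_filter \<phi>) \<longleftrightarrow> (\<forall>\<^sub>F n in sequentially. n \<in> admissible_sizes \<phi> \<longrightarrow> P n)"
  by (simp add: size_filter_def eventually_inf_principal)

lemma unordered_count_eq_0: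
  assumes \<phi>: "\<And>m. \<phi> m \<ge> 0" and k: "k \<notin> admissible_sizes \<phi>"
  shows "unordered_count {m. \<phi> m > 0} k = 0"
proof -
  have "{u. size (uoutdegs u) = k \<and> set_mset (uoutdegs u) \<subseteq> {m. \<phi> m > 0}} = {}"
  proof safe
    fix u assume u: "k = size (uoutdegs u)" "set_mset (uoutdegs u) \<subseteq> {m. \<phi> m > 0}"
    obtain t where "shape t = u" using surj_shape by blast
    hence "tsize t = k" "weight \<phi> t > 0"
      using u tsize_shape[of t] by (auto simp: weight_pos_iff[OF \<phi>] uoutdegs_shape)
    thus "u \<in> {}" using k by (auto simp: admissible_sizes_def)
  qed
  thus ?thesis by (simp only: unordered_count_def card.empty)
qed

lemma unordered_count_pos:
  assumes \<phi>: "\<And>m. \<phi> m \<ge> 0" and k: "k \<in> admissible_sizes \<phi>"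
  shows "unordered_count {m. \<phi> m > 0} k \<ge> 1"
proof -
  obtain t where "tsize t = k" "weight \<phi> t > 0" using k by (auto simp: admissible_sizes_def)
  hence "shape t \<in> {u. size (uoutdegs u) = k \<and> set_mset (uoutdegs u) \<subseteq> {m. \<phi> m > 0}}"
    using tsize_shape[of t] by (auto simp: weight_pos_iff[OF \<phi>] uoutdegs_shape)
  hence "{u. size (uoutdegs u) = k \<and> set_mset (uoutdegs u) \<subseteq> {m. \<phi> m > 0}} \<noteq> {}" by blast
  hence "unordered_count {m. \<phi> m > 0} k > 0"
    unfolding unordered_count_def card_gt_0_iff using finite_unordered by blast
  thus ?thesis by simp
qed

text \<open>The tail bounds hold for each fixed tolerance, while a factor 1 + o(1) inside a
  probability asks for one null sequence of tolerances; a diagonal choice provides it.\<close>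

lemma diagonal_null_sequence:
  fixes P :: "nat \<Rightarrow> real \<Rightarrow> real"
  assumes P: "\<And>e. 0 < e \<Longrightarrow> e < 1 \<Longrightarrow> ((\<lambda>n. P n e) \<longlongrightarrow> 0) F" and F: "F \<le> sequentially"
    and nn: "\<And>n e. P n e \<ge> 0"
  obtains \<epsilon> where "(\<epsilon> \<longlongrightarrow> 0) F" "((\<lambda>n. P n (\<epsilon> n)) \<longlongrightarrow> 0) F"
proof -
  define d :: "nat \<Rightarrow> real" where "d j = 1 / (real j + 2)" for j
  have d: "0 < d j" "d j < 1" for j by (auto simp: d_def)
  define S where "S n = {j. j \<le> n \<and> P n (d j) \<le> d j}" for n
  have finS: "finite (S n)" for n by (rule finite_subset[of _ "{..n}"]) (auto simp: S_def)
  \<comment> \<open>the smallest tolerance \<open>d j\<close>, \<open>j \<le> n\<close>, that is already met at stage \<open>n\<close>\<close>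
  define \<epsilon> where "\<epsilon> n = d (Max (S n))" for n
  have ev: "\<forall>\<^sub>F n in F. 0 \<le> \<epsilon> n \<and> \<epsilon> n \<le> d j \<and> P n (\<epsilon> n) \<le> d j" for j
  proof -
    have "\<forall>\<^sub>F n in F. P n (d j) < d j" using P[OF d] by (rule order_tendstoD(2)) (rule d)
    moreover have "\<forall>\<^sub>F n in F. j \<le> n" using F eventually_ge_at_top[of j] by (rule filter_leD)
    ultimately show ?thesis
    proof eventually_elim
      case (elim n)
      hence j: "j \<in> S n" by (simp add: S_def)
      hence "Max (S n) \<in> S n" using finS by (intro Max_in) auto
      moreover have "j \<le> Max (S n)" using finS j by (rule Max_ge)
      hence "\<epsilon> n \<le> d j" unfolding \<epsilon>_def d_def by (intro divide_left_mono) auto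
      ultimately show ?case using less_imp_le[OF d(1)] by (auto simp: S_def \<epsilon>_def)
    qed
  qed
  have dlim: "d \<longlonglongrightarrow> 0" unfolding d_def by real_asymp
  have small: "\<exists>j. d j < e" if "e > 0" for e
    using order_tendstoD(2)[OF dlim that] by (auto simp: eventually_sequentially)
  show ?thesis
  proof (rule that[of \<epsilon>]; rule tendstoI)
    fix e :: real assume "e > 0"
    then obtain j where j: "d j < e" using small by blast
    show "\<forall>\<^sub>F n in F. dist (\<epsilon> n) 0 < e" using ev[of j] by eventually_elim (use j in auto)
    show "\<forall>\<^sub>F n in F. dist (P n (\<epsilon> n)) 0 < e" using ev[of j] by eventually_elim (use j nn in auto)
  qed
qed

lemma expectation_le_threshold:
  fixes f :: "'a \<Rightarrow> real"
  assumes fin: "finite (set_pmf p)" and f: "\<And>x. x \<in> set_pmf p \<Longrightarrow> f x \<le> n" and "X \<ge> 0" "n \<ge> 0"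
  shows "expect p f \<le> X + n * prob p {x. f x \<ge> X}"
proof -
  have i: "integrable (measure_pmf p) g" for g :: "'a \<Rightarrow> real" by (rule integrable_measure_pmf_finite[OF fin])
  have "expect p f \<le> expect p (\<lambda>x. X + n * indicator {x. f x \<ge> X} x)"
    using f assms(3,4) by (intro integral_mono_AE i AE_pmfI) (auto simp: indicator_def intro: add_increasing)
  also have "\<dots> = X + n * prob p {x. f x \<ge> X}" by (simp add: i)
  finally show ?thesis .
qed

lemma expectation_ge_threshold:
  fixes f :: "'a \<Rightarrow> real"
  assumes fin: "finite (set_pmf p)" and f: "\<And>x. f x \<ge> 0" and "X \<ge> 0"
  shows "expect p f \<ge> X * (1 - prob p {x. f x \<le> X})"
proof -
  have i: "integrable (measure_pmf p) g" for g :: "'a \<Rightarrow> real" by (rule integrable_measure_pmf_finite[OF fin])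
  have "X * (1 - prob p {x. f x \<le> X}) = expect p (\<lambda>x. X * (1 - indicator {x. f x \<le> X} x))"
    by (simp add: i)
  also have "\<dots> \<le> expect p f"
    using f assms(3) by (intro integral_mono i) (auto simp: indicator_def)
  finally show ?thesis .
qed

lemma prob_eventually_inverse_square:
  fixes P :: "nat \<Rightarrow> real"
  assumes "\<forall>\<^sub>F n in F. P n \<le> 1 / real n ^ 2" "\<And>n. P n \<ge> 0" "F \<le> sequentially"
  shows "(P \<longlongrightarrow> 0) F"
proof (rule tendsto_sandwich[OF _ assms(1) tendsto_const])
  have "(\<lambda>n::nat. 1 / real n ^ 2) \<longlonglongrightarrow> 0" by real_asymp
  thus "((\<lambda>n::nat. 1 / real n ^ 2) \<longlongrightarrow> 0) F" using assms(3) by (rule filterlim_mono[OF _ order_refl])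
qed (use assms(2) in simp)

text \<open>The condition on \<tau> says that the offspring mean is 1, and the second derivative of
  \<open>Phi \<phi>\<close> at \<tau> is the variance times \<open>Phi \<phi> \<tau>\<close> /
  \<tau>^2; inserting this turns \<open>kappa\<close> into sqrt(2 / (pi \<sigma>^2)).\<close>

lemma simply_generated_critical:
  fixes \<phi> :: "nat \<Rightarrow> real" and \<tau> :: real
  assumes \<phi>: "\<And>m. \<phi> m \<ge> 0" and \<tau>: "0 < \<tau>"
    and sm: "summable (\<lambda>m. \<phi> m * \<tau> ^ m)" and sm1: "summable (\<lambda>m. diffs \<phi> m * \<tau> ^ m)"
    and crit: "\<tau> * Phi (diffs \<phi>) \<tau> = Phi \<phi> \<tau>"
    and \<xi>: "\<xi> = offspring \<phi> \<tau>"
    and var: "integrable (measure_pmf \<xi>) (\<lambda>m. (real m - expect \<xi> real)\<^sup>2)"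
    and \<phi>0: "\<phi> 0 > 0"
  shows "critical_offspring \<xi>" "kappa \<phi> \<tau> = critical_offspring.\<kappa> \<xi>"
    "\<And>m. pmf \<xi> m > 0 \<Longrightarrow> \<phi> m > 0"
    "\<And>n. n \<in> admissible_sizes \<phi> \<Longrightarrow> conditioned_tree \<xi> n (random_tree \<phi> n)"
    "\<And>n. tree_prob \<xi> n > 0 \<Longrightarrow> n \<in> admissible_sizes \<phi>"
proof -
  define P where "P = Phi \<phi> \<tau>"
  have P: "P > 0" unfolding P_def Phi_def using sm \<phi> \<tau> \<phi>0 by (intro suminf_pos2[of _ 0]) auto
  have pmf: "pmf \<xi> m = \<phi> m * \<tau> ^ m / P" for m
    using pmf_offspring[OF \<phi> \<tau> sm] P unfolding \<xi> P_def by blast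
  have "(\<lambda>m. diffs \<phi> m * \<tau> ^ m) sums Phi (diffs \<phi>) \<tau>"
    unfolding Phi_def using sm1 by (rule summable_sums)
  from sums_mult[OF this, of \<tau>] have "(\<lambda>m. \<tau> * (diffs \<phi> m * \<tau> ^ m)) sums P"
    by (simp add: crit P_def)
  hence "(\<lambda>m. real (Suc m) * \<phi> (Suc m) * \<tau> ^ Suc m) sums P"
    by (simp add: diffs_def mult_ac)
  hence "(\<lambda>m. real m * \<phi> m * \<tau> ^ m) sums P"
    by (subst (asm) sums_Suc_iff) simp
  from sums_divide[OF this, of P] have m1: "(\<lambda>m. pmf \<xi> m * real m) sums 1"
    using P by (simp add: pmf mult_ac)
  hence int: "integrable (measure_pmf \<xi>) real"
    by (simp add: integrable_nat_pmf_iff sums_iff)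
  have mean: "expect \<xi> real = 1"
    using expectation_nat_pmf_sums[OF int] m1 by (rule sums_unique2)
  have "integrable (measure_pmf \<xi>) (\<lambda>m. (real m - 1)\<^sup>2 + (2 * real m - 1))"
    using var int unfolding mean by (intro Bochner_Integration.integrable_add Bochner_Integration.integrable_diff) auto
  hence sq: "integrable (measure_pmf \<xi>) (\<lambda>m. (real m)\<^sup>2)"
    by (simp add: power2_eq_square algebra_simps)
  show crit': "critical_offspring \<xi>"
    by unfold_locales (use sq mean \<phi>0 P in \<open>auto simp: pmf\<close>)
  interpret critical_offspring \<xi> by (rule crit')
  have "(\<lambda>m. pmf \<xi> m * (real m * (real m - 1))) sums \<sigma>2"
    unfolding \<sigma>2_def by (rule expectation_nat_pmf_sums[OF integrable_\<sigma>2])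
  \<comment> \<open>The terms for m = 0 and m = 1 vanish, so the series may start at 2, like that of
    the second derivative.\<close>
  hence "(\<lambda>m. pmf \<xi> (m + 2) * (real (m + 2) * (real (m + 2) - 1))) sums \<sigma>2"
    by (subst sums_iff_shift) (simp add: numeral_2_eq_2)
  from sums_mult2[OF this, of "P / \<tau>\<^sup>2"]
  have "(\<lambda>m. pmf \<xi> (m + 2) * (real (m + 2) * (real (m + 2) - 1)) * (P / \<tau>\<^sup>2)) sums (\<sigma>2 * (P / \<tau>\<^sup>2))" .
  moreover have "pmf \<xi> (m + 2) * (real (m + 2) * (real (m + 2) - 1)) * (P / \<tau>\<^sup>2) = diffs (diffs \<phi>) m * \<tau> ^ m" for m
  proof -
    have "pmf \<xi> (m + 2) * (P / \<tau>\<^sup>2) = \<phi> (m + 2) * \<tau> ^ m"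
      using P \<tau> by (simp add: pmf power_add power2_eq_square)
    moreover have "diffs (diffs \<phi>) m = real (m + 2) * (real (m + 2) - 1) * \<phi> (m + 2)"
      by (simp add: diffs_def algebra_simps)
    ultimately show ?thesis by (metis (no_types, opaque_lifting) mult.assoc mult.commute)
  qed
  ultimately have "(\<lambda>m. diffs (diffs \<phi>) m * \<tau> ^ m) sums (\<sigma>2 * (P / \<tau>\<^sup>2))" by simp
  hence Phi2: "Phi (diffs (diffs \<phi>)) \<tau> = \<sigma>2 * (P / \<tau>\<^sup>2)"
    unfolding Phi_def by (simp add: sums_iff)
  show "kappa \<phi> \<tau> = \<kappa>"
  proof -
    have "(2 * pi * (\<sigma>2 * (P / \<tau>\<^sup>2))) powr (-1/2) = inverse (sqrt (2 * pi * (\<sigma>2 * (P / \<tau>\<^sup>2))))"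
      using powr_minus[of "2 * pi * (\<sigma>2 * (P / \<tau>\<^sup>2))" "1/2"] \<sigma>2_pos P by (simp add: powr_half_sqrt)
    also have "\<dots> = \<tau> / (sqrt (2 * pi * \<sigma>2) * sqrt P)"
      using \<tau> by (simp add: real_sqrt_mult real_sqrt_divide inverse_eq_divide mult_ac)
    finally have "kappa \<phi> \<tau> = 2 * inverse \<tau> * sqrt P * (\<tau> / (sqrt (2 * pi * \<sigma>2) * sqrt P))"
      using P by (simp add: kappa_def Phi2 P_def powr_half_sqrt)
    also have "\<dots> = sqrt 4 / sqrt (2 * pi * \<sigma>2)" using \<tau> P by simp
    also have "\<dots> = sqrt (2 / (pi * \<sigma>2))"
      unfolding real_sqrt_divide[symmetric] by (rule arg_cong[of _ _ sqrt]) simp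
    finally show ?thesis by (simp add: \<kappa>_def)
  qed
  show "\<phi> m > 0" if "pmf \<xi> m > 0" for m
    using that \<phi>[of m] by (cases "\<phi> m = 0") (auto simp: pmf)
  have w: "weight (pmf \<xi>) t = weight \<phi> t * (\<tau> ^ (tsize t - 1) / P ^ tsize t)" for t
    using weight_rescale[of \<phi> \<tau> P t] by (simp add: pmf[abs_def])
  have tp: "tree_prob \<xi> n = (\<Sum>t | tsize t = n. weight \<phi> t) * (\<tau> ^ (n - 1) / P ^ n)" for n
    unfolding tree_prob_def sum_distrib_right by (intro sum.cong) (auto simp: w)
  have c: "\<tau> ^ (n - 1) / P ^ n > 0" for n using \<tau> P by simp
  show "n \<in> admissible_sizes \<phi>" if "tree_prob \<xi> n > 0" for n
    using zero_less_mult_pos2[OF that[unfolded tp] c] unfolding admissible_iff[OF \<phi>] .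
  show "conditioned_tree \<xi> n (random_tree \<phi> n)" if "n \<in> admissible_sizes \<phi>" for n
  proof -
    have pos: "(\<Sum>s | tsize s = n. weight \<phi> s) > 0" using that by (simp add: admissible_iff[OF \<phi>])
    have "tree_prob \<xi> n > 0" unfolding tp by (intro mult_pos_pos pos c)
    moreover have "weight \<phi> t / (\<Sum>s | tsize s = n. weight \<phi> s) = weight (pmf \<xi>) t / tree_prob \<xi> n" if "tsize t = n" for t
    proof -
      have "x / S = (x * k) / (S * k)" if "k > 0" for x S k :: real using that by simp
      from this[OF c[of n]] show ?thesis unfolding tp w that .
    qed
    ultimately show ?thesis
      unfolding conditioned_tree_def pmf_random_tree[OF \<phi> pos] by auto
  qed
qed

text \<open>At arbitrarily large admissible sizes there is at least one shape, which excludes b <=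
  1, where the asymptotic expression tends to 0. At inadmissible sizes there is none, and the
  finitely many sizes before the asymptotics sets in are absorbed by C, as b^k >= 1.\<close>

lemma unordered_count_growth:
  fixes \<phi> :: "nat \<Rightarrow> real" and a b :: real
  assumes \<phi>: "\<And>m. \<phi> m \<ge> 0" and nbot: "size_filter \<phi> \<noteq> bot" and ab: "a > 0" "b > 0"
    and asym: "(\<lambda>k. real (unordered_count {m. \<phi> m > 0} k)) \<sim>[size_filter \<phi>] (\<lambda>k. a * b ^ k * real k powr (-3/2))"
  shows "b > 1" "\<exists>C. \<forall>k. real (unordered_count {m. \<phi> m > 0} k) \<le> C * b ^ k"
proof -
  let ?F = "size_filter \<phi>" and ?u = "\<lambda>k. real (unordered_count {m. \<phi> m > 0} k)"
  have F: "?F \<le> sequentially" by (simp add: size_filter_def)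
  have adm: "\<forall>\<^sub>F n in ?F. n \<in> admissible_sizes \<phi>" by (simp add: eventually_size_filter)
  show b: "b > 1"
  proof (rule ccontr)
    assume "\<not> b > 1"
    hence b1: "b ^ k \<le> 1" for k using ab by (simp add: power_le_one)
    have "(\<lambda>k::nat. a * real k powr (-3/2)) \<longlonglongrightarrow> 0" using ab by real_asymp
    hence "((\<lambda>k::nat. a * real k powr (-3/2)) \<longlongrightarrow> 0) ?F" using F by (rule filterlim_mono[OF _ order_refl])
    hence "((\<lambda>k. a * b ^ k * real k powr (-3/2)) \<longlongrightarrow> 0) ?F"
    proof (rule Lim_null_comparison[rotated])
      show "\<forall>\<^sub>F k in ?F. norm (a * b ^ k * real k powr (-3/2)) \<le> a * real k powr (-3/2)"
      proof (intro always_eventually allI)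
        fix k
        have "a * b ^ k * real k powr (-3/2) \<le> a * 1 * real k powr (-3/2)"
          using ab b1 by (intro mult_right_mono mult_left_mono) auto
        thus "norm (a * b ^ k * real k powr (-3/2)) \<le> a * real k powr (-3/2)"
          using ab by (simp add: abs_mult)
      qed
    qed
    hence "(?u \<longlongrightarrow> 0) ?F" using tendsto_asymp_equiv_cong[OF asym] by blast
    hence "\<forall>\<^sub>F k in ?F. ?u k < 1" by (rule order_tendstoD(2)) simp
    with adm have "\<forall>\<^sub>F k in ?F. False"
    proof eventually_elim
      case (elim k)
      thus ?case using unordered_count_pos[OF \<phi> elim(1)] by simp
    qed
    with nbot show False by (simp add: trivial_limit_def)
  qed
  have "?u \<in> O[?F](\<lambda>k. a * b ^ k * real k powr (-3/2))" using asym by (rule asymp_equiv_imp_bigo)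
  then obtain c where c: "c > 0" "\<forall>\<^sub>F k in ?F. norm (?u k) \<le> c * norm (a * b ^ k * real k powr (-3/2))"
    by (rule landau_o.bigE)
  then obtain K where K: "\<And>k. k \<ge> K \<Longrightarrow> k \<in> admissible_sizes \<phi> \<Longrightarrow> ?u k \<le> c * norm (a * b ^ k * real k powr (-3/2))"
    unfolding eventually_size_filter eventually_sequentially by force
  define C where "C = c * a + (\<Sum>k<K. ?u k)"
  have s0: "(\<Sum>k<K. ?u k) \<ge> 0" by (intro sum_nonneg) auto
  have "?u k \<le> C * b ^ k" for k
  proof (cases "k < K")
    case True
    have "?u k \<le> (\<Sum>k<K. ?u k)" using True by (intro member_le_sum) auto
    also have "\<dots> \<le> C * 1" using c ab by (simp add: C_def)
    also have "\<dots> \<le> C * b ^ k" using c ab s0 b by (intro mult_left_mono one_le_power) (auto simp: C_def)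
    finally show ?thesis .
  next
    case False
    show ?thesis
    proof (cases "k \<in> admissible_sizes \<phi>")
      case True
      have "real k powr (-3/2) \<le> 1"
        using powr_mono[of "-3/2" 0 "real k"] by (cases "k = 0") auto
      have "?u k \<le> c * norm (a * b ^ k * real k powr (-3/2))" using K[of k] False True by simp
      also have "\<dots> = c * a * b ^ k * real k powr (-3/2)" using ab by (simp add: abs_mult)
      also have "\<dots> \<le> c * a * b ^ k * 1" using c ab \<open>real k powr (-3/2) \<le> 1\<close> by (intro mult_left_mono) auto
      also have "\<dots> \<le> C * b ^ k" using s0 ab by (simp add: C_def)
      finally show ?thesis .
    next
      case False
      thus ?thesis using unordered_count_eq_0[OF \<phi> False] c ab s0 by (simp add: C_def)
    qed
  qed
  thus "\<exists>C. \<forall>k. ?u k \<le> C * b ^ k" by blast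
qed

text \<open>For B <= 0 the lower bound is trivial, the count being nonnegative; this covers C2 <= 0,
  where the real \<open>sqrt\<close> is nonpositive. Hence the tail bound for B is demanded only
  under the premise B > 0.\<close>

lemma relative_bounds_from_tails:
  fixes f :: "nat \<Rightarrow> 'a \<Rightarrow> real" and p :: "nat \<Rightarrow> 'a pmf"
  assumes F: "F \<le> sequentially"
    and fin: "\<forall>\<^sub>F n in F. finite (set_pmf (p n)) \<and> (\<forall>x\<in>set_pmf (p n). f n x \<le> n)" and f0: "\<And>n x. f n x \<ge> 0"
    and A: "A > 0" and up: "\<And>e. e > 0 \<Longrightarrow> \<forall>\<^sub>F n in F. prob (p n) {x. f n x \<ge> (1 + e) * (A * (real n / sqrt (ln (real n))))} \<le> 1 / real n ^ 2"
    and lo: "B > 0 \<Longrightarrow> (\<And>e. 0 < e \<Longrightarrow> e < 1 \<Longrightarrow> \<forall>\<^sub>F n in F. prob (p n) {x. f n x \<le> (1 - e) * (B * (real n / sqrt (ln (real n))))} \<le> 1 / real n ^ 2)"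
  shows "\<exists>\<epsilon>\<^sub>1 \<epsilon>\<^sub>2 :: nat \<Rightarrow> real. (\<epsilon>\<^sub>1 \<longlongrightarrow> 0) F \<and> (\<epsilon>\<^sub>2 \<longlongrightarrow> 0) F \<and>
        (\<forall>\<^sub>F n in F. B * (real n / sqrt (ln (real n))) * (1 + \<epsilon>\<^sub>1 n) \<le> expect (p n) (f n) \<and>
           expect (p n) (f n) \<le> A * (real n / sqrt (ln (real n))) * (1 + \<epsilon>\<^sub>2 n))" (is ?E)
    and "\<exists>\<epsilon>\<^sub>1 \<epsilon>\<^sub>2 :: nat \<Rightarrow> real. (\<epsilon>\<^sub>1 \<longlongrightarrow> 0) F \<and> (\<epsilon>\<^sub>2 \<longlongrightarrow> 0) F \<and>
        ((\<lambda>n. prob (p n) {x. B * (real n / sqrt (ln (real n))) * (1 + \<epsilon>\<^sub>1 n) \<le> f n x \<and>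
            f n x \<le> A * (real n / sqrt (ln (real n))) * (1 + \<epsilon>\<^sub>2 n)}) \<longlongrightarrow> 1) F" (is ?P)
proof -
  define s where "s n = real n / sqrt (ln (real n))" for n :: nat
  define E where "E n = expect (p n) (f n)" for n
  have s0: "s n \<ge> 0" for n by (cases "n = 0") (auto simp: s_def)
  have E0: "E n \<ge> 0" for n unfolding E_def using f0 by (intro integral_nonneg_AE) auto
  have ev_s: "\<forall>\<^sub>F n in F. s n > 0 \<and> n > 1"
    using F by (rule filter_leD) (use eventually_gt_at_top[of 1] in \<open>eventually_elim, simp add: s_def\<close>)
  have trivial: "B * s n \<le> 0" if "\<not> B > 0" for n using that s0[of n] by (simp add: mult_nonpos_nonneg)

  \<comment> \<open>The smallest errors of the right sign that make the inequalities true; clipping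
    at 0 leaves only the excess in the wrong direction to be estimated.\<close>
  define \<epsilon>\<^sub>2 where "\<epsilon>\<^sub>2 n = max 0 (E n / (A * s n) - 1)" for n
  define \<epsilon>\<^sub>1 where "\<epsilon>\<^sub>1 n = (if B > 0 then min 0 (E n / (B * s n) - 1) else 0)" for n
  have "(\<epsilon>\<^sub>2 \<longlongrightarrow> 0) F"
  proof (rule tendstoI)
    fix e :: real assume e: "e > 0"
    have "\<forall>\<^sub>F n::nat in sequentially. 1 / real n / (real n / sqrt (ln (real n))) < A * (e / 2)"
    proof (rule order_tendstoD(2))
      show "(\<lambda>n::nat. 1 / real n / (real n / sqrt (ln (real n)))) \<longlonglongrightarrow> 0" by real_asymp
    qed (use A e in simp)
    hence "\<forall>\<^sub>F n in F. 1 / real n / s n < A * (e / 2)" unfolding s_def using F by (rule filter_leD[rotated])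
    thus "\<forall>\<^sub>F n in F. dist (\<epsilon>\<^sub>2 n) 0 < e" using up[OF half_gt_zero[OF e]] ev_s fin
    proof eventually_elim
      case (elim n)
      have As: "A * s n > 0" using A elim by simp
      have "E n \<le> (1 + e/2) * (A * s n) + real n * prob (p n) {x. f n x \<ge> (1 + e/2) * (A * s n)}"
        unfolding E_def using elim e As by (intro expectation_le_threshold) auto
      also have "\<dots> \<le> (1 + e/2) * (A * s n) + real n * (1 / real n ^ 2)"
        using elim(2) unfolding s_def by (intro add_left_mono mult_left_mono) auto
      also have "real n * (1 / real n ^ 2) = (1 / real n / s n) * s n"
        using elim by (simp add: power2_eq_square)
      also have "\<dots> < A * (e / 2) * s n" using elim by (intro mult_strict_right_mono) auto
      finally have "E n < (1 + e) * (A * s n)" by (simp add: algebra_simps)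
      hence "E n / (A * s n) < 1 + e" using As by (simp add: divide_less_eq)
      thus ?case using e by (simp add: \<epsilon>\<^sub>2_def)
    qed
  qed
  moreover have "(\<epsilon>\<^sub>1 \<longlongrightarrow> 0) F"
  proof (cases "B > 0")
    case True
    show ?thesis
    proof (rule tendstoI)
      fix e' :: real assume e': "e' > 0"
      \<comment> \<open>One factor 1 - e is lost to the threshold and one to the exceptional event,
        and (1 - e)^2 >= 1 - 2 e >= 1 - e'.\<close>
      define e where "e = min (e' / 2) (1 / 2)"
      have e: "0 < e" "e < 1" "2 * e \<le> e'" using e' by (auto simp: e_def)
      have "\<forall>\<^sub>F n::nat in sequentially. 1 / real n ^ 2 < e"
      proof (rule order_tendstoD(2))
        show "(\<lambda>n::nat. 1 / real n ^ 2) \<longlonglongrightarrow> 0" by real_asymp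
      qed (rule e)
      hence "\<forall>\<^sub>F n in F. 1 / real n ^ 2 < e" using F by (rule filter_leD[rotated])
      thus "\<forall>\<^sub>F n in F. dist (\<epsilon>\<^sub>1 n) 0 < e'" using lo[OF True e(1,2)] ev_s fin
      proof eventually_elim
        case (elim n)
        have Bs: "B * s n > 0" using True elim by simp
        have "(1 - e) * (1 - e) * (B * s n) < (1 - e) * (B * s n) * (1 - prob (p n) {x. f n x \<le> (1 - e) * (B * s n)})"
        proof -
          have "1 - e < 1 - prob (p n) {x. f n x \<le> (1 - e) * (B * s n)}"
            using elim(1,2) unfolding s_def by linarith
          moreover have "(1 - e) * (B * s n) > 0" by (rule mult_pos_pos) (use e Bs in auto)
          ultimately have "(1 - e) * (B * s n) * (1 - e) < (1 - e) * (B * s n) * (1 - prob (p n) {x. f n x \<le> (1 - e) * (B * s n)})"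
            by (rule mult_strict_left_mono)
          thus ?thesis by (simp add: mult_ac)
        qed
        also have "\<dots> \<le> E n"
          unfolding E_def using elim e Bs f0 by (intro expectation_ge_threshold) auto
        finally have "(1 - e) * (1 - e) < E n / (B * s n)" using Bs by (simp add: less_divide_eq)
        moreover have "(1 - e) * (1 - e) \<ge> 1 - 2 * e" by (simp add: algebra_simps)
        ultimately have "E n / (B * s n) - 1 > - e'" using e by linarith
        thus ?case using e' True by (auto simp: \<epsilon>\<^sub>1_def dist_real_def)
      qed
    qed
  next
    case False
    hence "\<epsilon>\<^sub>1 = (\<lambda>_. 0)" by (simp add: \<epsilon>\<^sub>1_def fun_eq_iff)
    thus ?thesis by simp
  qed
  moreover have "\<forall>\<^sub>F n in F. B * s n * (1 + \<epsilon>\<^sub>1 n) \<le> E n \<and> E n \<le> A * s n * (1 + \<epsilon>\<^sub>2 n)"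
    using ev_s
  proof eventually_elim
    case (elim n)
    have As: "A * s n > 0" using A elim by simp
    have "E n / (A * s n) \<le> 1 + \<epsilon>\<^sub>2 n" by (simp add: \<epsilon>\<^sub>2_def)
    hence "E n \<le> A * s n * (1 + \<epsilon>\<^sub>2 n)" using As by (simp add: divide_le_eq mult.commute)
    moreover have "B * s n * (1 + \<epsilon>\<^sub>1 n) \<le> E n"
    proof (cases "B > 0")
      case True
      hence Bs: "B * s n > 0" using elim by simp
      have "1 + \<epsilon>\<^sub>1 n \<le> E n / (B * s n)" using True by (simp add: \<epsilon>\<^sub>1_def)
      thus ?thesis using Bs by (simp add: le_divide_eq mult.commute)
    next
      case False
      thus ?thesis using trivial[OF False, of n] E0[of n] by (simp add: \<epsilon>\<^sub>1_def)
    qed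
    ultimately show ?case by blast
  qed
  ultimately show ?E unfolding s_def E_def by blast

  \<comment> \<open>Both exceptional probabilities enter one function of the tolerance, so that a
    single diagonal sequence serves the upper and the lower bound.\<close>
  define P where "P n e = prob (p n) {x. f n x \<ge> (1 + e) * (A * s n)} +
     (if B > 0 then prob (p n) {x. f n x \<le> (1 - e) * (B * s n)} else 0)" for n e
  have "((\<lambda>n. P n e) \<longlongrightarrow> 0) F" if "0 < e" "e < 1" for e
  proof -
    have "((\<lambda>n. prob (p n) {x. f n x \<ge> (1 + e) * (A * s n)}) \<longlongrightarrow> 0) F"
      unfolding s_def by (intro prob_eventually_inverse_square up that F) simp
    moreover have "((\<lambda>n. if B > 0 then prob (p n) {x. f n x \<le> (1 - e) * (B * s n)} else 0) \<longlongrightarrow> 0) F"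
    proof (cases "B > 0")
      case True
      have "((\<lambda>n. prob (p n) {x. f n x \<le> (1 - e) * (B * s n)}) \<longlongrightarrow> 0) F"
        unfolding s_def by (intro prob_eventually_inverse_square lo[OF True] that F) simp
      thus ?thesis using True by simp
    qed simp
    ultimately show ?thesis unfolding P_def using tendsto_add by fastforce
  qed
  then obtain \<epsilon> where \<epsilon>: "(\<epsilon> \<longlongrightarrow> 0) F" "((\<lambda>n. P n (\<epsilon> n)) \<longlongrightarrow> 0) F"
    by (rule diagonal_null_sequence[OF _ F, of P]) (auto simp: P_def)
  define \<delta> where "\<delta> n = (if B > 0 then - \<epsilon> n else 0)" for n
  have "(\<delta> \<longlongrightarrow> 0) F" using tendsto_minus[OF \<epsilon>(1)] by (cases "B > 0") (simp_all add: \<delta>_def[abs_def])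
  moreover have "((\<lambda>n. prob (p n) {x. B * s n * (1 + \<delta> n) \<le> f n x \<and> f n x \<le> A * s n * (1 + \<epsilon> n)}) \<longlongrightarrow> 1) F"
  proof (rule tendsto_sandwich[OF _ _ _ tendsto_const])
    show "\<forall>\<^sub>F n in F. 1 - P n (\<epsilon> n) \<le> prob (p n) {x. B * s n * (1 + \<delta> n) \<le> f n x \<and> f n x \<le> A * s n * (1 + \<epsilon> n)}"
    proof (intro always_eventually allI)
      fix n
      let ?G = "{x. B * s n * (1 + \<delta> n) \<le> f n x \<and> f n x \<le> A * s n * (1 + \<epsilon> n)}"
      let ?U = "{x. f n x \<ge> (1 + \<epsilon> n) * (A * s n)}"
      let ?L = "if B > 0 then {x. f n x \<le> (1 - \<epsilon> n) * (B * s n)} else {}"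
      have "1 - prob (p n) ?G = prob (p n) (- ?G)"
        using measure_pmf.prob_compl[of ?G "p n"] by (simp add: Compl_eq_Diff_UNIV)
      also have "\<dots> \<le> prob (p n) (?U \<union> ?L)"
      proof (rule measure_pmf.finite_measure_mono)
        show "- ?G \<subseteq> ?U \<union> ?L"
        proof
          fix x assume "x \<in> - ?G"
          hence "\<not> (B * s n * (1 + \<delta> n) \<le> f n x) \<or> f n x \<ge> (1 + \<epsilon> n) * (A * s n)"
            by (auto simp: mult_ac)
          moreover have "x \<in> ?L" if "\<not> (B * s n * (1 + \<delta> n) \<le> f n x)"
          proof (cases "B > 0")
            case False
            thus ?thesis using that trivial[OF False, of n] f0[of n x] by (simp add: \<delta>_def)
          qed (use that in \<open>auto simp: \<delta>_def mult_ac\<close>)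
          ultimately show "x \<in> ?U \<union> ?L" by blast
        qed
      qed simp
      also have "\<dots> \<le> prob (p n) ?U + prob (p n) ?L" by (rule measure_Un_le) auto
      also have "\<dots> = P n (\<epsilon> n)" by (simp add: P_def)
      finally show "1 - P n (\<epsilon> n) \<le> prob (p n) ?G" by linarith
    qed
    show "((\<lambda>n. 1 - P n (\<epsilon> n)) \<longlongrightarrow> 1) F" using tendsto_diff[OF tendsto_const[of 1] \<epsilon>(2)] by simp
  qed (simp add: always_eventually)
  ultimately show ?P using \<epsilon>(1) unfolding s_def by blast
qed

theorem theorem11:
  fixes \<phi> :: "nat \<Rightarrow> real" and \<tau> a b C1 C2 :: real and \<xi> :: "nat pmf" and M :: "nat set"
  assumes "\<And>m. \<phi> m \<ge> 0"
    and "0 < \<tau>" and "ereal \<tau> \<le> conv_radius \<phi>"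
    and "summable (\<lambda>m. \<phi> m * \<tau> ^ m)" and "summable (\<lambda>m. diffs \<phi> m * \<tau> ^ m)"
    and "\<tau> * Phi (diffs \<phi>) \<tau> = Phi \<phi> \<tau>"
    and "\<xi> = offspring \<phi> \<tau>"
    and "integrable (measure_pmf \<xi>) (\<lambda>m. (real m - measure_pmf.expectation \<xi> real)\<^sup>2)"
    and "M = {m. \<phi> m > 0}"
    and "a > 0" and "b > 0"
    and "(\<lambda>k. real (unordered_count M k)) \<sim>[size_filter \<phi>]
           (\<lambda>k. a * b ^ k * real k powr (-3/2))"
    and "C1 = ln b"
    and "C2 = - measure_pmf.expectation (gw_tree \<xi>) (toll \<xi>)"
  shows
    "(\<exists>\<epsilon>\<^sub>1 \<epsilon>\<^sub>2 :: nat \<Rightarrow> real.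
        \<epsilon>\<^sub>1 \<in> o[size_filter \<phi>](\<lambda>_. 1) \<and> \<epsilon>\<^sub>2 \<in> o[size_filter \<phi>](\<lambda>_. 1) \<and>
        (\<forall>\<^sub>F n in size_filter \<phi>.
           kappa \<phi> \<tau> * sqrt C2 * (real n / sqrt (ln (real n))) * (1 + \<epsilon>\<^sub>1 n)
             \<le> measure_pmf.expectation (random_tree \<phi> n) (\<lambda>t. real (distinct_fringe t)) \<and>
           measure_pmf.expectation (random_tree \<phi> n) (\<lambda>t. real (distinct_fringe t))
             \<le> kappa \<phi> \<tau> * sqrt C1 * (real n / sqrt (ln (real n))) * (1 + \<epsilon>\<^sub>2 n))) \<and>
     (\<exists>\<epsilon>\<^sub>1 \<epsilon>\<^sub>2 :: nat \<Rightarrow> real.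
        \<epsilon>\<^sub>1 \<in> o[size_filter \<phi>](\<lambda>_. 1) \<and> \<epsilon>\<^sub>2 \<in> o[size_filter \<phi>](\<lambda>_. 1) \<and>
        ((\<lambda>n. measure_pmf.prob (random_tree \<phi> n)
           {t. kappa \<phi> \<tau> * sqrt C2 * (real n / sqrt (ln (real n))) * (1 + \<epsilon>\<^sub>1 n)
                 \<le> real (distinct_fringe t) \<and>
               real (distinct_fringe t)
                 \<le> kappa \<phi> \<tau> * sqrt C1 * (real n / sqrt (ln (real n))) * (1 + \<epsilon>\<^sub>2 n)})
           \<longlongrightarrow> 1) (size_filter \<phi>))"
proof (cases "\<phi> 0 = 0")
  case True
  hence "size_filter \<phi> = bot"
    by (simp add: size_filter_def admissible_sizes_empty)
  thus ?thesis by (auto intro!: exI[of _ "\<lambda>_. 0"])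
next
  case False
  hence \<phi>0: "\<phi> 0 > 0" using assms(1)[of 0] by simp
  let ?F = "size_filter \<phi>" and ?R = "random_tree \<phi>"
  note scrit = simply_generated_critical[OF assms(1,2,4-8) \<phi>0]
  interpret critical_offspring \<xi> by (rule scrit(1))
  have F: "?F \<le> sequentially" by (simp add: size_filter_def)
  have lift: "\<forall>\<^sub>F n in ?F. Q n (?R n)" if "\<forall>\<^sub>F n in sequentially. \<forall>R. conditioned_tree \<xi> n R \<longrightarrow> Q n R" for Q
    unfolding eventually_size_filter using that by eventually_elim (use scrit(4) in blast)
  \<comment> \<open>Arbitrarily large sizes have positive probability by
    \<open>tree_prob_window\<close>, so the limit along admissible sizes is not vacuous; b > 1
    relies on this.\<close>
  have nbot: "?F \<noteq> bot"
  proof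
    assume "?F = bot"
    hence "\<forall>\<^sub>F n in sequentially. n \<notin> admissible_sizes \<phi>"
      using eventually_size_filter[of "\<lambda>_. False" \<phi>] by simp
    then obtain K where K: "\<And>n. n \<ge> K \<Longrightarrow> n \<notin> admissible_sizes \<phi>" unfolding eventually_sequentially by blast
    obtain c m0 where c: "c > 0" "m0 > 0" "\<And>m. m \<ge> m0 \<Longrightarrow> \<exists>k. m < k \<and> k \<le> 16 * m \<and> tree_prob \<xi> k \<ge> c / real m ^ 2"
      using tree_prob_window by blast
    obtain k where k: "K + m0 < k" "tree_prob \<xi> k \<ge> c / real (K + m0) ^ 2" using c(3)[of "K + m0"] by auto
    moreover have "c / real (K + m0) ^ 2 > 0" using c by simp
    ultimately show False using scrit(5)[of k] K[of k] by simp
  qed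
  have b: "b > 1" using unordered_count_growth(1)[OF assms(1) nbot assms(10,11)] assms(9,12) by simp
  obtain C where C: "\<And>k. real (unordered_count M k) \<le> C * b ^ k"
    using unordered_count_growth(2)[OF assms(1) nbot assms(10,11)] assms(9,12) by auto
  have M: "pmf \<xi> j > 0 \<Longrightarrow> j \<in> M" for j using scrit(3) by (simp add: assms(9))
  have fin: "\<forall>\<^sub>F n in ?F. finite (set_pmf (?R n)) \<and> (\<forall>t\<in>set_pmf (?R n). real (distinct_fringe t) \<le> n)"
  proof (rule lift, rule always_eventually, safe)
    fix n R assume R: "conditioned_tree \<xi> n R"
    show "finite (set_pmf R)"
      by (rule finite_subset[OF _ finite_tsize_eq[of n]]) (use conditioned_tree_tsize[OF R] in auto)
    show "real (distinct_fringe t) \<le> n" if "t \<in> set_pmf R" for t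
      using conditioned_tree_tsize(1)[OF R that] distinct_fringe_le_tsize[of t] by simp
  qed
  have A: "\<kappa> * sqrt (ln b) > 0" using \<kappa>_pos b by simp
  have up: "\<forall>\<^sub>F n in ?F. prob (?R n) {t. real (distinct_fringe t) \<ge> (1 + e) * (\<kappa> * sqrt (ln b) * (real n / sqrt (ln (real n))))} \<le> 1 / real n ^ 2"
    if "e > 0" for e
    by (rule lift[OF distinct_fringe_upper_asymptotics[OF b C that M]])
  have lo: "\<forall>\<^sub>F n in ?F. prob (?R n) {t. real (distinct_fringe t) \<le> (1 - e) * (\<kappa> * sqrt C2 * (real n / sqrt (ln (real n))))} \<le> 1 / real n ^ 2"
    if "\<kappa> * sqrt C2 > 0" "0 < e" "e < 1" for e
  proof (rule lift[OF distinct_fringe_lower_asymptotics[OF assms(14) _ that(2,3)]])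
    show "C2 > 0" using that(1) \<kappa>_pos by (simp add: zero_less_mult_iff)
  qed
  have small: "(\<epsilon> \<longlongrightarrow> 0) ?F \<Longrightarrow> \<epsilon> \<in> o[?F](\<lambda>_. 1)" for \<epsilon> :: "nat \<Rightarrow> real"
    by (rule smalloI_tendsto) auto
  note bounds = relative_bounds_from_tails[OF F fin of_nat_0_le_iff A up lo]
  show ?thesis
    unfolding scrit(2) assms(13)
    by (rule conjI; (insert bounds small, blast))
qed

end
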